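(* Let $\rho:\Gamma=SL(2,\mathbb{Z})\to GL(2,\mathbb{C})$ be an irreducible representation such that $\rho(T)=\mathrm{diag}(e^{2\pi i m_1},e^{2\pi i m_2})$ with $1>m_1>m_2\ge 0$. Suppose that $\rho$ has finite projective level $M$ and that $M$ does not divide $60$. Then for every integer $k$, every nonzero $F\in\mathcal{H}(k,\rho)_{\mathbb{Q}}$ has unbounded denominators.
   Context: $S=\begin{pmatrix}0&-1\\1&0\end{pmatrix}$, $T=\begin{pmatrix}1&1\\0&1\end{pmatrix}$, $q=e^{2\pi i\tau}$, $q^{m}=e^{2\pi i m\tau}$. A holomorphic vector-valued modular form of integral weight $k$ associated to $\rho$ is a column vector $F(\tau)=(f_1(\tau),f_2(\tau))^t$ of holomorphic functions on the upper half-plane with $q$-expansions $f_i(\tau)=\sum_{n\ge0}a_{n,i}q^{m_i+n}$ ($i=1,2$) satisfying $(c\tau+d)^{-k}F(\gamma\tau)=\rho(\gamma)F(\tau)$ for all $\gamma=\begin{pmatrix}a&b\\c&d\end{pmatrix}\in\Gamma$. $\mathcal{H}(k,\rho)$ denotes the space of these, and $\mathcal{H}(k,\rho)_{\mathbb{Q}}$ the subset of those with all $a_{n,i}\in\mathbb{Q}$. Such $F$ has bounded denominators if there is a nonzero integer $B$ with $Ba_{n,i}\in\mathbb{Z}$ for all $n\ge0$, $i=1,2$; otherwise it has unbounded denominators. The projective level of $\rho$ is the order of the image of $\rho(T)$ in $PGL(2,\mathbb{C})$. *)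

theory Defs
  imports "HOL-Complex_Analysis.Complex_Analysis" "HOL-Algebra.Algebra"
begin

section \<open>Groups of two-by-two matrices\<close>

definition SL2Z :: "(int^2^2) monoid" where
  "SL2Z = \<lparr>carrier = {A. det A = 1}, mult = (**), one = mat 1\<rparr>"

definition GL2C :: "(complex^2^2) monoid" where
  "GL2C = \<lparr>carrier = {A. invertible A}, mult = (**), one = mat 1\<rparr>"

definition scalars_GL2C :: "(complex^2^2) set" where
  "scalars_GL2C = {mat c |c. c \<noteq> 0}"

definition PGL2C :: "(complex^2^2) set monoid" where
  "PGL2C = GL2C Mod scalars_GL2C"

definition T_SL2Z :: "int^2^2" where
  "T_SL2Z = vector [vector [1, 1], vector [0, 1]]"

definition irreducible_rep :: "(int^2^2 \<Rightarrow> complex^2^2) \<Rightarrow> bool" where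
  "irreducible_rep \<rho> \<longleftrightarrow>
     (\<forall>W. vec.subspace W \<and> (\<forall>\<gamma>\<in>carrier SL2Z. \<forall>w\<in>W. \<rho> \<gamma> *v w \<in> W)
        \<longrightarrow> W = {0} \<or> W = UNIV)"

text \<open>As for every order in \<^const>\<open>group.ord\<close>, the value 0 stands for infinite order.\<close>

definition projective_level :: "(int^2^2 \<Rightarrow> complex^2^2) \<Rightarrow> nat" where
  "projective_level \<rho> = group.ord PGL2C (scalars_GL2C #>\<^bsub>GL2C\<^esub> \<rho> T_SL2Z)"

section \<open>Vector-valued modular forms\<close>

definition upper_half_plane :: "complex set" where
  "upper_half_plane = {\<tau>. Im \<tau> > 0}"

definition moebius_act :: "int^2^2 \<Rightarrow> complex \<Rightarrow> complex" where
  "moebius_act \<gamma> \<tau> =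
     (of_int (\<gamma>$1$1) * \<tau> + of_int (\<gamma>$1$2)) / (of_int (\<gamma>$2$1) * \<tau> + of_int (\<gamma>$2$2))"

definition automorphy :: "int^2^2 \<Rightarrow> complex \<Rightarrow> complex" where
  "automorphy \<gamma> \<tau> = of_int (\<gamma>$2$1) * \<tau> + of_int (\<gamma>$2$2)"

text \<open>
  The vector \<open>m\<close> holds the leading exponents of the two components;
  \<open>a n $ i\<close> is the coefficient of \<open>q\<close> to the power \<open>m $ i + n\<close> in the \<open>i\<close>-th component.
\<close>

definition has_q_expansion ::
    "real^2 \<Rightarrow> (complex \<Rightarrow> complex^2) \<Rightarrow> (nat \<Rightarrow> complex^2) \<Rightarrow> bool" where
  "has_q_expansion m F a \<longleftrightarrow>
     (\<forall>\<tau>\<in>upper_half_plane. \<forall>i.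
        (\<lambda>n. a n $ i * exp (2 * of_real pi * \<i> * (of_real (m$i) + of_nat n) * \<tau>)) sums (F \<tau> $ i))"

text \<open>
  A form is a function on the upper half-plane; the values of its representative
  outside the upper half-plane are unconstrained.
\<close>

definition vvmf :: "int \<Rightarrow> (int^2^2 \<Rightarrow> complex^2^2) \<Rightarrow> real^2 \<Rightarrow> (complex \<Rightarrow> complex^2) set" where
  "vvmf k \<rho> m =
     {F. (\<forall>i. (\<lambda>\<tau>. F \<tau> $ i) holomorphic_on upper_half_plane)
       \<and> (\<exists>a. has_q_expansion m F a)
       \<and> (\<forall>\<gamma>\<in>carrier SL2Z. \<forall>\<tau>\<in>upper_half_plane.
            automorphy \<gamma> \<tau> powi (- k) *s F (moebius_act \<gamma> \<tau>) = \<rho> \<gamma> *v F \<tau>)}"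

definition vvmf_rational ::
    "int \<Rightarrow> (int^2^2 \<Rightarrow> complex^2^2) \<Rightarrow> real^2 \<Rightarrow> (complex \<Rightarrow> complex^2) set" where
  "vvmf_rational k \<rho> m =
     {F \<in> vvmf k \<rho> m. \<exists>a. has_q_expansion m F a \<and> (\<forall>n i. a n $ i \<in> \<rat>)}"

definition bounded_denominators :: "real^2 \<Rightarrow> (complex \<Rightarrow> complex^2) \<Rightarrow> bool" where
  "bounded_denominators m F \<longleftrightarrow>
     (\<exists>a. has_q_expansion m F a \<and>
        (\<exists>B::int. B \<noteq> 0 \<and> (\<forall>n i. of_int B * a n $ i \<in> \<int>)))"

section \<open>Well-definedness\<close>

lemma group_SL2Z: "group SL2Z"
proof (rule groupI)
  fix A assume A: "A \<in> carrier SL2Z"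
  define B :: "int^2^2" where "B = vector [vector [A$2$2, - A$1$2], vector [- A$2$1, A$1$1]]"
  have "det B = 1" "B ** A = mat 1"
    using A by (auto simp: SL2Z_def B_def det_2 vec_eq_iff matrix_matrix_mult_def sum_2
                  forall_2 mat_def algebra_simps)
  then show "\<exists>B\<in>carrier SL2Z. B \<otimes>\<^bsub>SL2Z\<^esub> A = \<one>\<^bsub>SL2Z\<^esub>"
    by (auto simp: SL2Z_def)
qed (auto simp: SL2Z_def det_mul matrix_mul_assoc)

lemma group_GL2C: "group GL2C"
proof (rule groupI)
  fix A assume "A \<in> carrier GL2C"
  then show "\<exists>B\<in>carrier GL2C. B \<otimes>\<^bsub>GL2C\<^esub> A = \<one>\<^bsub>GL2C\<^esub>"
    by (auto simp: GL2C_def invertible_def)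
qed (auto simp: GL2C_def invertible_mult matrix_mul_assoc invertible_def[of "mat 1"])

lemma mat_mult_mat: "mat c ** mat d = (mat (c * d) :: complex^2^2)"
  by (auto simp: vec_eq_iff matrix_matrix_mult_def sum_2 forall_2 mat_def)

lemma mat_mult_commute: "mat c ** A = A ** (mat c :: complex^2^2)"
  by (simp add: vec_eq_iff matrix_matrix_mult_def mat_def mult_delta_left mult_delta_right mult.commute)

lemma invertible_mat: "c \<noteq> 0 \<Longrightarrow> invertible (mat c :: complex^2^2)"
  unfolding invertible_def by (rule exI[of _ "mat (1/c)"]) (simp add: mat_mult_mat)

lemma normal_scalars_GL2C: "scalars_GL2C \<lhd> GL2C"
proof -
  interpret GL: group GL2C by (rule group_GL2C)
  have inv: "inv\<^bsub>GL2C\<^esub> (mat c) = mat (1/c)" if "c \<noteq> 0" for c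
    by (rule GL.inv_equality) (use that in \<open>auto simp: GL2C_def mat_mult_mat invertible_mat\<close>)
  have "subgroup scalars_GL2C GL2C"
  proof (rule GL.subgroupI)
    show "scalars_GL2C \<subseteq> carrier GL2C" "scalars_GL2C \<noteq> {}"
      by (auto simp: scalars_GL2C_def GL2C_def invertible_mat intro: exI[of _ 1])
    show "inv\<^bsub>GL2C\<^esub> A \<in> scalars_GL2C" if "A \<in> scalars_GL2C" for A
      using that inv by (force simp: scalars_GL2C_def)
    show "A \<otimes>\<^bsub>GL2C\<^esub> B \<in> scalars_GL2C" if "A \<in> scalars_GL2C" "B \<in> scalars_GL2C" for A B
      using that by (force simp: scalars_GL2C_def GL2C_def mat_mult_mat)
  qed
  moreover have "x \<otimes>\<^bsub>GL2C\<^esub> h \<otimes>\<^bsub>GL2C\<^esub> inv\<^bsub>GL2C\<^esub> x \<in> scalars_GL2C"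
    if "x \<in> carrier GL2C" "h \<in> scalars_GL2C" for x h
  proof -
    have h: "h \<in> carrier GL2C" "x \<otimes>\<^bsub>GL2C\<^esub> h = h \<otimes>\<^bsub>GL2C\<^esub> x"
      using that by (auto simp: scalars_GL2C_def GL2C_def invertible_mat mat_mult_commute)
    then have "x \<otimes>\<^bsub>GL2C\<^esub> h \<otimes>\<^bsub>GL2C\<^esub> inv\<^bsub>GL2C\<^esub> x = h"
      using that(1) by (simp add: GL.m_assoc)
    then show ?thesis using that by simp
  qed
  ultimately show ?thesis
    by (simp add: GL.normal_inv_iff)
qed

lemma group_PGL2C: "group PGL2C"
  unfolding PGL2C_def by (rule normal.factorgroup_is_group[OF normal_scalars_GL2C])

lemma powser_zero_unique:
  fixes d :: "nat \<Rightarrow> complex"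
  assumes "\<And>x. x \<noteq> 0 \<Longrightarrow> norm x < 1 \<Longrightarrow> (\<lambda>n. d n * x ^ n) sums 0"
  shows "d n = 0"
  using assms
proof (induction n arbitrary: d)
  case 0
  have "((\<lambda>x::complex. 0) \<longlongrightarrow> d 0) (at 0)"
    by (rule powser_limit_0_strong[of 1]) (use 0 in auto)
  then show ?case
    by (simp add: tendsto_const_iff)
next
  case (Suc n)
  have "((\<lambda>x::complex. 0) \<longlongrightarrow> d 0) (at 0)"
    by (rule powser_limit_0_strong[of 1]) (use Suc.prems in auto)
  then have d0: "d 0 = 0"
    by (simp add: tendsto_const_iff)
  show ?case
  proof (rule Suc.IH[of "\<lambda>n. d (Suc n)"])
    fix x :: complex assume x: "x \<noteq> 0" "norm x < 1"
    have "(\<lambda>n. d (Suc n) * x ^ Suc n) sums 0"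
      using Suc.prems[OF x] d0 by (subst sums_Suc_iff) simp
    then have "(\<lambda>n. (d (Suc n) * x ^ Suc n) * (1 / x)) sums (0 * (1 / x))"
      by (rule sums_mult2)
    then show "(\<lambda>n. d (Suc n) * x ^ n) sums 0"
      using x by simp
  qed
qed

text \<open>
  The coefficients are determined by the form, so quantifying existentially over
  them in the definitions above amounts to speaking of the coefficients.
\<close>

lemma has_q_expansion_unique:
  assumes "has_q_expansion m F a" "has_q_expansion m F b"
  shows "a = b"
proof -
  have "a n $ i - b n $ i = 0" for n i
  proof (rule powser_zero_unique[of "\<lambda>n. a n $ i - b n $ i"])
    fix x :: complex assume x: "x \<noteq> 0" "norm x < 1"
    define \<tau> where "\<tau> = Ln x / (2 * of_real pi * \<i>)"
    define E where "E = exp (2 * of_real pi * \<i> * of_real (m$i) * \<tau>)"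
    have "Im \<tau> = - ln (norm x) / (2 * pi)"
      using x by (simp add: \<tau>_def Im_divide power2_eq_square)
    then have \<tau>: "\<tau> \<in> upper_half_plane"
      using x by (simp add: upper_half_plane_def divide_neg_pos)
    have e: "2 * of_real pi * \<i> * \<tau> = Ln x"
      by (simp add: \<tau>_def)
    have "exp (2 * of_real pi * \<i> * (of_real (m$i) + of_nat n) * \<tau>) = E * x ^ n" for n
    proof -
      have "2 * of_real pi * \<i> * (of_real (m$i) + of_nat n) * \<tau> =
          2 * of_real pi * \<i> * of_real (m$i) * \<tau> + of_nat n * (2 * of_real pi * \<i> * \<tau>)"
        by (simp add: algebra_simps)
      then show ?thesis
        by (simp only: e exp_add E_def exp_of_nat_mult exp_Ln[OF x(1)])
    qed
    then have "(\<lambda>n. a n $ i * (E * x ^ n)) sums (F \<tau> $ i)" "(\<lambda>n. b n $ i * (E * x ^ n)) sums (F \<tau> $ i)"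
      using assms[unfolded has_q_expansion_def, THEN bspec, OF \<tau>, THEN spec, of i]
      by (simp_all only:)
    from sums_mult[OF sums_diff[OF this], of "1 / E"]
    have "(\<lambda>n. 1 / E * (a n $ i * (E * x ^ n) - b n $ i * (E * x ^ n))) sums 0"
      by simp
    moreover have "1 / E * (a n $ i * (E * x ^ n) - b n $ i * (E * x ^ n)) =
        (a n $ i - b n $ i) * x ^ n" for n
    proof -
      have "E \<noteq> 0" by (simp add: E_def)
      then show ?thesis by (simp add: field_simps)
    qed
    ultimately show "(\<lambda>n. (a n $ i - b n $ i) * x ^ n) sums 0"
      by (simp only:)
  qed
  then show ?thesis
    by (simp add: fun_eq_iff vec_eq_iff)
qed

end

theory Submission
  imports Defs
begin

text \<open>
  Let \<open>r = m\<^sub>1 - m\<^sub>2 = a/M\<close> in lowest terms and let \<open>\<partial>\<close> be the Serre derivative. If the Wronskian of a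
  form \<open>F\<^sub>0\<close> of minimal weight \<open>k\<^sub>0\<close> for \<open>\<rho>\<close> vanished somewhere, a combination of \<open>F\<^sub>0\<close> and \<open>\<partial>F\<^sub>0\<close> could be
  divided by a scalar form so as to lower the weight. So it has no zeros, even at the cusp,
  which forces \<open>\<partial>\<^sup>2F\<^sub>0 = -\<kappa>E\<^sub>4F\<^sub>0\<close> with \<open>\<kappa> = 1/144 - r\<^sup>2/4\<close>, and every form is \<open>\<alpha>F\<^sub>0 + \<beta>\<partial>F\<^sub>0\<close> with scalar forms
  \<open>\<alpha>\<close> and \<open>\<beta>\<close>. If \<open>F\<close> has rational coefficients, a \<open>\<rat>\<close>-linear projection of \<open>\<complex>\<close> onto \<open>\<rat>\<close>, applied to the
  coefficients of \<open>\<alpha>\<close> and \<open>\<beta>\<close>, makes these rational too. If some form \<open>F \<noteq> 0\<close> has bounded denominators, then the logarithmic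
  derivative \<open>u\<close> of the first component of \<open>F\<^sub>0\<close> (without its leading exponent) is a quotient of bounded series
  and has \<open>p\<close>-adic Gauss norm at most 1 for every \<open>p\<close>. In the Riccati equation of \<open>u\<close> the terms other than \<open>12r\<^sup>2Y\<close>,
  where \<open>E\<^sub>4 = 1 + 48Y\<close> and \<open>Y = 5q + \<dots>\<close>, contain \<open>r\<close> at most to the first power, so \<open>M\<close> divides \<open>12 \<sqdot> 5 = 60\<close>.
\<close>

subsection \<open>Partial fractions of the cotangent\<close>

text \<open>Neither \<open>F\<^sub>0\<close> nor a multiple of it is known to have bounded
  denominators, so nothing can be read off its coefficients directly. But \<open>F\<close> and
  \<open>\<partial>F\<close> are combinations of \<open>F\<^sub>0\<close> and
  \<open>\<partial>F\<^sub>0\<close>; eliminating \<open>\<partial>F\<^sub>0\<close> by Cramer's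
  rule leaves a bounded series equal to a bounded scalar series times the normalised first component
  of \<open>F\<^sub>0\<close>. A constant Wronskian gives the differential equation because its
  derivative, the determinant of \<open>F\<^sub>0\<close> and
  \<open>\<partial>\<^sup>2F\<^sub>0\<close>, is zero: the two vectors are proportional, with a
  factor of weight 4. The value of \<kappa> is the indicial equation at the leading exponents, whose
  sum is fixed by the Wronskian having weight 0. The 12 in \<open>12r\<^sup>2Y\<close> is 48/4, from
  \<open>48\<kappa> = 1/3 - 12r\<^sup>2\<close>; the 1/3 cancels against the other terms with
  denominator 3. \<open>M\<close> is the denominator of \<open>r\<close> because the n-th power of
  the image of T is scalar exactly if \<open>nr\<close> is an integer. Serre derivatives rest on the
  transformation law of the Eisenstein series of weight two, whose lattice sum converges only
  conditionally. This explains the long analytic beginning.\<close>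

lemma pi_cot_Digamma:
  fixes z :: complex
  assumes "z \<notin> \<int>"
  shows "of_real pi * cot (of_real pi * z) = Digamma (1 - z) - Digamma z"
proof -
  have z: "z \<notin> \<int>\<^sub>\<le>\<^sub>0" "1 - z \<notin> \<int>\<^sub>\<le>\<^sub>0"
    using assms by (auto dest!: nonpos_Ints_Int simp: minus_in_Ints_iff[of "1 - z", symmetric] simp del: minus_in_Ints_iff)
  have s: "sin (of_real pi * z) \<noteq> 0" "sin (of_real pi * z) = sin (z * of_real pi)"
    using assms by (auto simp: sin_eq_0 mult.commute)
  \<comment> \<open>Euler's reflection formula for the entire function \<open>rGamma\<close> is
    differentiated; dividing by it turns the derivative into a difference of Digamma values.\<close>
  have d1: "((\<lambda>z. rGamma z * rGamma (1 - z)) has_field_derivative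
          (- (rGamma z * Digamma z) * rGamma (1 - z) + rGamma z * (rGamma (1 - z) * Digamma (1 - z)))) (at z)"
    by (rule derivative_eq_intros z refl | simp)+ 
  have d2: "((\<lambda>z. sin (of_real pi * z) / of_real pi) has_field_derivative
          cos (of_real pi * z)) (at z)"
    by (auto intro!: derivative_eq_intros)
  have eq: "(\<lambda>z. rGamma z * rGamma (1 - z)) = (\<lambda>z. sin (of_real pi * z) / complex_of_real pi)"
    by (simp add: rGamma_reflection_complex fun_eq_iff)
  have "rGamma z * rGamma (1 - z) * (Digamma (1 - z) - Digamma z) = cos (of_real pi * z)"
    using DERIV_unique[OF d1 d2[folded eq]] by (simp add: algebra_simps)
  then show ?thesis
    using s by (simp add: rGamma_reflection_complex cot_def field_simps)
qed

lemma cot_sums: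
  fixes z :: complex
  assumes "z \<notin> \<int>"
  shows "(\<lambda>m. 1 / (z + of_nat (Suc m)) + 1 / (z - of_nat (Suc m))) sums (of_real pi * cot (of_real pi * z) - 1 / z)"
proof -
  have z0: "z \<noteq> 0" "1 - z \<noteq> 0"
    using assms by auto
  have "(\<lambda>k. inverse (z + of_nat k) - inverse (1 - z + of_nat k)) sums
      (Digamma (1 - z) - Digamma z)"
    using sums_diff[OF summable_sums[OF summable_Digamma[OF z0(2)]] summable_sums[OF summable_Digamma[OF z0(1)]]]
    by (simp add: Digamma_def)
  then have lim1: "(\<lambda>K. \<Sum>k<K. inverse (z + of_nat k) - inverse (1 - z + of_nat k)) \<longlonglongrightarrow>
      of_real pi * cot (of_real pi * z)"
    by (simp add: pi_cot_Digamma[OF assms] sums_def)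
  have lim2: "(\<lambda>K. inverse (z + of_nat K)) \<longlonglongrightarrow> 0"
    by (intro filterlim_compose[OF tendsto_inverse_0]
              tendsto_add_filterlim_at_infinity[OF tendsto_const] tendsto_of_nat)
  \<comment> \<open>The Digamma series pairs \<open>z + k\<close> with \<open>z - (k + 1)\<close>,
    the cotangent series pairs \<open>z + m\<close> with \<open>z - m\<close>. This shift by one
    index changes a partial sum by its first term \<open>1/z\<close> and by
    \<open>1/(z + K)\<close>, which tends to 0.\<close>
  have eq: "(\<Sum>m<K. 1 / (z + of_nat (Suc m)) + 1 / (z - of_nat (Suc m))) =
     (\<Sum>k<K. inverse (z + of_nat k) - inverse (1 - z + of_nat k)) - 1 / z + inverse (z + of_nat K)" for K
  proof (induction K)
    case (Suc K)
    have "inverse (1 - z + of_nat K) = - (1 / (z - of_nat (Suc K)))"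
      by (simp add: inverse_eq_divide minus_divide_right del: divide_minus_right)
    then show ?case
      using Suc.IH by (simp add: inverse_eq_divide)
  qed (use z0 in \<open>simp add: field_simps\<close>)
  show ?thesis
    unfolding sums_def eq
    using tendsto_add[OF tendsto_diff[OF lim1 tendsto_const[of "1/z"]] lim2] by simp
qed

section \<open>Unordered sums over the integers\<close>

lemma has_sum_int_UNIV:
  fixes f :: "int \<Rightarrow> 'a :: {topological_ab_group_add, t2_space}"
  assumes "((\<lambda>n. f (int n)) has_sum a) UNIV" "((\<lambda>n. f (- int (Suc n))) has_sum b) UNIV"
  shows "(f has_sum (a + b)) UNIV"
proof -
  have 1: "(f has_sum a) (range int)"
    using assms(1) by (subst has_sum_reindex) (auto simp: o_def)
  have 2: "(f has_sum b) (range (\<lambda>n. - int (Suc n)))"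
    using assms(2) by (subst has_sum_reindex) (auto simp: o_def inj_on_def)
  have "range int \<union> range (\<lambda>n. - int (Suc n)) = UNIV"
  proof -
    have "x \<in> range int \<union> range (\<lambda>n. - int (Suc n))" for x
      by (cases "x \<ge> 0") (auto simp: image_iff intro: exI[of _ "nat x"] exI[of _ "nat (-x-1)"])
    then show ?thesis by blast
  qed
  moreover have "range int \<inter> range (\<lambda>n. - int (Suc n)) = {}"
    by auto
  ultimately show ?thesis
    using has_sum_Un_disjoint[OF 1 2] by simp
qed

lemma has_sum_int_nonzero:
  fixes f :: "int \<Rightarrow> complex"
  assumes "f summable_on (- {0})"
  shows "((\<lambda>n. f (int (Suc n)) + f (- int (Suc n))) has_sum infsum f (- {0})) UNIV"
proof -
  have eq: "- {0} = range (\<lambda>n. int (Suc n)) \<union> range (\<lambda>n. - int (Suc n))"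
  proof -
    have "x \<in> range (\<lambda>n. int (Suc n)) \<union> range (\<lambda>n. - int (Suc n))" if "x \<noteq> 0" for x
      using that by (cases "x \<ge> 0") (auto simp: image_iff intro: exI[of _ "nat (x-1)"] exI[of _ "nat (-x-1)"])
    then show ?thesis by auto
  qed
  have s: "f summable_on range (\<lambda>n. int (Suc n))" "f summable_on range (\<lambda>n. - int (Suc n))"
    by (rule summable_on_subset_banach[OF assms], force)+
  have "infsum f (- {0}) = infsum f (range (\<lambda>n. int (Suc n))) + infsum f (range (\<lambda>n. - int (Suc n)))"
    unfolding eq by (rule infsum_Un_disjoint[OF s]) auto
  moreover have "((\<lambda>n. f (int (Suc n))) has_sum infsum f (range (\<lambda>n. int (Suc n)))) UNIV"
    using has_sum_infsum[OF s(1)] by (subst (asm) has_sum_reindex) (auto simp: o_def inj_on_def)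
  moreover have "((\<lambda>n. f (- int (Suc n))) has_sum infsum f (range (\<lambda>n. - int (Suc n)))) UNIV"
    using has_sum_infsum[OF s(2)] by (subst (asm) has_sum_reindex) (auto simp: o_def inj_on_def)
  ultimately show ?thesis
    by (simp only:) (intro has_sum_add)
qed

text \<open>Differentiating the Digamma formula for \<open>cot\<close> gives
  \<open>Polygamma 1\<close> at \<open>z\<close> and at \<open>1 - z\<close>, which are the sums
  over n \<ge> 0 and over n < 0.\<close>

lemma has_sum_inverse_square_shifts:
  fixes z :: complex
  assumes "z \<notin> \<int>"
  shows "((\<lambda>n::int. 1 / (z + of_int n)\<^sup>2) has_sum (of_real pi / sin (of_real pi * z))\<^sup>2) UNIV"
proof -
  have z: "z \<notin> \<int>\<^sub>\<le>\<^sub>0" "1 - z \<notin> \<int>\<^sub>\<le>\<^sub>0"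
    using assms by (auto dest!: nonpos_Ints_Int simp: minus_in_Ints_iff[of "1 - z", symmetric] simp del: minus_in_Ints_iff)
  have z0: "z \<noteq> 0" "1 - z \<noteq> 0"
    using assms by auto
  have s: "sin (of_real pi * z) \<noteq> 0"
    using assms by (auto simp: sin_eq_0 mult.commute)
  have d1: "((\<lambda>z. Digamma (1 - z) - Digamma z) has_field_derivative
          (- Polygamma 1 (1 - z) - Polygamma 1 z)) (at z)"
    by (rule derivative_eq_intros z refl | simp)+ 
  have d2: "((\<lambda>z. of_real pi * cot (of_real pi * z)) has_field_derivative
          - (of_real pi / sin (of_real pi * z))\<^sup>2) (at z)"
  proof -
    define x where "x = of_real pi * z"
    have "((\<lambda>z. of_real pi * (cos (of_real pi * z) / sin (of_real pi * z))) has_field_derivative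
        of_real pi * ((- (sin x * of_real pi) * sin x - cos x * (cos x * of_real pi)) / (sin x * sin x))) (at z)"
      unfolding x_def by (rule derivative_eq_intros refl s | simp)+
    moreover have "of_real pi * (- (sin x * of_real pi) * sin x - cos x * (cos x * of_real pi)) = - (of_real pi)\<^sup>2"
    proof -
      have "p * (- (s * p) * s - c * (c * p)) = - p\<^sup>2" if "s\<^sup>2 + c\<^sup>2 = 1" for p s c :: complex
        using that by Groebner_Basis.algebra
      then show ?thesis using sin_cos_squared_add[of x] by blast
    qed
    ultimately show ?thesis
      by (simp add: cot_def x_def power_divide power2_eq_square)
  qed
  have "open (- \<int> :: complex set)"
    using closed_Ints by (simp add: closed_def)
  then have "\<forall>\<^sub>F w in nhds z. w \<in> - \<int>"
    using assms by (intro eventually_nhds_in_open) auto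
  then have ev: "\<forall>\<^sub>F w in nhds z. of_real pi * cot (of_real pi * w) = Digamma (1 - w) - Digamma w"
    by eventually_elim (use pi_cot_Digamma in auto)
  have "((\<lambda>z. of_real pi * cot (of_real pi * z)) has_field_derivative
          (- Polygamma 1 (1 - z) - Polygamma 1 z)) (at z)"
    using d1 by (subst DERIV_cong_ev[OF refl ev refl])
  then have pg: "(of_real pi / sin (of_real pi * z))\<^sup>2 = Polygamma 1 z + Polygamma 1 (1 - z)"
    using DERIV_unique[OF d2] by (metis add.commute add_uminus_conv_diff minus_diff_eq minus_minus)
  have hs: "((\<lambda>k. 1 / (w + of_nat k)\<^sup>2) has_sum Polygamma 1 w) UNIV" if "w \<noteq> 0" for w :: complex
  proof (rule norm_summable_imp_has_sum)
    show "(\<lambda>k. 1 / (w + of_nat k)\<^sup>2) sums Polygamma 1 w"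
      using Polygamma_converges'[OF that, of 2]
      by (simp add: Polygamma_def numeral_2_eq_2 divide_inverse power_Suc0_right summable_sums)
    have "summable (\<lambda>k. inverse ((real k)\<^sup>2))"
      using inverse_power_summable[of 2] by simp
    then have sm: "summable (\<lambda>k. 4 * inverse ((real k)\<^sup>2))"
      by (rule summable_mult)
    \<comment> \<open>Beyond twice the norm of \<open>w\<close>, the norm of \<open>w + k\<close> is
      at least k/2, whence the majorant 4/k^2.\<close>
    obtain K :: nat where K: "real K > 2 * norm w"
      using reals_Archimedean2 by blast
    show "summable (\<lambda>k. norm (1 / (w + of_nat k)\<^sup>2))"
    proof (rule summable_comparison_test'[OF sm, of "Suc K"])
      fix k assume k: "k \<ge> Suc K"
      have "norm (of_nat k :: complex) \<le> norm (w + of_nat k) + norm w"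
        by (metis add_diff_cancel_left' norm_triangle_ineq4)
      then have "real k / 2 \<le> norm (w + of_nat k)"
        using k K by simp
      then have "(real k / 2)^2 \<le> norm (w + of_nat k) ^ 2"
        by (intro power_mono) auto
      moreover have "real k > 0" using k by auto
      ultimately have "inverse (norm (w + of_nat k) ^ 2) \<le> inverse ((real k / 2)^2)"
        by (intro le_imp_inverse_le) auto
      moreover have "inverse ((real k / 2)^2) = 4 * inverse ((real k)\<^sup>2)"
        by (simp add: power_divide inverse_eq_divide)
      moreover have "norm (norm (1 / (w + of_nat k)\<^sup>2)) = inverse (norm (w + of_nat k) ^ 2)"
        by (simp only: norm_divide norm_power norm_one real_norm_def abs_norm_cancel inverse_eq_divide abs_divide abs_one power_abs)
      ultimately show "norm (norm (1 / (w + of_nat k)\<^sup>2)) \<le> 4 * inverse ((real k)\<^sup>2)"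
        by (simp only:)
    qed
  qed
  have eq: "(z + of_int (- int (Suc k)))\<^sup>2 = (1 - z + of_nat k)\<^sup>2" for k
  proof -
    have "z + of_int (- int (Suc k)) = - (1 - z + of_nat k)"
      by simp
    then show ?thesis by (simp only: power2_minus)
  qed
  show ?thesis
    unfolding pg by (rule has_sum_int_UNIV) (use hs[OF z0(1)] hs[OF z0(2)] in \<open>simp_all only: eq of_int_of_nat_eq\<close>)
qed

subsection \<open>The Eisenstein series of weight two\<close>

definition nome :: "complex \<Rightarrow> complex" where
  "nome \<tau> = exp (2 * of_real pi * \<i> * \<tau>)"

lemma nome_nonzero [simp]: "nome \<tau> \<noteq> 0"
  by (simp add: nome_def)

lemma norm_nome: "norm (nome \<tau>) = exp (- 2 * pi * Im \<tau>)"
  by (simp add: nome_def)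

lemma norm_nome_less_1: "Im \<tau> > 0 \<Longrightarrow> norm (nome \<tau>) < 1"
  by (simp add: norm_nome)

lemma Im_inverse_pos: "Im \<tau> > 0 \<Longrightarrow> Im (- 1 / \<tau>) > 0"
  by (auto simp: Im_divide zero_less_divide_iff intro!: add_nonneg_pos)

section \<open>Divisor sums and their Lambert series\<close>

definition divisor_sum :: "nat \<Rightarrow> nat" where
  "divisor_sum n = (\<Sum>d | d dvd n. d)"

text \<open>Every number divides 0, so the sum runs over an infinite set and takes its default
  value. This gives \<open>sigma_fps\<close> the constant term 0.\<close>

lemma divisor_sum_0 [simp]: "divisor_sum 0 = 0"
  unfolding divisor_sum_def by (rule sum.infinite) simp

text \<open>Since (m+1)(d+1) \<ge> m + d, the double series is dominated by a product of a geometric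
  series and its derivative.\<close>

lemma lambert_summable:
  fixes q :: complex
  assumes q: "norm q < 1"
  shows "(\<lambda>x. norm (case x of (m, d) \<Rightarrow> of_nat (Suc d) * q ^ (Suc m * Suc d))) summable_on UNIV"
proof -
  define r where "r = norm q"
  have r: "0 \<le> r" "r < 1"
    using q by (auto simp: r_def)
  have h1: "((\<lambda>d. real (Suc d) * r ^ d) has_sum (1 / (1 - r)^2)) UNIV"
    using r geometric_deriv_sums[of r]
    by (intro sums_nonneg_imp_has_sum) auto
  have h2: "((\<lambda>m. r ^ m) has_sum (1 / (1 - r))) UNIV"
    using r geometric_sums[of r] by (intro sums_nonneg_imp_has_sum) auto
  have "(\<lambda>(m, d). r ^ m * (real (Suc d) * r ^ d)) summable_on (UNIV \<times> UNIV)"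
  proof (rule summable_on_SigmaI)
    show "((\<lambda>y. case (x, y) of (m, d) \<Rightarrow> r ^ m * (real (Suc d) * r ^ d)) has_sum r ^ x * (1 / (1 - r)^2)) UNIV" for x
      using has_sum_cmult_right[OF h1, of "r ^ x"] by simp
    show "(\<lambda>x. r ^ x * (1 / (1 - r)\<^sup>2)) summable_on UNIV"
      using has_sum_imp_summable[OF h2] by (rule summable_on_cmult_left)
  qed (use r in auto)
  then have "(\<lambda>(m, d). r ^ m * (real (Suc d) * r ^ d)) summable_on UNIV"
    by simp
  then show ?thesis
  proof (rule summable_on_comparison_test)
    fix x :: "nat \<times> nat"
    obtain m d where x: "x = (m, d)" by fastforce
    have "r ^ (Suc m * Suc d) \<le> r ^ (m + d)"
      using r by (intro power_decreasing) auto
    then have "real (Suc d) * r ^ (Suc m * Suc d) \<le> real (Suc d) * r ^ (m + d)"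
      by (intro mult_left_mono) auto
    then show "norm (case x of (m, d) \<Rightarrow> complex_of_nat (Suc d) * q ^ (Suc m * Suc d)) \<le>
        (case x of (m, d) \<Rightarrow> r ^ m * (real (Suc d) * r ^ d))"
      by (simp add: x norm_mult norm_power r_def power_add mult_ac del: of_nat_Suc)
  qed auto
qed

lemma lambert_rows:
  fixes q :: complex
  assumes q: "norm q < 1"
  shows "((\<lambda>d. of_nat (Suc d) * q ^ (Suc m * Suc d)) has_sum (q ^ Suc m / (1 - q ^ Suc m)\<^sup>2)) UNIV"
proof -
  define x where "x = q ^ Suc m"
  have "norm q ^ Suc m \<le> norm q ^ 1"
    using q by (intro power_decreasing) auto
  then have x: "norm x < 1"
    unfolding x_def norm_power by (rule le_less_trans) (use q in simp)
  have pow: "q ^ (Suc m * Suc d) = x * x ^ d" for d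
    unfolding x_def power_mult by (rule power_Suc)
  show ?thesis
    unfolding pow x_def[symmetric]
  proof (rule norm_summable_imp_has_sum)
    have eq: "of_nat (Suc d) * (x * x ^ d) = x * (of_nat (Suc d) * x ^ d)" for d
      by (rule mult.left_commute)
    show "(\<lambda>d. of_nat (Suc d) * (x * x ^ d)) sums (x / (1 - x)\<^sup>2)"
      unfolding eq using sums_mult[OF geometric_deriv_sums[OF x], of x] by (simp del: of_nat_Suc)
    have "norm (norm x) < 1" using x by simp
    from summable_mult[OF sums_summable[OF geometric_deriv_sums[OF this]], of "norm x"]
    show "summable (\<lambda>d. norm (of_nat (Suc d) * (x * x ^ d)))"
      unfolding eq norm_mult norm_power norm_of_nat .
  qed
qed

definition sigma_fps :: "complex fps" where
  "sigma_fps = Abs_fps (\<lambda>n. of_nat (divisor_sum n))"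

text \<open>Absolute convergence allows the double series to be collected by n = (m+1)(d+1), which
  gives the divisor sums, or by rows, which gives the closed forms met in the lattice sum.\<close>

lemma lambert_has_sum:
  fixes q :: complex
  assumes q: "norm q < 1"
  shows "((\<lambda>n. of_nat (divisor_sum n) * q ^ n) has_sum
           (\<Sum>\<^sub>\<infinity>(m, d). of_nat (Suc d) * q ^ (Suc m * Suc d))) UNIV"
    and "((\<lambda>m. q ^ Suc m / (1 - q ^ Suc m)\<^sup>2) has_sum
           (\<Sum>\<^sub>\<infinity>(m, d). of_nat (Suc d) * q ^ (Suc m * Suc d))) UNIV"
proof -
  let ?f = "\<lambda>(m, d). of_nat (Suc d) * q ^ (Suc m * Suc d)"
  let ?s = "\<Sum>\<^sub>\<infinity>x. ?f x"
  have hs: "(?f has_sum ?s) (UNIV \<times> UNIV)"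
    unfolding UNIV_Times_UNIV by (rule has_sum_infsum[OF abs_summable_summable[OF lambert_summable[OF q]]])
  show "((\<lambda>m. q ^ Suc m / (1 - q ^ Suc m)\<^sup>2) has_sum ?s) UNIV"
    using hs by (rule has_sum_SigmaD) (simp only: prod.case lambert_rows[OF q])
  have "(?f has_sum ?s) UNIV \<longleftrightarrow>
      ((\<lambda>(n, d). of_nat d * q ^ n) has_sum ?s) (SIGMA n:{0<..}. {d. d dvd n})"
  proof (rule has_sum_reindex_bij_witness[of UNIV "\<lambda>(n, d). (n div d - 1, d - 1)" "\<lambda>(m, d). (Suc m * Suc d, Suc d)"])
    fix b :: "nat \<times> nat"
    assume b: "b \<in> (SIGMA n:{0<..}. {d. d dvd n})"
    then obtain n d where nd: "b = (n, d)" "n > 0" "d dvd n"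
      by auto
    then obtain k where k: "n = d * k" "d > 0" "k > 0"
      by auto
    then have e: "Suc (k - 1) = k" "Suc (d - 1) = d" "n div d = k" by simp_all
    have "Suc (n div d - 1) * Suc (d - 1) = n"
      unfolding e(3) e(1) e(2) using k(1) by (metis mult.commute)
    then show "(case case b of (n, d) \<Rightarrow> (n div d - 1, d - 1) of (m, d) \<Rightarrow> (Suc m * Suc d, Suc d)) = b"
      by (simp only: nd(1) prod.case e(2))
  next
    fix a :: "nat \<times> nat"
    obtain m d where a: "a = (m, d)" by fastforce
    have "Suc m * Suc d div Suc d = Suc m"
      by (rule nonzero_mult_div_cancel_right) simp
    then show "(case case a of (m, d) \<Rightarrow> (Suc m * Suc d, Suc d) of (n, d) \<Rightarrow> (n div d - 1, d - 1)) = a"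
      by (simp only: a prod.case diff_Suc_1)
    show "(case a of (m, d) \<Rightarrow> (Suc m * Suc d, Suc d)) \<in> (SIGMA n:{0<..}. {d. d dvd n})"
      by (simp only: a prod.case mem_Sigma_iff mem_Collect_eq greaterThan_iff dvd_triv_right) simp
    show "(case case a of (m, d) \<Rightarrow> (Suc m * Suc d, Suc d) of (n, d) \<Rightarrow> of_nat d * q ^ n) = ?f a"
      by (simp only: a prod.case)
  qed (rule UNIV_I, rule refl)
  then have "((\<lambda>(n, d). of_nat d * q ^ n) has_sum ?s) (SIGMA n:{0<..}. {d. d dvd n})"
    using hs unfolding UNIV_Times_UNIV by blast
  then have "((\<lambda>n. of_nat (divisor_sum n) * q ^ n) has_sum ?s) {0<..}"
  proof (rule has_sum_SigmaD)
    fix n :: nat assume n: "n \<in> {0<..}"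
    then have "finite {d. d dvd n}" by simp
    then show "((\<lambda>d. case (n, d) of (n, d) \<Rightarrow> of_nat d * q ^ n) has_sum of_nat (divisor_sum n) * q ^ n) {d. d dvd n}"
      unfolding divisor_sum_def of_nat_sum sum_distrib_right prod.case by (rule has_sum_finiteI) (rule refl)
  qed
  moreover have "((\<lambda>n. of_nat (divisor_sum n) * q ^ n) has_sum s) {0<..} \<longleftrightarrow>
      ((\<lambda>n. of_nat (divisor_sum n) * q ^ n) has_sum s) UNIV" for s
    by (rule has_sum_cong_neutral) auto
  ultimately show "((\<lambda>n. of_nat (divisor_sum n) * q ^ n) has_sum ?s) UNIV"
    by (rule iffD1[rotated])
qed

lemma sigma_fps_radius: "fps_conv_radius sigma_fps \<ge> 1"
  unfolding fps_conv_radius_def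
proof (rule conv_radius_geI_ex)
  fix r :: real assume r: "0 < r" "ereal r < 1"
  then have "norm (of_real r :: complex) < 1" by simp
  from has_sum_imp_sums[OF lambert_has_sum(1)[OF this]]
  show "\<exists>z. norm z = r \<and> summable (\<lambda>n. fps_nth sigma_fps n * z ^ n)"
    using r by (intro exI[of _ "of_real r"]) (auto simp: sigma_fps_def sums_iff)
qed

lemma eval_sigma_fps:
  fixes q :: complex
  assumes q: "norm q < 1"
  shows "((\<lambda>m. q ^ Suc m / (1 - q ^ Suc m)\<^sup>2) has_sum eval_fps sigma_fps q) UNIV"
proof -
  have "eval_fps sigma_fps q = (\<Sum>\<^sub>\<infinity>(m, d). of_nat (Suc d) * q ^ (Suc m * Suc d))"
    using has_sum_imp_sums[OF lambert_has_sum(1)[OF q]]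
    by (simp add: eval_fps_def sigma_fps_def sums_iff)
  then show ?thesis
    using lambert_has_sum(2)[OF q] by simp
qed

lemma has_sum_int_even:
  fixes f :: "int \<Rightarrow> complex"
  assumes "((\<lambda>n. f (int (Suc n))) has_sum a) UNIV" "\<And>n. f (- n) = f n"
  shows "(f has_sum 2 * a) (- {0})"
proof -
  define g where "g n = (if n = 0 then 0 else f n)" for n
  have "((\<lambda>n. g (int n)) has_sum a) UNIV"
  proof -
    have "((\<lambda>n. g (int n)) has_sum a) (range Suc)"
      using assms(1) by (subst has_sum_reindex) (auto simp: o_def g_def)
    then show ?thesis
      by (rule has_sum_cong_neutral[THEN iffD1, rotated -1]) (auto simp: g_def image_iff intro: Suc_pred[symmetric])
  qed
  moreover have "((\<lambda>n. g (- int (Suc n))) has_sum a) UNIV"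
    unfolding g_def assms(2) using assms(1) by simp
  ultimately have "(g has_sum (a + a)) UNIV"
    by (rule has_sum_int_UNIV)
  moreover have "(g has_sum s) UNIV \<longleftrightarrow> (f has_sum s) (- {0})" for s
    by (rule has_sum_cong_neutral) (auto simp: g_def)
  ultimately show ?thesis
    by (simp only: mult_2)
qed

lemma sin_nome:
  fixes \<tau> :: complex
  assumes "Im \<tau> > 0"
  shows "(of_real pi / sin (of_real pi * \<tau>))\<^sup>2 = - 4 * (of_real pi)\<^sup>2 * (nome \<tau> / (1 - nome \<tau>)\<^sup>2)"
proof -
  define e where "e = exp (\<i> * (of_real pi * \<tau>))"
  have e: "nome \<tau> = e\<^sup>2" "e \<noteq> 0"
    by (simp_all add: e_def nome_def power2_eq_square flip: exp_add) (simp add: mult_ac)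
  have s: "sin (of_real pi * \<tau>) = (e - 1 / e) / (2 * \<i>)"
    by (simp add: sin_exp_eq e_def exp_minus inverse_eq_divide)
  have e2: "e\<^sup>2 \<noteq> 1"
    using norm_nome_less_1[OF assms] e by auto
  have "(e - 1 / e) / (2 * \<i>) = (e\<^sup>2 - 1) / (2 * \<i> * e)"
    using e by (simp add: field_simps power2_eq_square)
  then have "(sin (of_real pi * \<tau>))\<^sup>2 = - ((1 - e\<^sup>2)\<^sup>2 / (4 * e\<^sup>2))"
    by (simp add: s power_divide power_mult_distrib power2_commute[of 1 "e\<^sup>2"])
  then have "(of_real pi)\<^sup>2 / (sin (of_real pi * \<tau>))\<^sup>2 = (of_real pi)\<^sup>2 / - ((1 - e\<^sup>2)\<^sup>2 / (4 * e\<^sup>2))"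
    by (simp only:)
  moreover have "P / - (a / (4 * b)) = - 4 * P * (b / a)" for P a b :: complex
    by simp
  ultimately show ?thesis
    by (simp only: power_divide e(1))
qed

lemma nome_mult: "nome (of_nat m * \<tau>) = nome \<tau> ^ m"
  by (simp add: nome_def mult_ac flip: exp_of_nat_mult)

text \<open>The terms are the sums over n of \<open>1/(m\<tau> + n)\<^sup>2\<close>. They are even
  in m, so they add up to twice a Lambert series.\<close>

lemma sin_squares_has_sum:
  assumes "Im \<tau> > 0"
  shows "((\<lambda>m::int. (of_real pi / sin (of_real pi * (of_int m * \<tau>)))\<^sup>2) has_sum
           (- 8 * (of_real pi)\<^sup>2 * eval_fps sigma_fps (nome \<tau>))) (- {0})"
proof -
  have "((\<lambda>n. (of_real pi / sin (of_real pi * (of_int (int (Suc n)) * \<tau>)))\<^sup>2) has_sum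
     (- 4 * (of_real pi)\<^sup>2 * eval_fps sigma_fps (nome \<tau>))) UNIV"
  proof -
    have eq: "(of_real pi / sin (of_real pi * (of_int (int (Suc n)) * \<tau>)))\<^sup>2 =
       - 4 * (of_real pi)\<^sup>2 * (nome \<tau> ^ Suc n / (1 - nome \<tau> ^ Suc n)\<^sup>2)" for n
    proof -
      have "Im (of_nat (Suc n) * \<tau>) > 0"
        using assms by (simp del: of_nat_Suc)
      from sin_nome[OF this] show ?thesis
        by (simp only: nome_mult of_int_of_nat_eq)
    qed
    show ?thesis
      unfolding eq by (intro has_sum_cmult_right eval_sigma_fps norm_nome_less_1 assms)
  qed
  from has_sum_int_even[OF this] show ?thesis
    by (simp add: mult.assoc)
qed

definition E2_fps :: "complex fps" where
  "E2_fps = 1 - 24 * sigma_fps"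

section \<open>The lattice sum of weight two\<close>

lemma has_sum_diff:
  fixes f g :: "'a \<Rightarrow> complex"
  assumes "(f has_sum a) A" "(g has_sum b) A"
  shows "((\<lambda>x. f x - g x) has_sum (a - b)) A"
  using has_sum_add[OF assms(1), of "\<lambda>x. - g x" "- b"] assms(2) by (simp add: has_sum_uminus)

text \<open>The imaginary part bounds m, and then the triangle inequality bounds n.\<close>

lemma lattice_lower_bound:
  fixes \<tau> :: complex
  assumes "Im \<tau> > 0"
  obtains c :: real where "c > 0" "\<And>m n::int. c * real_of_int (\<bar>m\<bar> + \<bar>n\<bar>) \<le> norm (of_int m * \<tau> + of_int n)"
proof -
  define y where "y = Im \<tau>"
  define K where "K = 1 + (1 + norm \<tau>) / y"
  have y: "y > 0" using assms by (simp add: y_def)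
  have K: "K > 0" unfolding K_def using y by (intro add_pos_nonneg) auto
  have "real_of_int (\<bar>m\<bar> + \<bar>n\<bar>) \<le> K * norm (of_int m * \<tau> + of_int n)" for m n :: int
  proof -
    let ?w = "of_int m * \<tau> + of_int n"
    have 1: "y * \<bar>m\<bar> \<le> norm ?w"
      using abs_Im_le_cmod[of ?w] y by (simp add: abs_mult y_def mult.commute)
    have "norm (of_int n :: complex) \<le> norm ?w + norm (of_int m * \<tau>)"
      by (metis add_diff_cancel_left' norm_triangle_ineq4)
    then have 2: "\<bar>n\<bar> \<le> norm ?w + \<bar>m\<bar> * norm \<tau>"
      by (simp add: norm_mult)
    have "\<bar>m\<bar> \<le> norm ?w / y"
      using 1 y by (simp add: field_simps)
    then have "\<bar>m\<bar> * (1 + norm \<tau>) \<le> norm ?w / y * (1 + norm \<tau>)"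
      by (intro mult_right_mono) auto
    then show ?thesis
      using 2 unfolding K_def by (simp add: algebra_simps)
  qed
  then have "1 / K * real_of_int (\<bar>m\<bar> + \<bar>n\<bar>) \<le> norm (of_int m * \<tau> + of_int n)" for m n :: int
    using K by (simp add: field_simps)
  then show ?thesis
    using that[of "1 / K"] K by simp
qed

lemma lattice_nonzero:
  assumes "Im \<tau> > 0" "m \<noteq> 0"
  shows "of_int m * \<tau> + of_int n \<noteq> 0"
proof
  assume "of_int m * \<tau> + of_int n = 0"
  then have "Im (of_int m * \<tau> + of_int n) = 0" by simp
  then show False using assms by simp
qed

lemma summable_on_int_powr:
  "(\<lambda>n::int. (1 + real_of_int \<bar>n\<bar>) powr (- 3 / 2)) summable_on UNIV"
proof -
  have "summable (\<lambda>n. real (Suc n) powr (- 3 / 2))"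
    by (subst summable_Suc_iff) (simp add: summable_real_powr_iff)
  then have s: "(\<lambda>n. real (Suc n) powr (- 3 / 2)) summable_on UNIV"
    by (intro summable_nonneg_imp_summable_on) auto
  have "(\<lambda>n. real (Suc (Suc n)) powr (- 3 / 2)) summable_on UNIV"
    by (rule summable_on_comparison_test[OF s]) (auto intro!: powr_mono2')
  with s obtain a b where ab: "((\<lambda>n. real (Suc n) powr (- 3 / 2)) has_sum a) UNIV"
      "((\<lambda>n. real (Suc (Suc n)) powr (- 3 / 2)) has_sum b) UNIV"
    unfolding summable_on_def by blast
  have e: "1 + real_of_int \<bar>int n\<bar> = real (Suc n)" "1 + real_of_int \<bar>- int (Suc n)\<bar> = real (Suc (Suc n))" for n
    by auto
  have "((\<lambda>n::int. (1 + real_of_int \<bar>n\<bar>) powr (- 3 / 2)) has_sum (a + b)) UNIV"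
    by (rule has_sum_int_UNIV; unfold e) (fact ab)+
  then show ?thesis
    by (rule has_sum_imp_summable)
qed

text \<open>The sum of the plain squares \<open>1/w\<^sup>2\<close>, w = m\<tau> + n, does not
  converge absolutely. The extra factor \<open>1/(w + 1)\<close> raises the decay to exponent 3,
  shared by the two indices as 3/2 + 3/2, and changes each term only by
  \<open>1/w - 1/(w + 1)\<close>, which telescopes in n. So rows and columns may be exchanged here,
  and the telescoping part keeps track of the difference.\<close>

lemma lattice_summable:
  fixes \<tau> :: complex
  assumes \<tau>: "Im \<tau> > 0"
  shows "(\<lambda>(m::int, n::int). 1 / ((of_int m * \<tau> + of_int n)\<^sup>2 * (of_int m * \<tau> + of_int n + 1)))
           summable_on ((- {0}) \<times> UNIV)"
proof -
  obtain c where c: "c > 0" "\<And>m n::int. c * real_of_int (\<bar>m\<bar> + \<bar>n\<bar>) \<le> norm (of_int m * \<tau> + of_int n)"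
    using lattice_lower_bound[OF \<tau>] by blast
  let ?g = "\<lambda>x::int. (1 + real_of_int \<bar>x\<bar>) powr (- 3 / 2)"
  obtain s where s: "(?g has_sum s) UNIV"
    using summable_on_int_powr by (auto simp: summable_on_def)
  have "(\<lambda>(m, n). ?g m * ?g n) summable_on (UNIV \<times> UNIV)"
  proof (rule summable_on_SigmaI)
    show "((\<lambda>y. case (x, y) of (m, n) \<Rightarrow> ?g m * ?g n) has_sum ?g x * s) UNIV" for x
      unfolding prod.case by (rule has_sum_cmult_right[OF s])
    show "(\<lambda>x. ?g x * s) summable_on UNIV"
      by (rule summable_on_cmult_left[OF summable_on_int_powr])
  qed auto
  then have "(\<lambda>(m, n). ?g m * ?g n) summable_on ((- {0}) \<times> UNIV)"
    by (rule summable_on_subset_banach) auto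
  then have sg: "(\<lambda>x. 16 / c ^ 3 * (case x of (m, n) \<Rightarrow> ?g m * ?g n)) summable_on ((- {0}) \<times> UNIV)"
    by (rule summable_on_cmult_right)
  show ?thesis
  proof (rule abs_summable_summable, rule summable_on_comparison_test[OF sg])
    fix x :: "int \<times> int"
    assume x: "x \<in> (- {0}) \<times> UNIV"
    obtain m n where mn: "x = (m, n)" "m \<noteq> 0" using x by (cases x) auto
    define M where "M = real_of_int \<bar>m\<bar>"
    define N where "N = real_of_int \<bar>n\<bar>"
    define w where "w = of_int m * \<tau> + of_int n"
    have M: "M \<ge> 1" and N: "N \<ge> 0" using mn(2) by (auto simp: M_def N_def)
    have 1: "c * (M + N) \<le> norm w"
      using c(2)[of m n] by (simp add: M_def N_def w_def)
    have "\<bar>m\<bar> + \<bar>n\<bar> \<le> 2 * (\<bar>m\<bar> + \<bar>n + 1\<bar>)"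
      using mn(2) by arith
    then have "real_of_int (\<bar>m\<bar> + \<bar>n\<bar>) \<le> real_of_int (2 * (\<bar>m\<bar> + \<bar>n + 1\<bar>))"
      by (simp only: of_int_le_iff)
    then have "real_of_int (\<bar>m\<bar> + \<bar>n\<bar>) / 2 \<le> real_of_int (\<bar>m\<bar> + \<bar>n + 1\<bar>)"
      by simp
    then have "c * ((M + N) / 2) \<le> c * real_of_int (\<bar>m\<bar> + \<bar>n + 1\<bar>)"
      using c(1) by (intro mult_left_mono) (auto simp: M_def N_def)
    also have "\<dots> \<le> norm (w + 1)"
      using c(2)[of m "n + 1"] by (simp add: w_def add.assoc)
    finally have 2: "c * ((M + N) / 2) \<le> norm (w + 1)" .
    have pos: "c * (M + N) > 0" and pos2: "c * ((M + N) / 2) > 0" using c(1) M N by simp_all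
    have "(c * (M + N))\<^sup>2 * (c * ((M + N) / 2)) \<le> (norm w)\<^sup>2 * norm (w + 1)"
      using 1 2 pos by (intro mult_mono power_mono) auto
    then have 3: "inverse ((norm w)\<^sup>2 * norm (w + 1)) \<le> inverse ((c * (M + N))\<^sup>2 * (c * ((M + N) / 2)))"
      by (rule le_imp_inverse_le) (intro mult_pos_pos zero_less_power pos pos2)
    have half: "(1 + M) / 2 \<le> M + N" "(1 + N) / 2 \<le> M + N" using M N by auto
    have "((1 + M) / 2) powr (3/2) * ((1 + N) / 2) powr (3/2) \<le> (M + N) powr (3/2) * (M + N) powr (3/2)"
      using half M N by (intro mult_mono powr_mono2) auto
    also have "\<dots> = (M + N) ^ 3"
      using M N by (simp flip: powr_add powr_numeral)
    finally have 4: "((1 + M) * (1 + N)) powr (3/2) / 8 \<le> (M + N) ^ 3"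
    proof -
      have "((1 + M) / 2) powr (3/2) * ((1 + N) / 2) powr (3/2) = ((1 + M) * (1 + N)) powr (3/2) / 4 powr (3/2)"
        using M N by (simp add: powr_divide powr_mult flip: powr_mult)
      moreover have "4 powr (3/2) = (8::real)"
      proof -
        have "(4::real) powr (3/2) = (2 powr 2) powr (3/2)" by simp
        also have "\<dots> = 2 powr 3" by (simp only: powr_powr) simp
        finally show ?thesis by simp
      qed
      ultimately show "((1 + M) / 2) powr (3/2) * ((1 + N) / 2) powr (3/2) \<le> (M + N) ^ 3 \<Longrightarrow> ?thesis"
        by simp
    qed
    have "inverse ((c * (M + N))\<^sup>2 * (c * ((M + N) / 2))) = 2 / c ^ 3 * inverse ((M + N) ^ 3)"
      by (simp add: field_simps power2_eq_square power3_eq_cube)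
    also have "\<dots> \<le> 2 / c ^ 3 * inverse (((1 + M) * (1 + N)) powr (3/2) / 8)"
      using 4 c(1) M N by (intro mult_left_mono le_imp_inverse_le) auto
    also have "\<dots> = 16 / c ^ 3 * (?g m * ?g n)"
    proof -
      have "((1 + M) * (1 + N)) powr (3/2) = (1 + M) powr (3/2) * (1 + N) powr (3/2)"
        by (rule powr_mult)
      then show ?thesis
        unfolding M_def[symmetric] N_def[symmetric]
        by (simp add: powr_minus inverse_eq_divide)
    qed
    finally show "norm (case x of (m, n) \<Rightarrow> 1 / ((of_int m * \<tau> + of_int n)\<^sup>2 * (of_int m * \<tau> + of_int n + 1))) \<le>
       16 / c ^ 3 * (case x of (m, n) \<Rightarrow> ?g m * ?g n)"
      using 3 unfolding mn(1) prod.case w_def[symmetric] norm_divide norm_mult norm_power norm_one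
      by (simp add: inverse_eq_divide)
  qed auto
qed

text \<open>The first N pairs collected as (n, -n-1) run from -N to N-1, so the sum is the limit of
  \<open>h\<close> on the left minus the limit on the right.\<close>

lemma has_sum_int_telescope:
  fixes f h :: "int \<Rightarrow> complex"
  assumes f: "f summable_on UNIV" "\<And>n. f n = h n - h (n + 1)"
    and lim: "(\<lambda>N. h (- int N) - h (int N)) \<longlonglongrightarrow> L"
  shows "(f has_sum L) UNIV"
proof -
  have "f summable_on range int" "f summable_on range (\<lambda>n. - int (Suc n))"
    by (rule summable_on_subset_banach[OF f(1)], simp)+
  then have "(\<lambda>n. f (int n)) summable_on UNIV" "(\<lambda>n. f (- int (Suc n))) summable_on UNIV"
    by (subst (asm) (1 2) summable_on_reindex; simp add: o_def inj_on_def)+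
  then obtain a b where ab: "((\<lambda>n. f (int n)) has_sum a) UNIV" "((\<lambda>n. f (- int (Suc n))) has_sum b) UNIV"
    unfolding summable_on_def by blast
  have "(\<lambda>n. f (int n) + f (- int (Suc n))) sums (a + b)"
    by (intro sums_add has_sum_imp_sums ab)
  moreover have "(\<Sum>n<N. f (int n) + f (- int (Suc n))) = h (- int N) - h (int N)" for N
    by (induction N) (simp_all add: f(2) add.commute)
  ultimately have "(\<lambda>N. h (- int N) - h (int N)) \<longlonglongrightarrow> a + b"
    by (simp only: sums_def)
  then have "L = a + b"
    using lim LIMSEQ_unique by blast
  then show ?thesis
    using has_sum_int_UNIV[OF ab] by simp
qed

lemma has_sum_remove_zero:
  fixes f :: "int \<Rightarrow> complex"
  assumes "(f has_sum s) UNIV"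
  shows "(f has_sum (s - f 0)) (- {0})"
proof -
  have "f summable_on (- {0})"
    by (rule summable_on_subset_banach[OF has_sum_imp_summable[OF assms]]) simp
  then obtain x where x: "(f has_sum x) (- {0})"
    unfolding summable_on_def by blast
  have "(f has_sum (f 0 + x)) ({0} \<union> - {0})"
    by (intro has_sum_Un_disjoint x has_sum_finiteI) auto
  then have "f 0 + x = s"
    using assms has_sum_unique by (metis Compl_partition)
  then have "x = s - f 0" by (simp add: algebra_simps)
  then show ?thesis using x by simp
qed

lemma has_sum_add_zero:
  fixes f :: "int \<Rightarrow> complex"
  assumes "(f has_sum s) (- {0})"
  shows "(f has_sum (f 0 + s)) UNIV"
proof -
  have "(f has_sum (f 0 + s)) ({0} \<union> - {0})"
    by (intro has_sum_Un_disjoint assms has_sum_finiteI) auto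
  then show ?thesis by simp
qed

lemma has_sum_inverse_squares_int:
  "((\<lambda>n::int. 1 / (of_int n)\<^sup>2 :: complex) has_sum ((of_real pi)\<^sup>2 / 3)) (- {0})"
proof -
  have "((\<lambda>n. 1 / (real (n + 1))\<^sup>2) has_sum (pi\<^sup>2 / 6)) UNIV"
    using inverse_squares_sums by (intro sums_nonneg_imp_has_sum) auto
  then have "((\<lambda>n. complex_of_real (1 / (real (n + 1))\<^sup>2)) has_sum complex_of_real (pi\<^sup>2 / 6)) UNIV"
    by (rule has_sum_of_real)
  then have "((\<lambda>n. 1 / (complex_of_int (int (Suc n)))\<^sup>2) has_sum complex_of_real (pi\<^sup>2 / 6)) UNIV"
    by simp
  from has_sum_int_even[OF this] show ?thesis
    by simp
qed

text \<open>The argument lies in the lower half-plane because \<open>n/\<tau>\<close> is minus n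
  times \<open>- 1/\<tau>\<close>. In this form the limit \<i> is visible when
  \<open>nome \<sigma>\<close> tends to 0.\<close>

lemma cot_minus_nome:
  assumes "Im \<sigma> > 0"
  shows "cot (of_real pi * - \<sigma>) = \<i> * (1 + nome \<sigma>) / (1 - nome \<sigma>)"
proof -
  define e where "e = exp (\<i> * (of_real pi * \<sigma>))"
  have e: "nome \<sigma> = e\<^sup>2" "e \<noteq> 0"
    by (simp_all add: e_def nome_def power2_eq_square flip: exp_add) (simp add: mult_ac)
  have e2: "1 - e\<^sup>2 \<noteq> 0"
    using norm_nome_less_1[OF assms] e by auto
  have s: "sin (of_real pi * \<sigma>) = (e - 1 / e) / (2 * \<i>)" "cos (of_real pi * \<sigma>) = (e + 1 / e) / 2"
    by (simp_all add: sin_exp_eq cos_exp_eq e_def exp_minus inverse_eq_divide)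
  have "e - 1 / e = - (1 - e\<^sup>2) / e" "e + 1 / e = (1 + e\<^sup>2) / e"
    using e(2) by (simp_all add: field_simps power2_eq_square)
  then have "sin (of_real pi * \<sigma>) = - (1 - e\<^sup>2) / e / (2 * \<i>)" "cos (of_real pi * \<sigma>) = (1 + e\<^sup>2) / e / 2"
    using s by simp_all
  moreover have "- ((1 + e\<^sup>2) / e / 2) / (- (1 - e\<^sup>2) / e / (2 * \<i>)) = \<i> * (1 + e\<^sup>2) / (1 - e\<^sup>2)"
  proof -
    have "- (a / e / 2) / (- b / e / (2 * \<i>)) = \<i> * a / b" if "b \<noteq> 0" for a b
      using e(2) that by (simp add: divide_simps)
    from this[OF e2] show ?thesis .
  qed
  ultimately show ?thesis
    unfolding cot_def e(1) by simp
qed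

text \<open>Along a row the correction \<open>1/w - 1/(w + 1)\<close> telescopes and its end terms
  tend to 0, so the row has the same sum as the plain squares.\<close>

lemma lattice_row:
  fixes \<tau> :: complex
  assumes \<tau>: "Im \<tau> > 0" and m: "m \<noteq> 0"
  shows "((\<lambda>n::int. 1 / ((of_int m * \<tau> + of_int n)\<^sup>2 * (of_int m * \<tau> + of_int n + 1))) has_sum
           (of_real pi / sin (of_real pi * (of_int m * \<tau>)))\<^sup>2) UNIV"
proof -
  define z where "z = of_int m * \<tau>"
  have nz: "z + of_int n \<noteq> 0" for n
    using lattice_nonzero[OF \<tau> m] by (simp add: z_def)
  have nz1: "z + of_int n + 1 \<noteq> 0" for n
    using nz[of "n + 1"] by (simp add: add.assoc)
  have "z \<notin> \<int>"
  proof
    assume "z \<in> \<int>"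
    then obtain n where "z = of_int n" by (elim Ints_cases)
    then show False using nz[of "- n"] by simp
  qed
  note sq = has_sum_inverse_square_shifts[OF this]
  have sm: "(\<lambda>n. 1 / ((z + of_int n)\<^sup>2 * (z + of_int n + 1))) summable_on UNIV"
  proof -
    have "(\<lambda>(m', n). 1 / ((of_int m' * \<tau> + of_int n)\<^sup>2 * (of_int m' * \<tau> + of_int n + 1))) summable_on (Pair m ` UNIV)"
      by (rule summable_on_subset_banach[OF lattice_summable[OF \<tau>]]) (use m in auto)
    then show ?thesis
      by (subst (asm) summable_on_reindex) (auto simp: inj_on_def o_def z_def)
  qed
  have eq: "1 / ((z + of_int n)\<^sup>2 * (z + of_int n + 1)) =
      1 / (z + of_int n)\<^sup>2 - (1 / (z + of_int n) - 1 / (z + of_int (n + 1)))" for n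
  proof -
    have "1 / (w\<^sup>2 * (w + 1)) = 1 / w\<^sup>2 - (1 / w - 1 / (w + 1))" if "w \<noteq> 0" "w + 1 \<noteq> 0" for w :: complex
      using that by (simp add: divide_simps power2_eq_square)
    from this[OF nz nz1] show ?thesis by (simp add: add.assoc)
  qed
  have "((\<lambda>n. 1 / (z + of_int n) - 1 / (z + of_int (n + 1))) has_sum 0) UNIV"
  proof (rule has_sum_int_telescope[where h = "\<lambda>n. 1 / (z + of_int n)"])
    have "(\<lambda>n. 1 / (z + of_int n)\<^sup>2 + - (1 / ((z + of_int n)\<^sup>2 * (z + of_int n + 1)))) summable_on UNIV"
      by (intro summable_on_add summable_on_uminus[THEN iffD2] sm has_sum_imp_summable[OF sq])
    then show "(\<lambda>n. 1 / (z + of_int n) - 1 / (z + of_int (n + 1))) summable_on UNIV"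
      by (simp add: eq)
    have "(\<lambda>N. inverse (z + of_nat N)) \<longlonglongrightarrow> 0"
      by (intro filterlim_compose[OF tendsto_inverse_0]
              tendsto_add_filterlim_at_infinity[OF tendsto_const] tendsto_of_nat)
    moreover have "(\<lambda>N. inverse (- z + of_nat N)) \<longlonglongrightarrow> 0"
      by (intro filterlim_compose[OF tendsto_inverse_0]
              tendsto_add_filterlim_at_infinity[OF tendsto_const] tendsto_of_nat)
    ultimately have "(\<lambda>N. - inverse (- z + of_nat N) - inverse (z + of_nat N)) \<longlonglongrightarrow> - 0 - 0"
      by (intro tendsto_intros)
    moreover have "- inverse (- z + of_nat N) = 1 / (z + of_int (- int N))" for N
      by (simp add: inverse_eq_divide minus_divide_right del: divide_minus_right)
    ultimately show "(\<lambda>N. 1 / (z + of_int (- int N)) - 1 / (z + of_int (int N))) \<longlonglongrightarrow> 0"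
      by (simp add: inverse_eq_divide)
  qed (rule refl)
  from has_sum_diff[OF sq this]
  show ?thesis
    unfolding z_def[symmetric] eq by simp
qed

text \<open>Taking out \<tau> turns the column into inverse squares of shifts of
  \<open>n/\<tau>\<close>. The omitted term m = 0 accounts for the subtraction, and the column n = 0
  is twice the value of zeta at 2, divided by \<open>\<tau>\<^sup>2\<close>.\<close>

lemma lattice_column_square:
  fixes \<tau> :: complex
  assumes \<tau>: "Im \<tau> > 0"
  shows "((\<lambda>m::int. 1 / (of_int m * \<tau> + of_int n)\<^sup>2) has_sum
     (if n = 0 then (of_real pi)\<^sup>2 / 3 / \<tau>\<^sup>2
      else (of_real pi / sin (of_real pi * (of_int n * (- 1 / \<tau>))))\<^sup>2 / \<tau>\<^sup>2 - 1 / (of_int n)\<^sup>2)) (- {0})"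
proof (cases "n = 0")
  case True
  have "((\<lambda>m::int. 1 / (of_int m)\<^sup>2 * (1 / \<tau>\<^sup>2)) has_sum (of_real pi)\<^sup>2 / 3 * (1 / \<tau>\<^sup>2)) (- {0})"
    by (rule has_sum_cmult_left[OF has_sum_inverse_squares_int])
  then show ?thesis
    using True by (simp add: power_mult_distrib)
next
  case False
  define z where "z = of_int n / \<tau>"
  have t0: "\<tau> \<noteq> 0" using \<tau> by auto
  have nz: "z + of_int m \<noteq> 0" for m
  proof -
    have "z + of_int m = (of_int m * \<tau> + of_int n) / \<tau>"
      using t0 by (simp add: z_def field_simps)
    moreover have "of_int m * \<tau> + of_int n \<noteq> 0"
      using lattice_nonzero[OF \<tau>, of m n] False by (cases "m = 0") auto
    ultimately show ?thesis using t0 by simp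
  qed
  have "z \<notin> \<int>"
  proof
    assume "z \<in> \<int>"
    then obtain k where "z = of_int k" by (elim Ints_cases)
    then show False using nz[of "- k"] by simp
  qed
  from has_sum_cmult_left[OF has_sum_inverse_square_shifts[OF this], of "1 / \<tau>\<^sup>2"]
  have "((\<lambda>m::int. 1 / (z + of_int m)\<^sup>2 * (1 / \<tau>\<^sup>2)) has_sum
     (of_real pi / sin (of_real pi * z))\<^sup>2 * (1 / \<tau>\<^sup>2)) UNIV" .
  moreover have "1 / (z + of_int m)\<^sup>2 * (1 / \<tau>\<^sup>2) = 1 / (of_int m * \<tau> + of_int n)\<^sup>2" for m
  proof -
    have "(z + of_int m) * \<tau> = of_int m * \<tau> + of_int n"
      using t0 by (simp add: z_def field_simps)
    then show ?thesis by (metis power_mult_distrib times_divide_times_eq mult_1)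
  qed
  ultimately have "((\<lambda>m::int. 1 / (of_int m * \<tau> + of_int n)\<^sup>2) has_sum
     (of_real pi / sin (of_real pi * z))\<^sup>2 * (1 / \<tau>\<^sup>2)) UNIV"
    by simp
  from has_sum_remove_zero[OF this]
  have "((\<lambda>m::int. 1 / (of_int m * \<tau> + of_int n)\<^sup>2) has_sum
     (of_real pi / sin (of_real pi * z))\<^sup>2 / \<tau>\<^sup>2 - 1 / (of_int n)\<^sup>2) (- {0})"
    by simp
  moreover have "(of_real pi / sin (of_real pi * (of_int n * (- 1 / \<tau>))))\<^sup>2 = (of_real pi / sin (of_real pi * z))\<^sup>2"
    by (simp add: z_def power_divide)
  ultimately show ?thesis
    using False by simp
qed

text \<open>Summed over pairs m and -m, the terms \<open>1/(m\<tau> + n)\<close> converge to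
  \<open>h n\<close> by the partial fractions of the cotangent; the omitted m = 0 gives
  \<open>- 1/n\<close>, and for n = 0 the pairs cancel.\<close>

lemma lattice_column_telescope:
  fixes \<tau> :: complex
  assumes \<tau>: "Im \<tau> > 0"
    and sm: "(f has_sum s) (- {0::int})"
    and f: "\<And>m. m \<noteq> 0 \<Longrightarrow> f m = 1 / (of_int m * \<tau> + of_int n) - 1 / (of_int m * \<tau> + of_int (n + 1))"
    and h: "\<And>n. h n = (if n = 0 then 0 else of_real pi / \<tau> * cot (of_real pi * (of_int n / \<tau>)) - 1 / of_int n)"
  shows "s = h n - h (n + 1)"
proof -
  have t0: "\<tau> \<noteq> 0" using \<tau> by auto
  have sums: "(\<lambda>k. 1 / (of_int (int (Suc k)) * \<tau> + of_int n) + 1 / (of_int (- int (Suc k)) * \<tau> + of_int n)) sums h n" for n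
  proof (cases "n = 0")
    case True
    have "1 / (w * \<tau>) + 1 / (- w * \<tau>) = 0" for w :: complex
      by (simp only: mult_minus_left divide_minus_right add.right_inverse)
    from this[of "of_int (int (Suc _))"] show ?thesis
      unfolding h True of_int_0 add_0_right of_int_minus by (simp only: sums_zero if_True simp_thms)
  next
    case False
    define z where "z = of_int n / \<tau>"
    have "z \<notin> \<int>"
    proof
      assume "z \<in> \<int>"
      then obtain k where "of_int n / \<tau> = of_int k" unfolding z_def by (elim Ints_cases)
      then have "of_int n = of_int k * \<tau>" using t0 by (simp add: field_simps)
      then have "Im (of_int n) = Im (of_int k * \<tau>)" "Re (of_int n) = Re (of_int k * \<tau>)" by simp_all
      then show False using \<tau> False by auto
    qed
    from sums_mult[OF cot_sums[OF this], of "1 / \<tau>"]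
    have "(\<lambda>m. 1 / \<tau> * (1 / (z + of_nat (Suc m)) + 1 / (z - of_nat (Suc m)))) sums
        (1 / \<tau> * (of_real pi * cot (of_real pi * z) - 1 / z))" .
    moreover have "1 / \<tau> * (1 / (z + w) + 1 / (z - w)) = 1 / (w * \<tau> + of_int n) + 1 / (- w * \<tau> + of_int n)" for w
    proof -
      have "(z + w) * \<tau> = w * \<tau> + of_int n" "(z - w) * \<tau> = - w * \<tau> + of_int n"
        using t0 by (simp_all add: z_def field_simps)
      then have "1 / \<tau> * (1 / (z + w)) = 1 / (w * \<tau> + of_int n)" "1 / \<tau> * (1 / (z - w)) = 1 / (- w * \<tau> + of_int n)"
        by (metis times_divide_times_eq mult_1 mult.commute)+
      then show ?thesis by (simp only: distrib_left)
    qed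
    moreover have "1 / \<tau> * (of_real pi * cot (of_real pi * z) - 1 / z) = h n"
      using False t0 by (simp add: h z_def algebra_simps)
    ultimately show ?thesis
      by (simp only: of_int_of_nat_eq of_int_minus)
  qed
  have "(\<lambda>k. f (int (Suc k)) + f (- int (Suc k))) sums s"
    using has_sum_int_nonzero[OF has_sum_imp_summable[OF sm]] infsumI[OF sm] has_sum_imp_sums by metis
  moreover have "f (int (Suc k)) + f (- int (Suc k)) =
     (1 / (of_int (int (Suc k)) * \<tau> + of_int n) + 1 / (of_int (- int (Suc k)) * \<tau> + of_int n)) -
     (1 / (of_int (int (Suc k)) * \<tau> + of_int (n + 1)) + 1 / (of_int (- int (Suc k)) * \<tau> + of_int (n + 1)))" for k
    using f[of "int (Suc k)"] f[of "- int (Suc k)"] by (simp del: of_int_add of_nat_Suc)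
  ultimately show ?thesis
    using sums_diff[OF sums[of n] sums[of "n + 1"]] sums_unique2 by (simp only:) blast
qed

text \<open>By rows, the absolutely convergent sum \<open>S\<close> equals the row-wise sum of the
  plain squares, a multiple of the divisor series at \<tau>. By columns, it differs from the
  column-wise sum \<open>T\<close> of the squares, which involves that series at
  \<open>- 1/\<tau>\<close>, by telescoping terms. Here \<open>h\<close> has different limits at the
  two ends, and their difference \<open>- 2\<pi>\<i>/\<tau>\<close> is the inhomogeneous term of the
  law.\<close>

theorem E2_transform:
  fixes \<tau> :: complex
  assumes \<tau>: "Im \<tau> > 0"
  shows "eval_fps E2_fps (nome (- 1 / \<tau>)) = \<tau>\<^sup>2 * eval_fps E2_fps (nome \<tau>) + 6 * \<tau> / (of_real pi * \<i>)"
proof -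
  define a where "a = (\<lambda>m n. 1 / ((of_int m * \<tau> + of_int n)\<^sup>2 * (of_int m * \<tau> + of_int n + 1)))"
  define P :: complex where "P = of_real pi"
  define s where "s \<sigma> = eval_fps sigma_fps (nome \<sigma>)" for \<sigma>
  define h where "h n = (if n = 0 then 0 else of_real pi / \<tau> * cot (of_real pi * (of_int n / \<tau>)) - 1 / of_int n)" for n :: int
  define C where "C n = (if n = 0 then P\<^sup>2 / 3 / \<tau>\<^sup>2
      else (P / sin (P * (of_int n * (- 1 / \<tau>))))\<^sup>2 / \<tau>\<^sup>2 - 1 / (of_int n)\<^sup>2)" for n :: int
  have t0: "\<tau> \<noteq> 0" using \<tau> by auto
  have sm: "(\<lambda>(m, n). a m n) summable_on ((- {0}) \<times> UNIV)"
    unfolding a_def by (rule lattice_summable[OF \<tau>])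
  then obtain S where S: "((\<lambda>(m, n). a m n) has_sum S) ((- {0}) \<times> UNIV)"
    unfolding summable_on_def by blast
  have "((\<lambda>m. (of_real pi / sin (of_real pi * (of_int m * \<tau>)))\<^sup>2) has_sum S) (- {0})"
    using S by (rule has_sum_SigmaD) (use lattice_row[OF \<tau>] in \<open>simp add: a_def\<close>)
  then have S1: "S = - 8 * P\<^sup>2 * s \<tau>"
    using sin_squares_has_sum[OF \<tau>] has_sum_unique unfolding P_def s_def by blast
  have S': "((\<lambda>(n, m). a m n) has_sum S) (UNIV \<times> (- {0}))"
    using S by (subst has_sum_swap) simp
  have colsm: "(\<lambda>m. a m n) summable_on (- {0})" for n
  proof -
    have "(\<lambda>(m, n). a m n) summable_on ((\<lambda>m. (m, n)) ` (- {0}))"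
      by (rule summable_on_subset_banach[OF sm]) auto
    then show ?thesis
      by (subst (asm) summable_on_reindex) (auto simp: inj_on_def o_def)
  qed
  define col where "col n = infsum (\<lambda>m. a m n) (- {0})" for n
  have col: "((\<lambda>m. a m n) has_sum col n) (- {0})" for n
    unfolding col_def by (rule has_sum_infsum[OF colsm])
  have colS: "(col has_sum S) UNIV"
    using S' by (rule has_sum_SigmaD) (simp add: col)
  have C: "((\<lambda>m. 1 / (of_int m * \<tau> + of_int n)\<^sup>2) has_sum C n) (- {0})" for n
    using lattice_column_square[OF \<tau>, of n] unfolding C_def P_def .
  define T where "T = P\<^sup>2 / 3 / \<tau>\<^sup>2 + ((- 8 * P\<^sup>2 * s (- 1 / \<tau>)) / \<tau>\<^sup>2 - P\<^sup>2 / 3)"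
  have CT: "(C has_sum T) UNIV"
  proof -
    have "((\<lambda>n::int. (P / sin (P * (of_int n * (- 1 / \<tau>))))\<^sup>2 * (1 / \<tau>\<^sup>2) - 1 / (of_int n)\<^sup>2) has_sum
        ((- 8 * P\<^sup>2 * s (- 1 / \<tau>)) * (1 / \<tau>\<^sup>2) - P\<^sup>2 / 3)) (- {0})"
      unfolding P_def s_def
      by (intro has_sum_diff has_sum_cmult_left sin_squares_has_sum has_sum_inverse_squares_int Im_inverse_pos \<tau>)
    then have "(C has_sum ((- 8 * P\<^sup>2 * s (- 1 / \<tau>)) * (1 / \<tau>\<^sup>2) - P\<^sup>2 / 3)) (- {0})"
      by (rule has_sum_cong[THEN iffD1, rotated]) (simp add: C_def)
    from has_sum_add_zero[OF this] show ?thesis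
      by (simp add: T_def C_def)
  qed
  have tel: "C n - col n = h n - h (n + 1)" for n
  proof (rule lattice_column_telescope[OF \<tau> has_sum_diff[OF C col] _ h_def])
    fix m :: int assume m: "m \<noteq> 0"
    have "1 / w\<^sup>2 - 1 / (w\<^sup>2 * (w + 1)) = 1 / w - 1 / (w + 1)" if "w \<noteq> 0" "w + 1 \<noteq> 0" for w :: complex
      using that by (simp add: divide_simps power2_eq_square)
    from this[of "of_int m * \<tau> + of_int n"] show "1 / (of_int m * \<tau> + of_int n)\<^sup>2 - a m n =
        1 / (of_int m * \<tau> + of_int n) - 1 / (of_int m * \<tau> + of_int (n + 1))"
      using lattice_nonzero[OF \<tau> m, of n] lattice_nonzero[OF \<tau> m, of "n + 1"]
      by (simp add: a_def add.assoc)
  qed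
  have "((\<lambda>n. C n - col n) has_sum (- 2 * P * \<i> / \<tau>)) UNIV"
  proof (rule has_sum_int_telescope[OF has_sum_imp_summable[OF has_sum_diff[OF CT colS]] tel])
    define x where "x = nome (- 1 / \<tau>)"
    have x: "norm x < 1"
      unfolding x_def by (intro norm_nome_less_1 Im_inverse_pos \<tau>)
    have hN: "h (- int N) - h (int N) = - 2 * P / \<tau> * (\<i> * (1 + x ^ N) / (1 - x ^ N)) + 2 * (1 / of_nat N)"
      if N: "N > 0" for N
    proof -
      have "Im (of_nat N * (- 1 / \<tau>)) > 0"
      proof -
        have "Im (of_nat N * w) = real N * Im w" for w by simp
        then show ?thesis
          using mult_pos_pos[OF _ Im_inverse_pos[OF \<tau>], of "real N"] N by (simp only: of_nat_0_less_iff)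
      qed
      from cot_minus_nome[OF this]
      have "cot (P * (of_nat N / \<tau>)) = \<i> * (1 + x ^ N) / (1 - x ^ N)"
        unfolding nome_mult x_def P_def by simp
      moreover have "cot (P * (of_int (- int N) / \<tau>)) = - cot (P * (of_nat N / \<tau>))"
        by (simp add: cot_def)
      ultimately show ?thesis
        using N by (simp add: h_def flip: P_def)
    qed
    have "(\<lambda>N. - 2 * P / \<tau> * (\<i> * (1 + x ^ N) / (1 - x ^ N)) + 2 * (1 / of_nat N)) \<longlonglongrightarrow>
        - 2 * P / \<tau> * (\<i> * (1 + 0) / (1 - 0)) + 2 * 0"
      by (intro tendsto_intros LIMSEQ_power_zero x lim_1_over_n) simp
    then have "(\<lambda>N. - 2 * P / \<tau> * (\<i> * (1 + x ^ N) / (1 - x ^ N)) + 2 * (1 / of_nat N)) \<longlonglongrightarrow> - 2 * P * \<i> / \<tau>"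
      by (simp add: mult_ac)
    then show "(\<lambda>N. h (- int N) - h (int N)) \<longlonglongrightarrow> - 2 * P * \<i> / \<tau>"
    proof (rule Lim_transform_eventually)
      show "\<forall>\<^sub>F N in sequentially. - 2 * P / \<tau> * (\<i> * (1 + x ^ N) / (1 - x ^ N)) + 2 * (1 / of_nat N) =
          h (- int N) - h (int N)"
        using eventually_gt_at_top[of 0] by eventually_elim (simp only: hN)
    qed
  qed
  then have "T - S = - 2 * P * \<i> / \<tau>"
    using has_sum_diff[OF CT colS] has_sum_unique by blast
  then have main: "P\<^sup>2 / 3 / \<tau>\<^sup>2 + ((- 8 * P\<^sup>2 * s (- 1 / \<tau>)) / \<tau>\<^sup>2 - P\<^sup>2 / 3) + 8 * P\<^sup>2 * s \<tau> = - 2 * P * \<i> / \<tau>"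
    by (simp add: T_def S1)
  have P0: "P \<noteq> 0" by (simp add: P_def)
  have "(P\<^sup>2 / 3 / \<tau>\<^sup>2 + ((- 8 * P\<^sup>2 * s (- 1 / \<tau>)) / \<tau>\<^sup>2 - P\<^sup>2 / 3) + 8 * P\<^sup>2 * s \<tau>) * (3 * \<tau>\<^sup>2 / P\<^sup>2) =
      (1 - 24 * s (- 1 / \<tau>)) - \<tau>\<^sup>2 * (1 - 24 * s \<tau>)"
    using P0 t0 by (simp add: field_simps)
  moreover have "(- 2 * P * \<i> / \<tau>) * (3 * \<tau>\<^sup>2 / P\<^sup>2) = 6 * \<tau> / (P * \<i>)"
    using P0 t0 by (simp add: field_simps power2_eq_square)
  ultimately have fin: "(1 - 24 * s (- 1 / \<tau>)) = \<tau>\<^sup>2 * (1 - 24 * s \<tau>) + 6 * \<tau> / (P * \<i>)"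
    unfolding main by (metis diff_eq_eq add.commute)
  have E: "eval_fps E2_fps (nome \<sigma>) = 1 - 24 * s \<sigma>" if "Im \<sigma> > 0" for \<sigma>
  proof -
    have "ereal (norm (nome \<sigma>)) < fps_conv_radius sigma_fps"
      by (rule less_le_trans[OF _ sigma_fps_radius]) (use norm_nome_less_1[OF that] in simp)
    moreover from this have "ereal (norm (nome \<sigma>)) < fps_conv_radius (24 * sigma_fps)"
      by (rule less_le_trans) (use fps_conv_radius_mult[of 24 sigma_fps] in simp)
    ultimately show ?thesis
      by (simp add: E2_fps_def s_def eval_fps_diff eval_fps_mult)
  qed
  show ?thesis
    using fin unfolding E[OF \<tau>] E[OF Im_inverse_pos[OF \<tau>]] P_def .
qed

subsection \<open>Power series on the unit disc\<close>

definition disc :: "complex fps set" where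
  "disc = {A. fps_conv_radius A \<ge> 1}"

lemma disc_radius: "A \<in> disc \<Longrightarrow> norm q < 1 \<Longrightarrow> ereal (norm q) < fps_conv_radius A"
  unfolding disc_def by (rule less_le_trans[of _ "ereal 1"]) (simp_all flip: one_ereal_def)

lemma disc_add: "A \<in> disc \<Longrightarrow> B \<in> disc \<Longrightarrow> A + B \<in> disc"
  and disc_diff: "A \<in> disc \<Longrightarrow> B \<in> disc \<Longrightarrow> A - B \<in> disc"
  and disc_mult: "A \<in> disc \<Longrightarrow> B \<in> disc \<Longrightarrow> A * B \<in> disc"
  and disc_uminus: "A \<in> disc \<Longrightarrow> - A \<in> disc"
  and disc_power: "A \<in> disc \<Longrightarrow> A ^ n \<in> disc"
  and disc_const: "fps_const c \<in> disc"
  and disc_0: "0 \<in> disc"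
  and disc_1: "1 \<in> disc"
  and disc_numeral: "numeral k \<in> disc"
  and disc_X: "fps_X \<in> disc"
  and disc_deriv: "A \<in> disc \<Longrightarrow> fps_deriv A \<in> disc"
  unfolding disc_def mem_Collect_eq
  using fps_conv_radius_add[of A B] fps_conv_radius_diff[of A B] fps_conv_radius_mult[of A B]
    fps_conv_radius_power[of A n] fps_conv_radius_deriv[of A]
  by (auto intro: order_trans min.boundedI)

lemmas disc_intros = disc_add disc_diff disc_mult disc_uminus disc_power disc_const disc_0 disc_1
  disc_numeral disc_X disc_deriv

lemma
  assumes "A \<in> disc" "norm q < 1"
  shows disc_eval_add: "B \<in> disc \<Longrightarrow> eval_fps (A + B) q = eval_fps A q + eval_fps B q"
    and disc_eval_diff: "B \<in> disc \<Longrightarrow> eval_fps (A - B) q = eval_fps A q - eval_fps B q"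
    and disc_eval_mult: "B \<in> disc \<Longrightarrow> eval_fps (A * B) q = eval_fps A q * eval_fps B q"
    and disc_eval_uminus: "eval_fps (- A) q = - eval_fps A q"
    and disc_eval_power: "eval_fps (A ^ n) q = eval_fps A q ^ n"
  using disc_radius[OF _ assms(2)] assms(1)
  by (simp_all add: eval_fps_add eval_fps_diff eval_fps_mult eval_fps_minus eval_fps_power)

lemmas disc_eval = disc_eval_add disc_eval_diff disc_eval_mult disc_eval_uminus disc_eval_power

lemma disc_holomorphic: "A \<in> disc \<Longrightarrow> eval_fps A holomorphic_on ball 0 1"
  by (rule holomorphic_on_eval_fps) (auto intro: disc_radius)

lemma disc_has_field_derivative:
  "A \<in> disc \<Longrightarrow> norm q < 1 \<Longrightarrow> (eval_fps A has_field_derivative eval_fps (fps_deriv A) q) (at q)"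
  by (intro has_field_derivative_eval_fps disc_radius)

lemma disc_of_holomorphic:
  assumes "f holomorphic_on ball 0 1"
  obtains A where "A \<in> disc" "\<And>q. norm q < 1 \<Longrightarrow> eval_fps A q = f q"
proof
  have h: "f holomorphic_on eball 0 (ereal 1)"
    using assms by (simp add: eball_ereal)
  show "fps_expansion f 0 \<in> disc"
    using conv_radius_fps_expansion[OF h] by (simp add: disc_def one_ereal_def)
  show "eval_fps (fps_expansion f 0) q = f q" if "norm q < 1" for q
    using eval_fps_expansion'[OF h, of q] that by simp
qed

text \<open>The value 0 is not of the form \<open>nome \<tau>\<close>, so agreement is available
  only away from 0; multiplying both series by \<open>fps_X\<close> restores it there.\<close>

lemma disc_eqI:
  assumes A: "A \<in> disc" and B: "B \<in> disc"
    and eq: "\<And>q. q \<noteq> 0 \<Longrightarrow> norm q < 1 \<Longrightarrow> eval_fps A q = eval_fps B q"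
  shows "A = B"
proof -
  have "eval_fps (fps_X * A) q = eval_fps (fps_X * B) q" if "norm q < 1" for q
    using eq[of q] that A B by (cases "q = 0") (simp_all add: disc_eval_mult disc_X eval_fps_at_0)
  moreover have "eventually (\<lambda>q::complex. q \<in> ball 0 1) (nhds 0)"
    by (rule eventually_nhds_in_open) auto
  ultimately have "eventually (\<lambda>q. eval_fps (fps_X * A) q = eval_fps (fps_X * B) q) (nhds 0)"
    by (auto elim!: eventually_mono)
  moreover have "fps_X * A \<in> disc" "fps_X * B \<in> disc"
    by (intro disc_intros A B)+
  then have "fps_conv_radius (fps_X * A) > 0" "fps_conv_radius (fps_X * B) > 0"
    by (auto simp: disc_def intro: less_le_trans[of _ 1])
  ultimately have "fps_X * A = fps_X * B"
    by (intro eval_fps_eqD)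
  then show ?thesis by simp
qed

text \<open>The quotient of \<open>A\<close> by \<open>P\<close> continues holomorphically across
  the zeros of \<open>P\<close> as \<open>H/b\<close>, because \<open>b\<close> does not vanish
  there. This gives divisibility without counting multiplicities.\<close>

lemma disc_divide:
  assumes A: "A \<in> disc" and P: "P \<in> disc" and b: "b \<in> disc" and H: "H \<in> disc"
    and eq: "A * b = P * H"
    and nz: "\<And>q. norm q < 1 \<Longrightarrow> eval_fps P q = 0 \<Longrightarrow> eval_fps b q \<noteq> 0"
  obtains Q where "Q \<in> disc" "A = P * Q"
proof -
  have ev: "eval_fps A q * eval_fps b q = eval_fps P q * eval_fps H q" if "norm q < 1" for q
    using arg_cong[OF eq, of "\<lambda>Z. eval_fps Z q"] that A P b H by (simp add: disc_eval_mult)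
  define f where "f q = (if eval_fps P q \<noteq> 0 then eval_fps A q / eval_fps P q else eval_fps H q / eval_fps b q)" for q
  let ?U = "ball 0 1 \<inter> (eval_fps P -` (- {0}))" and ?V = "ball 0 1 \<inter> (eval_fps b -` (- {0}))"
  have cont: "continuous_on (ball 0 1) (eval_fps P)" "continuous_on (ball 0 1) (eval_fps b)"
    using P b by (auto intro!: holomorphic_on_imp_continuous_on disc_holomorphic)
  have "open ?U" "open ?V"
    by (rule continuous_open_preimage; use cont in \<open>simp add: open_Compl\<close>)+
  moreover have "f holomorphic_on ?U"
  proof -
    have "(\<lambda>q. eval_fps A q / eval_fps P q) holomorphic_on ?U"
      by (intro holomorphic_intros holomorphic_on_subset[OF disc_holomorphic[OF A]]
            holomorphic_on_subset[OF disc_holomorphic[OF P]]) auto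
    then show ?thesis
      by (rule holomorphic_transform) (auto simp: f_def)
  qed
  moreover have "f holomorphic_on ?V"
  proof -
    have "(\<lambda>q. eval_fps H q / eval_fps b q) holomorphic_on ?V"
      by (intro holomorphic_intros holomorphic_on_subset[OF disc_holomorphic[OF H]]
            holomorphic_on_subset[OF disc_holomorphic[OF b]]) auto
    then show ?thesis
      by (rule holomorphic_transform) (use ev in \<open>auto simp: f_def field_simps\<close>)
  qed
  ultimately have "f holomorphic_on (?U \<union> ?V)"
    by (intro holomorphic_on_Un)
  moreover have "?U \<union> ?V = ball 0 1"
    using nz by auto
  ultimately obtain Q where Q: "Q \<in> disc" "\<And>q. norm q < 1 \<Longrightarrow> eval_fps Q q = f q"
    using disc_of_holomorphic by metis
  have "A = P * Q"
  proof (rule disc_eqI)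
    fix q :: complex assume "norm q < 1"
    then show "eval_fps A q = eval_fps (P * Q) q"
      using ev[of q] nz[of q] Q P by (auto simp: disc_eval_mult f_def)
  qed (intro disc_intros A P Q(1))+
  then show ?thesis using that Q by blast
qed

text \<open>The operator q d/dq, which is d/d\<tau> divided by \<open>2\<pi>\<i>\<close>. The ring
  is arbitrary because integral series are differentiated as well.\<close>

definition qderiv :: "'a::comm_ring_1 fps \<Rightarrow> 'a fps" where
  "qderiv A = fps_X * fps_deriv A"

lemma qderiv_nth: "fps_nth (qderiv A) n = of_nat n * fps_nth A n"
  by (cases n) (simp_all add: qderiv_def)

lemma qderiv_add: "qderiv (A + B) = qderiv A + qderiv B"
  and qderiv_diff: "qderiv (A - B) = qderiv A - qderiv B"
  and qderiv_mult: "qderiv (A * B) = qderiv A * B + A * qderiv B"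
  and qderiv_const [simp]: "qderiv (fps_const c) = 0"
  and qderiv_1 [simp]: "qderiv 1 = 0"
  and qderiv_0 [simp]: "qderiv 0 = 0"
  and qderiv_numeral [simp]: "qderiv (numeral k) = 0"
  by (simp_all add: qderiv_def algebra_simps)

lemma disc_qderiv: "A \<in> disc \<Longrightarrow> qderiv A \<in> disc"
  unfolding qderiv_def by (intro disc_intros)

lemma disc_sigma: "sigma_fps \<in> disc"
  using sigma_fps_radius by (simp add: disc_def)

lemma disc_E2: "E2_fps \<in> disc"
  unfolding E2_fps_def by (intro disc_intros disc_sigma)

subsection \<open>Transformation behaviour\<close>

definition at_nome :: "complex fps \<Rightarrow> complex \<Rightarrow> complex" where
  "at_nome A \<tau> = eval_fps A (nome \<tau>)"

lemma nome_surj: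
  assumes "q \<noteq> 0" "norm q < 1"
  obtains \<tau> where "Im \<tau> > 0" "nome \<tau> = q"
proof
  show "nome (Ln q / (2 * of_real pi * \<i>)) = q"
    using assms by (simp add: nome_def)
  show "Im (Ln q / (2 * of_real pi * \<i>)) > 0"
    using assms by (simp add: Im_divide power2_eq_square divide_neg_pos)
qed

lemma at_nome_eqI:
  assumes "A \<in> disc" "B \<in> disc" "\<And>\<tau>. Im \<tau> > 0 \<Longrightarrow> at_nome A \<tau> = at_nome B \<tau>"
  shows "A = B"
proof (rule disc_eqI)
  fix q :: complex assume "q \<noteq> 0" "norm q < 1"
  then show "eval_fps A q = eval_fps B q"
    using assms(3) unfolding at_nome_def by (metis nome_surj)
qed (use assms in auto)

lemma
  assumes "A \<in> disc" "Im \<tau> > 0"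
  shows at_nome_add: "B \<in> disc \<Longrightarrow> at_nome (A + B) \<tau> = at_nome A \<tau> + at_nome B \<tau>"
    and at_nome_diff: "B \<in> disc \<Longrightarrow> at_nome (A - B) \<tau> = at_nome A \<tau> - at_nome B \<tau>"
    and at_nome_mult: "B \<in> disc \<Longrightarrow> at_nome (A * B) \<tau> = at_nome A \<tau> * at_nome B \<tau>"
    and at_nome_uminus: "at_nome (- A) \<tau> = - at_nome A \<tau>"
    and at_nome_power: "at_nome (A ^ n) \<tau> = at_nome A \<tau> ^ n"
  using assms norm_nome_less_1[of \<tau>] unfolding at_nome_def by (simp_all add: disc_eval)

lemma at_nome_const [simp]: "at_nome (fps_const c) \<tau> = c"
  and at_nome_1 [simp]: "at_nome 1 \<tau> = 1"
  and at_nome_0 [simp]: "at_nome 0 \<tau> = 0"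
  and at_nome_numeral [simp]: "at_nome (numeral k) \<tau> = numeral k"
  and at_nome_X [simp]: "at_nome fps_X \<tau> = nome \<tau>"
  by (simp_all add: at_nome_def)

lemmas at_nome_simps = at_nome_add at_nome_diff at_nome_mult at_nome_uminus at_nome_power

lemma at_nome_has_field_derivative:
  assumes A: "A \<in> disc" and \<tau>: "Im \<tau> > 0"
  shows "(at_nome A has_field_derivative 2 * of_real pi * \<i> * at_nome (qderiv A) \<tau>) (at \<tau>)"
proof -
  have n: "(nome has_field_derivative 2 * of_real pi * \<i> * nome \<tau>) (at \<tau>)"
    unfolding nome_def by (auto intro!: derivative_eq_intros)
  from DERIV_chain2[OF disc_has_field_derivative[OF A norm_nome_less_1[OF \<tau>]] n]
  show ?thesis
    using \<tau> A by (simp add: at_nome_def[abs_def] qderiv_def disc_eval_mult norm_nome_less_1 disc_intros mult_ac)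
qed

lemma twisted_has_field_derivative:
  assumes A: "A \<in> disc" and \<tau>: "Im \<tau> > 0"
  shows "((\<lambda>\<tau>. exp (2 * of_real pi * \<i> * m * \<tau>) * at_nome A \<tau>) has_field_derivative
     2 * of_real pi * \<i> * (exp (2 * of_real pi * \<i> * m * \<tau>) * at_nome (qderiv A + fps_const m * A) \<tau>)) (at \<tau>)"
  using A \<tau>
  by (auto intro!: derivative_eq_intros at_nome_has_field_derivative[OF A \<tau>]
       simp: at_nome_simps disc_intros disc_qderiv algebra_simps)

lemma at_nome_E2:
  assumes "Im \<tau> > 0"
  shows "at_nome E2_fps (- 1 / \<tau>) = \<tau>\<^sup>2 * at_nome E2_fps \<tau> + 6 * \<tau> / (of_real pi * \<i>)"
  using E2_transform[OF assms] by (simp add: at_nome_def)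

section \<open>Serre derivatives and scalar forms\<close>

lemma inverse_chain:
  assumes f: "\<And>\<tau>. Im \<tau> > 0 \<Longrightarrow> (f has_field_derivative f' \<tau>) (at \<tau>)" and \<tau>: "Im \<tau> > 0"
  shows "((\<lambda>\<tau>. f (- 1 / \<tau>)) has_field_derivative f' (- 1 / \<tau>) / \<tau>\<^sup>2) (at \<tau>)"
proof -
  have t0: "\<tau> \<noteq> 0" using \<tau> by auto
  have "((\<lambda>\<tau>. - 1 / \<tau>) has_field_derivative 1 / \<tau>\<^sup>2) (at \<tau>)"
    using t0 by (auto intro!: derivative_eq_intros simp: power2_eq_square)
  from DERIV_chain2[OF f[OF Im_inverse_pos[OF \<tau>]] this] show ?thesis by simp
qed

lemma open_upper_half: "open {\<tau>. Im \<tau> > 0}"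
  by (rule open_halfspace_Im_gt)

lemma eventually_upper_half: "Im \<tau> > 0 \<Longrightarrow> eventually (\<lambda>\<sigma>. Im \<sigma> > 0) (nhds \<tau>)"
  using eventually_nhds_in_open[OF open_upper_half, of \<tau>] by simp

text \<open>Differentiating the factor \<open>\<tau> powi k\<close> produces an extra multiple of
  \<open>\<tau> powi (k + 1) * g \<tau>\<close>; k/12 times the inhomogeneous term of
  \<open>E2_fps\<close> cancels it. Two functions \<open>f\<close> and \<open>g\<close> are allowed
  so that \<open>g\<close> can be a combination of the components of a vector.\<close>

lemma serre_transform:
  fixes k :: int
  assumes f: "\<And>\<tau>. Im \<tau> > 0 \<Longrightarrow> (f has_field_derivative 2 * of_real pi * \<i> * f1 \<tau>) (at \<tau>)"
    and g: "\<And>\<tau>. Im \<tau> > 0 \<Longrightarrow> (g has_field_derivative 2 * of_real pi * \<i> * g1 \<tau>) (at \<tau>)"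
    and fg: "\<And>\<tau>. Im \<tau> > 0 \<Longrightarrow> f (- 1 / \<tau>) = \<tau> powi k * g \<tau>"
    and \<tau>: "Im \<tau> > 0"
  shows "f1 (- 1 / \<tau>) - of_int k / 12 * at_nome E2_fps (- 1 / \<tau>) * f (- 1 / \<tau>) =
     \<tau> powi (k + 2) * (g1 \<tau> - of_int k / 12 * at_nome E2_fps \<tau> * g \<tau>)"
proof -
  define P :: complex where "P = of_real pi * \<i>"
  have P: "P \<noteq> 0" by (simp add: P_def)
  have t0: "\<tau> \<noteq> 0" using \<tau> by auto
  have d1: "((\<lambda>\<tau>. f (- 1 / \<tau>)) has_field_derivative 2 * P * f1 (- 1 / \<tau>) / \<tau>\<^sup>2) (at \<tau>)"
    using inverse_chain[of f, OF f \<tau>] by (simp add: P_def mult_ac)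
  have "((\<lambda>\<tau>. \<tau> powi k * g \<tau>) has_field_derivative
     of_int k * \<tau> powi (k - 1) * g \<tau> + \<tau> powi k * (2 * P * g1 \<tau>)) (at \<tau>)"
    using g[OF \<tau>] t0 unfolding P_def
    by (auto intro!: derivative_eq_intros simp: mult_ac)
  then have d2: "((\<lambda>\<tau>. f (- 1 / \<tau>)) has_field_derivative
     of_int k * \<tau> powi (k - 1) * g \<tau> + \<tau> powi k * (2 * P * g1 \<tau>)) (at \<tau>)"
    by (rule DERIV_cong_ev[THEN iffD1, OF refl _ refl, rotated])
       (use eventually_upper_half[OF \<tau>] fg in \<open>auto elim!: eventually_mono\<close>)
  have pw: "\<tau> powi (k - 1) = \<tau> powi k / \<tau>" "\<tau> powi (k + 2) = \<tau> powi k * \<tau>\<^sup>2"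
    using t0 by (simp_all add: power_int_diff power_int_add)
  have "2 * P * f1 (- 1 / \<tau>) / \<tau>\<^sup>2 = of_int k * (\<tau> powi k / \<tau>) * g \<tau> + \<tau> powi k * (2 * P * g1 \<tau>)"
    using DERIV_unique[OF d1 d2] by (simp add: pw)
  then have "f1 (- 1 / \<tau>) = \<tau> powi k * \<tau>\<^sup>2 * g1 \<tau> + of_int k * \<tau> powi k * \<tau> * g \<tau> / (2 * P)"
    using P t0 by (simp add: field_simps power2_eq_square)
  then have f1: "f1 (- 1 / \<tau>) = \<tau> powi k * \<tau>\<^sup>2 * g1 \<tau> + of_int k / 12 * (6 * \<tau> / P) * (\<tau> powi k * g \<tau>)"
    using P by (simp add: field_simps)
  show ?thesis
    unfolding at_nome_E2[OF \<tau>] fg[OF \<tau>] pw P_def[symmetric] f1 by (simp only: ring_distribs) simp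
qed

text \<open>Invariance under T and holomorphy at the cusp are built in, since the form is a power
  series in \<open>nome \<tau>\<close>; only the law for S remains to be required.\<close>

definition mform :: "int \<Rightarrow> complex fps set" where
  "mform w = {A \<in> disc. \<forall>\<tau>. Im \<tau> > 0 \<longrightarrow> at_nome A (- 1 / \<tau>) = \<tau> powi w * at_nome A \<tau>}"

lemma mform_disc: "A \<in> mform w \<Longrightarrow> A \<in> disc"
  and mform_transform: "A \<in> mform w \<Longrightarrow> Im \<tau> > 0 \<Longrightarrow> at_nome A (- 1 / \<tau>) = \<tau> powi w * at_nome A \<tau>"
  by (auto simp: mform_def)

lemma mform_0: "0 \<in> mform w"
  and mform_1: "1 \<in> mform 0"
  by (auto simp: mform_def disc_intros)

lemma mform_add: "A \<in> mform w \<Longrightarrow> B \<in> mform w \<Longrightarrow> A + B \<in> mform w"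
  and mform_diff: "A \<in> mform w \<Longrightarrow> B \<in> mform w \<Longrightarrow> A - B \<in> mform w"
  and mform_cmult: "A \<in> mform w \<Longrightarrow> fps_const c * A \<in> mform w"
  by (auto simp: mform_def disc_intros at_nome_simps Im_inverse_pos algebra_simps simp del: divide_minus_left)

lemma mform_mult:
  assumes "A \<in> mform w" "B \<in> mform w'"
  shows "A * B \<in> mform (w + w')"
proof -
  have "at_nome (A * B) (- 1 / \<tau>) = \<tau> powi (w + w') * at_nome (A * B) \<tau>" if \<tau>: "Im \<tau> > 0" for \<tau>
  proof -
    have "\<tau> \<noteq> 0" using \<tau> by auto
    then show ?thesis
      using assms \<tau> Im_inverse_pos[OF \<tau>]
      by (simp add: mform_def at_nome_simps power_int_add del: divide_minus_left)
  qed
  then show ?thesis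
    using assms by (simp add: mform_def disc_intros)
qed

lemma mform_power: "A \<in> mform w \<Longrightarrow> A ^ n \<in> mform (int n * w)"
proof (induction n)
  case (Suc n)
  then show ?case
    using mform_mult[of A w "A ^ n" "int n * w"] by (simp add: algebra_simps)
qed (simp add: mform_1)

text \<open>The Serre derivative of \<open>q\<^sup>m A\<close>, regarded as a form of weight \<open>w\<close>.\<close>

definition serre :: "int \<Rightarrow> complex \<Rightarrow> complex fps \<Rightarrow> complex fps" where
  "serre w m A = qderiv A + fps_const m * A - fps_const (of_int w / 12) * E2_fps * A"

lemma disc_serre: "A \<in> disc \<Longrightarrow> serre w m A \<in> disc"
  unfolding serre_def by (intro disc_intros disc_qderiv disc_E2)

lemma mform_serre:
  assumes A: "A \<in> mform w"
  shows "serre w 0 A \<in> mform (w + 2)"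
proof -
  note d = mform_disc[OF A]
  have "at_nome (serre w 0 A) (- 1 / \<tau>) = \<tau> powi (w + 2) * at_nome (serre w 0 A) \<tau>" if \<tau>: "Im \<tau> > 0" for \<tau>
  proof -
    have "at_nome (serre w 0 A) \<sigma> = at_nome (qderiv A) \<sigma> - of_int w / 12 * at_nome E2_fps \<sigma> * at_nome A \<sigma>"
      if "Im \<sigma> > 0" for \<sigma>
      using that d by (simp add: serre_def at_nome_simps disc_intros disc_qderiv disc_E2)
    then show ?thesis
      using serre_transform[of "at_nome A" "at_nome (qderiv A)" "at_nome A" "at_nome (qderiv A)" w \<tau>,
          OF at_nome_has_field_derivative[OF d] at_nome_has_field_derivative[OF d] mform_transform[OF A] \<tau>]
      by (simp only: \<tau> Im_inverse_pos)
  qed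
  then show ?thesis
    using d by (simp add: mform_def disc_serre)
qed

text \<open>Ramanujan's identities for the derivatives of E2 and E4, read as definitions of E4 and
  E6. Modularity and integrality then come from those of E2, without divisor sums of higher
  powers.\<close>

definition E4_fps :: "complex fps" where
  "E4_fps = E2_fps\<^sup>2 - 12 * qderiv E2_fps"

definition E6_fps :: "complex fps" where
  "E6_fps = - 3 * serre 4 0 E4_fps"

text \<open>The law of E2 is squared and differentiated; the factor 12 makes the inhomogeneous terms
  of the two results cancel.\<close>

lemma mform_E4: "E4_fps \<in> mform 4"
proof -
  have dE: "E4_fps \<in> disc"
    unfolding E4_fps_def by (intro disc_intros disc_qderiv disc_E2)
  have "at_nome E4_fps (- 1 / \<tau>) = \<tau> powi 4 * at_nome E4_fps \<tau>" if \<tau>: "Im \<tau> > 0" for \<tau>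
  proof -
    define P :: complex where "P = of_real pi * \<i>"
    have P: "P \<noteq> 0" by (simp add: P_def)
    have t0: "\<tau> \<noteq> 0" using \<tau> by auto
    define e where "e = at_nome E2_fps \<tau>"
    define e1 where "e1 = at_nome (qderiv E2_fps) \<tau>"
    have d1: "((\<lambda>\<tau>. at_nome E2_fps (- 1 / \<tau>)) has_field_derivative
        2 * P * at_nome (qderiv E2_fps) (- 1 / \<tau>) / \<tau>\<^sup>2) (at \<tau>)"
      using inverse_chain[of "at_nome E2_fps", OF at_nome_has_field_derivative[OF disc_E2] \<tau>]
      by (simp add: P_def mult_ac)
    have "((\<lambda>\<tau>. \<tau>\<^sup>2 * at_nome E2_fps \<tau> + 6 * \<tau> / P) has_field_derivative
       2 * \<tau> * e + \<tau>\<^sup>2 * (2 * P * e1) + 6 / P) (at \<tau>)"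
    proof -
      have "(at_nome E2_fps has_field_derivative 2 * P * e1) (at \<tau>)"
        using at_nome_has_field_derivative[OF disc_E2 \<tau>] by (simp add: P_def e1_def mult_ac)
      then show ?thesis
        using P unfolding e_def by (auto intro!: derivative_eq_intros simp: mult_ac)
    qed
    then have d2: "((\<lambda>\<tau>. at_nome E2_fps (- 1 / \<tau>)) has_field_derivative
       2 * \<tau> * e + \<tau>\<^sup>2 * (2 * P * e1) + 6 / P) (at \<tau>)"
      by (rule DERIV_cong_ev[THEN iffD1, OF refl _ refl, rotated])
         (use eventually_upper_half[OF \<tau>] at_nome_E2 in \<open>auto elim!: eventually_mono simp: P_def\<close>)
    have "2 * P * at_nome (qderiv E2_fps) (- 1 / \<tau>) / \<tau>\<^sup>2 = 2 * \<tau> * e + \<tau>\<^sup>2 * (2 * P * e1) + 6 / P"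
      by (rule DERIV_unique[OF d1 d2])
    then have q: "at_nome (qderiv E2_fps) (- 1 / \<tau>) = (2 * \<tau> * e + \<tau>\<^sup>2 * (2 * P * e1) + 6 / P) * \<tau>\<^sup>2 / (2 * P)"
      using P t0 by (simp add: field_simps)
    have "at_nome E4_fps (- 1 / \<tau>) = (\<tau>\<^sup>2 * e + 6 * \<tau> / P)\<^sup>2 - 12 * ((2 * \<tau> * e + \<tau>\<^sup>2 * (2 * P * e1) + 6 / P) * \<tau>\<^sup>2 / (2 * P))"
      unfolding E4_fps_def using Im_inverse_pos[OF \<tau>] \<tau>
      by (simp add: at_nome_simps disc_intros disc_qderiv disc_E2 q[unfolded divide_minus_left]
          at_nome_E2[OF \<tau>, unfolded divide_minus_left] P_def e_def)
    also have "\<dots> = \<tau> ^ 4 * (e\<^sup>2 - 12 * e1)"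
      using P by (simp add: field_simps power2_eq_square power4_eq_xxxx)
    also have "e\<^sup>2 - 12 * e1 = at_nome E4_fps \<tau>"
      unfolding E4_fps_def e_def e1_def using \<tau> by (simp add: at_nome_simps disc_intros disc_qderiv disc_E2)
    finally show ?thesis by simp
  qed
  then show ?thesis
    using dE by (simp add: mform_def)
qed

lemma mform_E6: "E6_fps \<in> mform 6"
proof -
  have "fps_const (- 3) * serre 4 0 E4_fps \<in> mform (4 + 2)"
    by (intro mform_cmult mform_serre mform_E4)
  moreover have "fps_const (- 3) * serre 4 0 E4_fps = E6_fps"
    by (simp add: E6_fps_def numeral_fps_const flip: fps_const_neg)
  ultimately show ?thesis by simp
qed

subsection \<open>Powers of the discriminant\<close>

text \<open>The logarithm of the product of all \<open>(1 - q\<^sup>n)\<^sup>2\<^sup>4\<close>.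
  Division by zero makes the constant term 0.\<close>

definition logdelta_fps :: "complex fps" where
  "logdelta_fps = Abs_fps (\<lambda>n. - 24 * of_nat (divisor_sum n) / of_nat n)"

lemma disc_logdelta: "logdelta_fps \<in> disc"
proof -
  have "fps_conv_radius logdelta_fps \<ge> 1"
    unfolding fps_conv_radius_def
  proof (rule conv_radius_geI_ex)
    fix r :: real assume r: "0 < r" "ereal r < 1"
    then have n: "norm (of_real r :: complex) < 1" by simp
    then have s: "summable (\<lambda>n. 24 * norm (fps_nth sigma_fps n * of_real r ^ n))"
      by (intro summable_mult norm_summable_fps disc_radius disc_sigma)
    have "summable (\<lambda>n. fps_nth logdelta_fps n * of_real r ^ n)"
    proof (rule summable_comparison_test[OF _ s], intro exI[of _ 0] allI impI)
      fix n
      have "real (divisor_sum n) / real n \<le> real (divisor_sum n)"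
      proof (cases "n = 0")
        case False
        then have "real (divisor_sum n) * 1 \<le> real (divisor_sum n) * real n"
          by (intro mult_left_mono) auto
        then show ?thesis using False by (simp add: divide_le_eq)
      qed simp
      then have "24 * (real (divisor_sum n) / real n) * r ^ n \<le> 24 * real (divisor_sum n) * r ^ n"
        using r by (intro mult_right_mono) auto
      then show "norm (fps_nth logdelta_fps n * of_real r ^ n) \<le> 24 * norm (fps_nth sigma_fps n * of_real r ^ n)"
        using r by (simp add: logdelta_fps_def sigma_fps_def norm_mult norm_power norm_divide mult_ac)
    qed
    then show "\<exists>z. norm z = r \<and> summable (\<lambda>n. fps_nth logdelta_fps n * z ^ n)"
      using r by (intro exI[of _ "of_real r"]) auto
  qed
  then show ?thesis by (simp add: disc_def)
qed

lemma qderiv_logdelta: "qderiv logdelta_fps = E2_fps - 1"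
proof (rule fps_ext)
  fix n show "fps_nth (qderiv logdelta_fps) n = fps_nth (E2_fps - 1) n"
    by (cases "n = 0") (simp_all add: qderiv_nth logdelta_fps_def E2_fps_def sigma_fps_def)
qed

text \<open>\<open>delta_power s\<close> is \<open>\<Prod>(1 - q\<^sup>n)\<^bsup>24 s\<^esup>\<close>, so that \<open>q\<^sup>s\<close> times it is the \<open>s\<close>-th power of the discriminant.\<close>

definition delta_power :: "complex \<Rightarrow> complex fps" where
  "delta_power s = (SOME A. A \<in> disc \<and> (\<forall>q. norm q < 1 \<longrightarrow> eval_fps A q = exp (s * eval_fps logdelta_fps q)))"

lemma disc_delta_power: "delta_power s \<in> disc"
  and eval_delta_power: "norm q < 1 \<Longrightarrow> eval_fps (delta_power s) q = exp (s * eval_fps logdelta_fps q)"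
proof -
  have "(\<lambda>q. exp (s * eval_fps logdelta_fps q)) holomorphic_on ball 0 1"
    by (intro holomorphic_intros disc_holomorphic disc_logdelta)
  then obtain A where "A \<in> disc" "\<And>q. norm q < 1 \<Longrightarrow> eval_fps A q = exp (s * eval_fps logdelta_fps q)"
    using disc_of_holomorphic by metis
  then have "\<exists>A. A \<in> disc \<and> (\<forall>q. norm q < 1 \<longrightarrow> eval_fps A q = exp (s * eval_fps logdelta_fps q))"
    by blast
  from someI_ex[OF this]
  show "delta_power s \<in> disc" "norm q < 1 \<Longrightarrow> eval_fps (delta_power s) q = exp (s * eval_fps logdelta_fps q)"
    unfolding delta_power_def by auto
qed

lemma delta_power_add: "delta_power s * delta_power t = delta_power (s + t)"
  by (rule disc_eqI) (simp_all add: disc_intros disc_delta_power disc_eval_mult eval_delta_power ring_distribs exp_add)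

lemma delta_power_0: "delta_power 0 = 1"
  by (rule disc_eqI) (simp_all add: disc_intros disc_delta_power eval_delta_power)

lemma delta_power_inverse: "delta_power s * delta_power (- s) = 1"
  by (simp add: delta_power_add delta_power_0)

lemma delta_power_nonzero: "delta_power s \<noteq> 0"
  using delta_power_inverse[of s] by auto

lemma delta_power_nth_0: "fps_nth (delta_power s) 0 = 1"
  using eval_delta_power[of 0 s] by (simp add: eval_fps_at_0 logdelta_fps_def)

lemma qderiv_delta_power: "qderiv (delta_power s) = fps_const s * (E2_fps - 1) * delta_power s"
proof (rule disc_eqI)
  fix q :: complex assume q: "norm q < 1"
  have d1: "(eval_fps (delta_power s) has_field_derivative eval_fps (fps_deriv (delta_power s)) q) (at q)"
    by (intro disc_has_field_derivative disc_delta_power q)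
  have "((\<lambda>q. exp (s * eval_fps logdelta_fps q)) has_field_derivative
      exp (s * eval_fps logdelta_fps q) * (s * eval_fps (fps_deriv logdelta_fps) q)) (at q)"
    using disc_has_field_derivative[OF disc_logdelta q] disc_radius[OF disc_logdelta q]
    by (auto intro!: derivative_eq_intros)
  moreover have "eventually (\<lambda>q::complex. q \<in> ball 0 1) (nhds q)"
    using q by (intro eventually_nhds_in_open) auto
  then have "eventually (\<lambda>q. eval_fps (delta_power s) q = exp (s * eval_fps logdelta_fps q)) (nhds q)"
    by eventually_elim (simp add: eval_delta_power)
  ultimately have d2: "(eval_fps (delta_power s) has_field_derivative
      exp (s * eval_fps logdelta_fps q) * (s * eval_fps (fps_deriv logdelta_fps) q)) (at q)"
    by (subst DERIV_cong_ev[OF refl _ refl])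
  have "eval_fps (qderiv (delta_power s)) q = exp (s * eval_fps logdelta_fps q) * (s * eval_fps (qderiv logdelta_fps) q)"
    unfolding qderiv_def using DERIV_unique[OF d1 d2] q
    by (simp add: disc_eval_mult disc_intros disc_delta_power disc_logdelta mult_ac)
  then show "eval_fps (qderiv (delta_power s)) q = eval_fps (fps_const s * (E2_fps - 1) * delta_power s) q"
    using q by (simp add: disc_eval disc_intros disc_delta_power disc_E2 eval_delta_power qderiv_logdelta mult_ac)
qed (intro disc_intros disc_qderiv disc_delta_power disc_E2)+

definition delta_fun :: "complex \<Rightarrow> complex \<Rightarrow> complex" where
  "delta_fun s \<tau> = exp (2 * of_real pi * \<i> * s * \<tau>) * at_nome (delta_power s) \<tau>"

lemma delta_fun_exp:
  "Im \<tau> > 0 \<Longrightarrow> delta_fun s \<tau> = exp (s * (2 * of_real pi * \<i> * \<tau> + at_nome logdelta_fps \<tau>))"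
  using eval_delta_power[OF norm_nome_less_1, of \<tau> s]
  by (simp add: delta_fun_def at_nome_def ring_distribs exp_add mult_ac)

lemma delta_fun_nonzero: "Im \<tau> > 0 \<Longrightarrow> delta_fun s \<tau> \<noteq> 0"
  by (simp add: delta_fun_exp)

text \<open>The logarithmic derivative of the power is s times E2, so by the law of E2 the quotient
  of the two sides without \<open>c\<close> has derivative zero on the convex upper half-plane. The
  multiplier \<open>c\<close> is left undetermined.\<close>

lemma delta_fun_transform:
  fixes l :: int
  assumes l: "12 * s = of_int l"
  obtains c where "c \<noteq> 0" "\<And>\<tau>. Im \<tau> > 0 \<Longrightarrow> delta_fun s (- 1 / \<tau>) = c * \<tau> powi l * delta_fun s \<tau>"
proof -
  define h where "h \<tau> = 2 * of_real pi * \<i> * \<tau> + at_nome logdelta_fps \<tau>" for \<tau>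
  define P :: complex where "P = of_real pi * \<i>"
  have P: "P \<noteq> 0" by (simp add: P_def)
  have h: "(h has_field_derivative 2 * P * at_nome E2_fps \<tau>) (at \<tau>)" if \<tau>: "Im \<tau> > 0" for \<tau>
  proof -
    have "(h has_field_derivative 2 * P + 2 * P * at_nome (qderiv logdelta_fps) \<tau>) (at \<tau>)"
      unfolding h_def P_def using at_nome_has_field_derivative[OF disc_logdelta \<tau>]
      by (auto intro!: derivative_eq_intros simp: mult_ac)
    then show ?thesis
      using \<tau> by (simp add: qderiv_logdelta at_nome_diff disc_E2 disc_intros algebra_simps)
  qed
  define f where "f \<tau> = exp (s * (h (- 1 / \<tau>) - h \<tau>)) * \<tau> powi (- l)" for \<tau>
  have "(f has_field_derivative 0) (at \<tau>)" if \<tau>: "Im \<tau> > 0" for \<tau>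
  proof -
    have t0: "\<tau> \<noteq> 0" using \<tau> by auto
    define Ex where "Ex = exp (s * (h (- 1 / \<tau>) - h \<tau>))"
    have "(f has_field_derivative Ex * (s * (2 * P * at_nome E2_fps (- 1 / \<tau>) / \<tau>\<^sup>2 - 2 * P * at_nome E2_fps \<tau>)) * \<tau> powi (- l) +
        Ex * (of_int (- l) * \<tau> powi (- l - 1))) (at \<tau>)"
      unfolding f_def Ex_def
      by (rule derivative_eq_intros inverse_chain[of h, OF h \<tau>] h[OF \<tau>] refl t0 | simp add: t0)+
    moreover have "s * (2 * P * at_nome E2_fps (- 1 / \<tau>) / \<tau>\<^sup>2 - 2 * P * at_nome E2_fps \<tau>) = of_int l / \<tau>"
      unfolding at_nome_E2[OF \<tau>] l[symmetric] P_def[symmetric]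
      using t0 P by (simp add: field_simps power2_eq_square)
    moreover have "\<tau> powi (- l - 1) = \<tau> powi (- l) / \<tau>"
      using t0 by (simp add: power_int_diff)
    ultimately show ?thesis by simp
  qed
  then have "\<exists>c. \<forall>\<tau>\<in>{\<tau>. Im \<tau> > 0}. f \<tau> = c"
    by (intro has_field_derivative_zero_constant convex_halfspace_Im_gt) (auto intro: has_field_derivative_at_within)
  then obtain c where c: "\<And>\<tau>. Im \<tau> > 0 \<Longrightarrow> f \<tau> = c" by auto
  show ?thesis
  proof
    have "f \<i> \<noteq> 0" by (simp add: f_def power_int_eq_0_iff)
    then show "c \<noteq> 0" using c[of \<i>] by simp
    fix \<tau> :: complex assume \<tau>: "Im \<tau> > 0"
    then have t0: "\<tau> \<noteq> 0" by auto
    have "exp (s * h (- 1 / \<tau>)) = exp (s * (h (- 1 / \<tau>) - h \<tau>)) * exp (s * h \<tau>)"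
      by (simp add: algebra_simps flip: exp_add)
    also have "exp (s * (h (- 1 / \<tau>) - h \<tau>)) = f \<tau> * \<tau> powi l"
      using t0 by (simp add: f_def power_int_minus)
    finally show "delta_fun s (- 1 / \<tau>) = c * \<tau> powi l * delta_fun s \<tau>"
      unfolding c[OF \<tau>] delta_fun_exp[OF \<tau>] delta_fun_exp[OF Im_inverse_pos[OF \<tau>]] h_def .
  qed
qed

definition delta_fps :: "complex fps" where
  "delta_fps = fps_X * delta_power 1"

lemma mform_delta: "delta_fps \<in> mform 12"
proof -
  obtain c where c: "\<And>\<tau>. Im \<tau> > 0 \<Longrightarrow> delta_fun 1 (- 1 / \<tau>) = c * \<tau> powi 12 * delta_fun 1 \<tau>"
    using delta_fun_transform[of 1 12] by auto
  have f: "delta_fun 1 \<tau> = at_nome delta_fps \<tau>" if "Im \<tau> > 0" for \<tau>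
    using that by (simp add: delta_fun_def delta_fps_def at_nome_simps disc_intros disc_delta_power nome_def)
  \<comment> \<open>\<i> is the fixed point of S and the form does not vanish there, so the
    multiplier can be read off at \<i>.\<close>
  have "\<i> ^ (2 * 6) = 1" unfolding power_mult power2_i by simp
  then have "\<i> powi 12 = 1" by simp
  then have "c = 1"
    using c[of \<i>] delta_fun_nonzero[of \<i> 1] by simp
  then show ?thesis
    using c f Im_inverse_pos by (simp add: mform_def delta_fps_def disc_intros disc_delta_power del: divide_minus_left)
qed

lemma delta_nonzero: "delta_fps \<noteq> 0"
  by (simp add: delta_fps_def delta_power_nonzero)

lemma eval_delta_nonzero: "q \<noteq> 0 \<Longrightarrow> norm q < 1 \<Longrightarrow> eval_fps delta_fps q \<noteq> 0"
  by (simp add: delta_fps_def disc_eval_mult disc_intros disc_delta_power eval_delta_power)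

lemma delta_nth_0 [simp]: "fps_nth delta_fps 0 = 0"
  and delta_nth_1: "fps_nth delta_fps (Suc 0) = 1"
  by (simp_all add: delta_fps_def delta_power_nth_0)

subsection \<open>Modular forms of level one\<close>

text \<open>If \<open>f\<close> were nonzero at a point, it would be so on a neighbourhood; the
  series \<open>P\<close> would vanish there and hence, by the identity theorem, everywhere.\<close>

lemma at_nome_cancel:
  assumes P: "P \<in> disc" "P \<noteq> 0"
    and f: "continuous_on {\<tau>. Im \<tau> > 0} f"
    and eq: "\<And>\<tau>. Im \<tau> > 0 \<Longrightarrow> at_nome P \<tau> * f \<tau> = 0"
    and \<tau>: "Im \<tau> > 0"
  shows "f \<tau> = 0"
proof (rule ccontr)
  assume nz: "f \<tau> \<noteq> 0"
  let ?U = "{\<tau>. Im \<tau> > 0} \<inter> (f -` (- {0}))"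
  have "open ?U"
    by (rule continuous_open_preimage[OF f open_upper_half]) (simp add: open_Compl)
  have hol: "at_nome P holomorphic_on {\<tau>. Im \<tau> > 0}"
    by (rule holomorphic_onI) (use at_nome_has_field_derivative[OF P(1)] field_differentiable_at_within
        in \<open>auto simp: field_differentiable_def intro: has_field_derivative_at_within\<close>)
  have "at_nome P \<sigma> = at_nome 0 \<sigma>" if "Im \<sigma> > 0" for \<sigma>
  proof -
    have "at_nome P \<sigma> = 0"
    proof (rule analytic_continuation_open[of ?U "{\<tau>. Im \<tau> > 0}" "at_nome P" "\<lambda>_. 0"])
      show "connected {\<tau>. Im \<tau> > 0}"
        by (intro convex_connected convex_halfspace_Im_gt)
      show "at_nome P z = 0" if "z \<in> ?U" for z
        using eq[of z] that by auto
    qed (use \<open>open ?U\<close> nz \<tau> that hol open_upper_half in auto)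
    then show ?thesis by simp
  qed
  then have "P = 0"
    by (intro at_nome_eqI P(1) disc_0)
  then show False using P(2) by simp
qed

lemma continuous_at_nome:
  assumes "A \<in> disc"
  shows "continuous_on {\<tau>. Im \<tau> > 0} (at_nome A)"
    and "continuous_on {\<tau>. Im \<tau> > 0} (\<lambda>\<tau>. at_nome A (- 1 / \<tau>))"
proof -
  show "continuous_on {\<tau>. Im \<tau> > 0} (at_nome A)"
    by (rule DERIV_continuous_on) (use at_nome_has_field_derivative[OF assms] in \<open>auto intro: has_field_derivative_at_within\<close>)
  show "continuous_on {\<tau>. Im \<tau> > 0} (\<lambda>\<tau>. at_nome A (- 1 / \<tau>))"
    by (rule DERIV_continuous_on[OF has_field_derivative_at_within[OF inverse_chain]])
       (use at_nome_has_field_derivative[OF assms] in auto)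
qed

lemma mform_divide:
  assumes A: "P * Q \<in> mform w" and P: "P \<in> mform v" "P \<noteq> 0" and Q: "Q \<in> disc"
  shows "Q \<in> mform (w - v)"
proof -
  have "at_nome Q (- 1 / \<tau>) - \<tau> powi (w - v) * at_nome Q \<tau> = 0" if \<tau>: "Im \<tau> > 0" for \<tau>
  proof (rule at_nome_cancel[OF mform_disc[OF P(1)] P(2) _ _ \<tau>])
    show "continuous_on {\<tau>. Im \<tau> > 0} (\<lambda>\<tau>. at_nome Q (- 1 / \<tau>) - \<tau> powi (w - v) * at_nome Q \<tau>)"
      by (intro continuous_intros continuous_at_nome Q) auto
    fix \<tau> assume \<tau>: "Im \<tau> > 0"
    have t0: "\<tau> \<noteq> 0" using \<tau> by auto
    have "\<tau> powi v * at_nome P \<tau> * at_nome Q (- 1 / \<tau>) = \<tau> powi w * (at_nome P \<tau> * at_nome Q \<tau>)"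
      using mform_transform[OF A \<tau>] mform_transform[OF P(1) \<tau>] mform_disc[OF P(1)] Q \<tau> Im_inverse_pos[OF \<tau>]
      by (simp add: at_nome_mult del: divide_minus_left)
    then show "at_nome P \<tau> * (at_nome Q (- 1 / \<tau>) - \<tau> powi (w - v) * at_nome Q \<tau>) = 0"
      using t0 by (simp add: power_int_diff field_simps del: divide_minus_left)
  qed
  then show ?thesis
    using Q by (simp add: mform_def)
qed

lemma nome_periodic: "nome (\<tau> + of_int n) = nome \<tau>"
proof -
  have "nome (\<tau> + of_int n) = nome \<tau> * exp (2 * of_int n * of_real pi * \<i>)"
    by (simp add: nome_def ring_distribs exp_add mult_ac)
  also have "exp (2 * of_int n * of_real pi * \<i>) = 1"
    by (auto simp: exp_eq_1)
  finally show ?thesis by simp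
qed

text \<open>After a translation to real part at most 1/2 in modulus, a point of imaginary part below
  1/2 has norm squared at most 1/2, so inversion at least doubles the imaginary part. The number
  \<open>n\<close> bounds the inversions; no fundamental domain is needed.\<close>

lemma mform_weight_0_reduce:
  assumes A: "A \<in> mform 0"
  shows "Im \<tau> \<ge> (1/2) ^ Suc n \<Longrightarrow> \<exists>\<sigma>. Im \<sigma> \<ge> 1/2 \<and> at_nome A \<sigma> = at_nome A \<tau>"
proof (induction n arbitrary: \<tau>)
  case 0
  then show ?case by auto
next
  case (Suc n)
  define \<tau>' where "\<tau>' = \<tau> + of_int (- round (Re \<tau>))"
  have same: "at_nome A \<tau>' = at_nome A \<tau>"
    unfolding \<tau>'_def at_nome_def nome_periodic ..
  have Im: "Im \<tau>' = Im \<tau>" by (simp add: \<tau>'_def)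
  have pos: "Im \<tau>' > 0"
    using Suc.prems unfolding Im by (intro less_le_trans[OF _ Suc.prems]) simp
  show ?case
  proof (cases "Im \<tau> \<ge> 1/2")
    case False
    have "\<bar>Re \<tau>'\<bar> \<le> 1/2"
      using of_int_round_abs_le[of "Re \<tau>"] by (simp add: \<tau>'_def abs_minus_commute)
    then have "(Re \<tau>')\<^sup>2 \<le> (1/2)\<^sup>2"
      by (simp add: abs_le_square_iff flip: abs_le_square_iff)
    moreover have "(Im \<tau>')\<^sup>2 \<le> (1/2)\<^sup>2"
      using False pos unfolding Im by (intro power_mono) auto
    ultimately have nrm: "(Re \<tau>')\<^sup>2 + (Im \<tau>')\<^sup>2 \<le> 1/2"
      by (simp add: power2_eq_square)
    have "Im (- 1 / \<tau>') = Im \<tau>' / ((Re \<tau>')\<^sup>2 + (Im \<tau>')\<^sup>2)"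
      by (simp add: Im_divide)
    moreover have "Im \<tau>' / ((Re \<tau>')\<^sup>2 + (Im \<tau>')\<^sup>2) \<ge> Im \<tau>' / (1/2)"
      using nrm pos by (intro divide_left_mono) (auto intro!: add_nonneg_pos mult_pos_pos)
    ultimately have "Im (- 1 / \<tau>') \<ge> 2 * Im \<tau>"
      using Im by simp
    moreover have "2 * Im \<tau> \<ge> (1/2) ^ Suc n"
      using Suc.prems by simp
    ultimately obtain \<sigma> where "Im \<sigma> \<ge> 1/2" "at_nome A \<sigma> = at_nome A (- 1 / \<tau>')"
      using Suc.IH[of "- 1 / \<tau>'"] by (metis order_trans)
    moreover have "at_nome A (- 1 / \<tau>') = at_nome A \<tau>'"
      using mform_transform[OF A pos] by simp
    ultimately show ?thesis using same by auto
  qed auto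
qed

text \<open>The points of imaginary part at least 1/2 have nome in the compact disc of radius
  exp(-\<pi>), so the modulus attains its maximum over the whole open disc there, and the maximum
  principle applies.\<close>

lemma mform_weight_0:
  assumes A: "A \<in> mform 0"
  shows "A = fps_const (fps_nth A 0)"
proof -
  have dA: "A \<in> disc" by (rule mform_disc[OF A])
  let ?K = "cball (0::complex) (exp (- pi))"
  have K: "?K \<subseteq> ball 0 1"
  proof
    fix q :: complex assume "q \<in> ?K"
    moreover have "exp (- pi) < 1" by simp
    ultimately show "q \<in> ball 0 1" by (simp del: exp_less_one_iff)
  qed
  have "continuous_on ?K (\<lambda>q. norm (eval_fps A q))"
    by (intro continuous_intros holomorphic_on_imp_continuous_on holomorphic_on_subset[OF disc_holomorphic[OF dA] K])
  then obtain q1 where q1: "q1 \<in> ?K" "\<And>q. q \<in> ?K \<Longrightarrow> norm (eval_fps A q) \<le> norm (eval_fps A q1)"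
    using continuous_attains_sup[of ?K "\<lambda>q. norm (eval_fps A q)"] by auto
  have "norm (eval_fps A q) \<le> norm (eval_fps A q1)" if q: "norm q < 1" for q
  proof (cases "q = 0")
    case False
    then obtain \<tau> where \<tau>: "Im \<tau> > 0" "nome \<tau> = q"
      using nome_surj q by metis
    obtain n where "(1/2) ^ n < Im \<tau>"
      using real_arch_pow_inv[OF \<tau>(1), of "1/2"] by auto
    moreover have "(1/2::real) ^ Suc n \<le> (1/2) ^ n" by simp
    ultimately obtain \<sigma> where \<sigma>: "Im \<sigma> \<ge> 1/2" "at_nome A \<sigma> = at_nome A \<tau>"
      using mform_weight_0_reduce[OF A, of n \<tau>] by fastforce
    then have "nome \<sigma> \<in> ?K"
      by (simp add: norm_nome)
    then show ?thesis
      using q1(2) \<sigma>(2) \<tau>(2) unfolding at_nome_def by metis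
  qed (use q1 in auto)
  then have "eval_fps A constant_on ball 0 1"
    by (intro maximum_modulus_principle[of "eval_fps A" "ball 0 1" "ball 0 1" q1])
       (use disc_holomorphic[OF dA] q1(1) K in auto)
  then obtain c where c: "\<And>q. norm q < 1 \<Longrightarrow> eval_fps A q = c"
    unfolding constant_on_def by auto
  have "A = fps_const c"
    by (rule disc_eqI) (use c dA in \<open>auto simp: disc_intros\<close>)
  then show ?thesis by simp
qed

text \<open>A suitable power of the discriminant brings \<open>A ^ 12\<close> to weight 0, where it
  is constant; the discriminant vanishes at the cusp, so the constant is 0.\<close>

lemma mform_negative:
  assumes A: "A \<in> mform w" and w: "w < 0"
  shows "A = 0"
proof -
  define n where "n = nat (- w)"
  have n: "int n = - w" "n > 0" using w by (auto simp: n_def)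
  have "A ^ 12 * delta_fps ^ n \<in> mform (int 12 * w + int n * 12)"
    by (intro mform_mult mform_power A mform_delta)
  then have "A ^ 12 * delta_fps ^ n \<in> mform 0"
    by (simp add: n)
  then have "A ^ 12 * delta_fps ^ n = fps_const (fps_nth (A ^ 12 * delta_fps ^ n) 0)"
    by (rule mform_weight_0)
  also have "fps_nth (A ^ 12 * delta_fps ^ n) 0 = 0"
    using n(2) by (simp add: fps_power_zeroth)
  finally show ?thesis
    using delta_nonzero by simp
qed

text \<open>S applied twice and ST applied three times fix every \<tau>. Iterating the law gives
  \<open>C\<^sup>2 * (- 1) powi w = 1\<close> and \<open>C ^ 3 * (- 1) powi w = 1\<close>, which
  leaves only C = 1 and even weight.\<close>

lemma multiplier_trivial:
  assumes g: "g \<in> disc" "g \<noteq> 0"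
    and tr: "\<And>\<tau>. Im \<tau> > 0 \<Longrightarrow> at_nome g (- 1 / \<tau>) = C * \<tau> powi w * at_nome g \<tau>"
  shows "C = 1" "even w"
proof -
  obtain \<tau> where \<tau>: "Im \<tau> > 0" "at_nome g \<tau> \<noteq> 0"
    using at_nome_eqI[OF g(1) disc_0] g(2) by auto
  have t0: "\<tau> \<noteq> 0" using \<tau> by auto
  have t1: "\<tau> + 1 \<noteq> 0"
  proof
    assume "\<tau> + 1 = 0"
    then have "Im (\<tau> + 1) = 0" by simp
    then show False using \<tau> by simp
  qed
  have "at_nome g \<tau> = at_nome g (- 1 / (- 1 / \<tau>))" using t0 by simp
  also have "\<dots> = C * (- 1 / \<tau>) powi w * (C * \<tau> powi w * at_nome g \<tau>)"
    by (simp only: tr \<tau>(1) Im_inverse_pos)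
  finally have "1 = C\<^sup>2 * ((- 1 / \<tau>) powi w * \<tau> powi w)"
    using \<tau>(2) by (simp add: power2_eq_square mult_ac)
  also have "(- 1 / \<tau>) powi w * \<tau> powi w = (- 1) powi w"
    using t0 by (simp flip: power_int_mult_distrib)
  finally have C2: "C\<^sup>2 * (- 1) powi w = 1" by simp
  have T: "at_nome g (\<sigma> + 1) = at_nome g \<sigma>" for \<sigma>
    using nome_periodic[of \<sigma> 1] by (simp add: at_nome_def)
  define U where "U \<sigma> = - 1 / (\<sigma> + 1)" for \<sigma> :: complex
  have U: "Im (U \<sigma>) > 0" "at_nome g (U \<sigma>) = C * (\<sigma> + 1) powi w * at_nome g \<sigma>" if "Im \<sigma> > 0" for \<sigma>
    using tr[of "\<sigma> + 1"] T[of \<sigma>] Im_inverse_pos[of "\<sigma> + 1"] that by (simp_all add: U_def)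
  have e1: "U \<tau> + 1 = \<tau> / (\<tau> + 1)" using t1 by (simp add: U_def field_simps)
  then have e2: "U (U \<tau>) = - (\<tau> + 1) / \<tau>" by (simp add: U_def)
  then have e3: "U (U \<tau>) + 1 = - 1 / \<tau>" using t0 by (simp add: field_simps)
  then have e4: "U (U (U \<tau>)) = \<tau>" using t0 by (simp add: U_def)
  have "at_nome g (U (U (U \<tau>))) = C * (- 1 / \<tau>) powi w * (C * (\<tau> / (\<tau> + 1)) powi w * (C * (\<tau> + 1) powi w * at_nome g \<tau>))"
    by (simp only: U \<tau>(1) e1[symmetric] e3[symmetric])
  then have "1 = C ^ 3 * ((- 1 / \<tau>) powi w * (\<tau> / (\<tau> + 1)) powi w * (\<tau> + 1) powi w)"
    using \<tau>(2) unfolding e4 by (simp add: power3_eq_cube mult_ac)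
  also have "(- 1 / \<tau>) powi w * (\<tau> / (\<tau> + 1)) powi w * (\<tau> + 1) powi w = (- 1) powi w"
    using t0 t1 by (simp flip: power_int_mult_distrib)
  finally have C3: "C ^ 3 * (- 1) powi w = 1" by simp
  have "C * (C\<^sup>2 * (- 1) powi w) = 1"
    using C3 by (simp add: power3_eq_cube power2_eq_square mult_ac)
  then show C: "C = 1" using C2 by simp
  show "even w"
    using C2 unfolding C by (auto simp: power_int_minus_left split: if_splits)
qed

lemma mform_odd:
  assumes A: "A \<in> mform w" and w: "odd w"
  shows "A = 0"
  using multiplier_trivial(2)[of A 1 w] mform_disc[OF A] mform_transform[OF A] w by auto

text \<open>The discriminant is \<open>fps_X\<close> times a unit with inverse
  \<open>delta_power (- 1)\<close>, so a missing constant term is all that division by it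
  requires.\<close>

lemma mform_cusp:
  assumes A: "A \<in> mform w" "fps_nth A 0 = 0"
  obtains B where "B \<in> mform (w - 12)" "A = delta_fps * B"
proof -
  have "fps_X * fps_shift 1 A = A"
    using A(2) by (simp add: fps_eq_iff)
  have "fps_shift 1 A \<in> disc"
    using mform_disc[OF A(1)] by (simp add: disc_def)
  define B where "B = fps_shift 1 A * delta_power (- 1)"
  have "delta_fps * B = fps_X * fps_shift 1 A * (delta_power 1 * delta_power (- 1))"
    by (simp add: delta_fps_def B_def mult_ac)
  then have eq: "delta_fps * B = A"
    by (simp only: delta_power_inverse \<open>fps_X * fps_shift 1 A = A\<close> mult_1_right)
  have "B \<in> mform (w - 12)"
  proof (rule mform_divide[OF _ mform_delta delta_nonzero])
    show "B \<in> disc"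
      unfolding B_def by (intro disc_intros disc_delta_power \<open>fps_shift 1 A \<in> disc\<close>)
  qed (use eq A in auto)
  then show ?thesis using that eq by auto
qed

lemma mform_reduce:
  assumes A: "A \<in> mform w" and e: "e \<in> mform w" "fps_nth e 0 \<noteq> 0"
  obtains B where "B \<in> mform (w - 12)" "A = fps_const (fps_nth A 0 / fps_nth e 0) * e + delta_fps * B"
proof -
  have "A - fps_const (fps_nth A 0 / fps_nth e 0) * e \<in> mform w"
    by (intro mform_diff mform_cmult A e)
  then obtain B where B: "B \<in> mform (w - 12)" "A - fps_const (fps_nth A 0 / fps_nth e 0) * e = delta_fps * B"
    by (rule mform_cusp) (use e(2) in simp)
  show ?thesis
    by (rule that[OF B(1)]) (simp flip: B(2))
qed

subsection \<open>Eisenstein series of weights four and six\<close>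

lemma divisor_sum_1: "divisor_sum (Suc 0) = 1"
  by (simp add: divisor_sum_def)

lemma E2_nth_0: "fps_nth E2_fps 0 = 1"
  and E2_nth_1: "fps_nth E2_fps (Suc 0) = - 24"
  by (simp_all add: E2_fps_def sigma_fps_def divisor_sum_1 fps_mult_nth_1[simplified])

lemma E4_nth_0: "fps_nth E4_fps 0 = 1"
  and E4_nth_1: "fps_nth E4_fps (Suc 0) = 240"
  by (simp_all add: E4_fps_def qderiv_nth E2_nth_0 E2_nth_1 power2_eq_square fps_mult_nth_1[simplified])

lemma E6_nth_0: "fps_nth E6_fps 0 = 1"
  and E6_nth_1: "fps_nth E6_fps (Suc 0) = - 504"
  by (simp_all add: E6_fps_def serre_def qderiv_nth E2_nth_0 E2_nth_1 E4_nth_0 E4_nth_1 fps_mult_nth_1[simplified] numeral_fps_const)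

lemma mform_reduce_zero:
  assumes A: "A \<in> mform w" and e: "e \<in> mform w" "fps_nth e 0 = 1"
    and z: "\<And>B. B \<in> mform (w - 12) \<Longrightarrow> B = 0"
  shows "A = fps_const (fps_nth A 0) * e"
proof -
  obtain B where "B \<in> mform (w - 12)" "A = fps_const (fps_nth A 0 / fps_nth e 0) * e + delta_fps * B"
    using mform_reduce[OF A e(1)] e(2) by auto
  then show ?thesis using z[of B] e(2) by simp
qed

lemma mform_E4_cubed_minus_E6_squared: "E4_fps ^ 3 - E6_fps\<^sup>2 \<in> mform 12"
  using mform_diff[OF mform_power[OF mform_E4, of 3, simplified] mform_power[OF mform_E6, of 2, simplified]] .

lemma E4_E6_nth_0: "fps_nth (E4_fps ^ 3 - E6_fps\<^sup>2) 0 = 0"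
  by (simp add: E4_nth_0 E6_nth_0 fps_power_zeroth)

lemma E4_E6_nth_1: "fps_nth (E4_fps ^ 3 - E6_fps\<^sup>2) (Suc 0) = 1728"
  by (simp add: E4_nth_0 E6_nth_0 E4_nth_1 E6_nth_1 power3_eq_cube power2_eq_square fps_mult_nth_1[simplified])

text \<open>The quotient by the discriminant has weight 0 and is constant; the coefficient of q
  determines it: 3 * 240 + 2 * 504 = 1728.\<close>

lemma delta_eq: "E4_fps ^ 3 - E6_fps\<^sup>2 = fps_const 1728 * delta_fps"
proof -
  obtain B where B: "B \<in> mform (12 - 12)" "E4_fps ^ 3 - E6_fps\<^sup>2 = delta_fps * B"
    by (rule mform_cusp[OF mform_E4_cubed_minus_E6_squared E4_E6_nth_0])
  then have c: "B = fps_const (fps_nth B 0)"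
    using mform_weight_0 by simp
  have "fps_nth (delta_fps * B) (Suc 0) = fps_nth B 0"
    by (simp add: fps_mult_nth_1[simplified] delta_nth_1)
  then have "fps_nth B 0 = 1728"
    using E4_E6_nth_1 B(2) by (simp add: delta_nth_1)
  then show ?thesis using B(2) c by (simp add: mult.commute)
qed

text \<open>The square and the cube are multiples of E4 and E6, and the sixth power computed in both
  ways would make E4^3 and E6^2 equal unless the constant term is 0. Then the discriminant divides,
  with a quotient of weight -10.\<close>

lemma mform_2:
  assumes A: "A \<in> mform 2"
  shows "A = 0"
proof -
  define c where "c = fps_nth A 0"
  have "A ^ 2 = fps_const (fps_nth (A ^ 2) 0) * E4_fps"
    by (rule mform_reduce_zero[of _ 4]) (use mform_power[OF A, of 2] mform_E4 E4_nth_0 in \<open>auto intro: mform_negative\<close>)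
  then have A2: "A ^ 2 = fps_const (c ^ 2) * E4_fps"
    by (simp add: fps_power_zeroth c_def)
  have "A ^ 3 = fps_const (fps_nth (A ^ 3) 0) * E6_fps"
    by (rule mform_reduce_zero[of _ 6]) (use mform_power[OF A, of 3] mform_E6 E6_nth_0 in \<open>auto intro: mform_negative\<close>)
  then have A3: "A ^ 3 = fps_const (c ^ 3) * E6_fps"
    by (simp add: fps_power_zeroth c_def)
  have "(A ^ 2) ^ 3 = (A ^ 3) ^ 2"
    by (simp flip: power_mult)
  then have "fps_const (c ^ 6) * (E4_fps ^ 3 - E6_fps\<^sup>2) = 0"
    unfolding A2 A3 by (simp add: power_mult_distrib fps_const_power algebra_simps flip: power_mult)
  then have "c = 0"
    using delta_eq delta_nonzero by auto
  then obtain B where "B \<in> mform (2 - 12)" "A = delta_fps * B"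
    using mform_cusp[OF A] c_def by metis
  then show ?thesis
    using mform_negative[of B] by simp
qed

text \<open>Subtracting the multiple of \<open>e\<close> with the same constant term leaves the
  discriminant times a form of negative weight or of weight 2.\<close>

lemma mform_small:
  assumes A: "A \<in> mform w" and e: "e \<in> mform w" "fps_nth e 0 = 1" and w: "w < 12 \<or> w = 14"
  shows "A = fps_const (fps_nth A 0) * e"
  by (rule mform_reduce_zero[OF A e]) (use w mform_negative mform_2 in auto)

lemma mform_monomial:
  assumes "4 * int a + 6 * int b = w"
  shows "E4_fps ^ a * E6_fps ^ b \<in> mform w" "fps_nth (E4_fps ^ a * E6_fps ^ b) 0 = 1"
  using mform_mult[OF mform_power[OF mform_E4, of a] mform_power[OF mform_E6, of b]] assms
  by (simp_all add: mult.commute E4_nth_0 E6_nth_0 fps_power_zeroth)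

lemma weight_decomposition:
  fixes w :: int
  assumes "even w" "w \<ge> 0" "w \<noteq> 2"
  obtains a b :: nat where "4 * int a + 6 * int b = w"
proof (cases "4 dvd w")
  case True
  then obtain a where "w = 4 * a" by auto
  then show ?thesis using that[of "nat a" 0] assms by auto
next
  case False
  define c where "c = w div 4"
  have c: "w = 4 * c + 2" using False assms(1) unfolding c_def by presburger
  then show ?thesis using that[of "nat (c - 1)" 1] assms by auto
qed

lemma serre_E4: "serre 4 0 E4_fps = fps_const (- 1 / 3) * E6_fps"
proof -
  have "fps_const (- 1 / 3) * (- 3 * serre 4 0 E4_fps) = fps_const (- 1 / 3 * - 3) * serre 4 0 E4_fps"
    by (simp add: numeral_fps_const mult.assoc flip: fps_const_mult fps_const_neg)
  then show ?thesis
    by (simp add: E6_fps_def)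
qed

lemma serre_E6: "serre 6 0 E6_fps = fps_const (- 1 / 2) * E4_fps\<^sup>2"
proof -
  have "serre 6 0 E6_fps \<in> mform 8"
    using mform_serre[OF mform_E6] by simp
  moreover have "E4_fps\<^sup>2 \<in> mform 8"
    using mform_power[OF mform_E4, of 2] by simp
  ultimately have "serre 6 0 E6_fps = fps_const (fps_nth (serre 6 0 E6_fps) 0) * E4_fps\<^sup>2"
    by (intro mform_small) (auto simp: E4_nth_0 fps_power_zeroth)
  moreover have "fps_nth (serre 6 0 E6_fps) 0 = - 1 / 2"
    by (simp add: serre_def qderiv_nth E6_nth_0 E2_nth_0)
  ultimately show ?thesis by simp
qed

lemma serre_mult: "serre (v + w) (m + n) (A * B) = serre v m A * B + A * serre w n B"
  by (simp add: serre_def qderiv_mult algebra_simps add_divide_distrib flip: fps_const_add)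

lemma serre_add: "serre w m (A + B) = serre w m A + serre w m B"
  and serre_diff: "serre w m (A - B) = serre w m A - serre w m B"
  and serre_cmult: "serre w m (fps_const c * A) = fps_const c * serre w m A"
  and serre_0 [simp]: "serre w m 0 = 0"
  by (simp_all add: serre_def qderiv_mult qderiv_add qderiv_diff algebra_simps)

lemma serre_power: "serre (int n * w) 0 (A ^ n) = of_nat n * A ^ (n - 1) * serre w 0 A"
proof (induction n)
  case 0
  then show ?case by (simp add: serre_def)
next
  case (Suc n)
  have "serre (int (Suc n) * w) 0 (A ^ Suc n) = serre (w + int n * w) (0 + 0) (A * A ^ n)"
    by (simp add: algebra_simps)
  also have "\<dots> = serre w 0 A * A ^ n + A * (of_nat n * A ^ (n - 1) * serre w 0 A)"
    by (simp only: serre_mult Suc.IH)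
  also have "A * (of_nat n * A ^ (n - 1) * serre w 0 A) = of_nat n * A ^ n * serre w 0 A"
    by (cases n) (simp_all add: algebra_simps)
  finally show ?case by (simp add: algebra_simps)
qed

lemma E4_E6_no_common_zero:
  assumes "norm q < 1" "eval_fps E4_fps q = 0"
  shows "eval_fps E6_fps q \<noteq> 0"
proof
  assume z: "eval_fps E6_fps q = 0"
  have q0: "q \<noteq> 0"
    using assms(2) by (auto simp: eval_fps_at_0 E4_nth_0)
  have "eval_fps (E4_fps ^ 3 - E6_fps\<^sup>2) q = 0"
    using assms z mform_disc[OF mform_E4] mform_disc[OF mform_E6] by (simp add: disc_eval disc_intros)
  then show False
    using eval_delta_nonzero[OF q0 assms(1)] assms(1) mform_disc[OF mform_delta]
    by (simp add: delta_eq disc_eval disc_intros)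
qed

subsection \<open>Forms with a single orbit of zeros\<close>

text \<open>A substitute for the valence formula: vanishing at a single zero of \<open>P\<close>
  already implies divisibility by \<open>P\<close>, as if all its zeros were simple and formed one
  orbit.\<close>

definition divides_at_zeros :: "int \<Rightarrow> complex fps \<Rightarrow> bool" where
  "divides_at_zeros v P \<longleftrightarrow> (\<forall>w A q. A \<in> mform w \<longrightarrow> norm q < 1 \<longrightarrow> eval_fps P q = 0 \<longrightarrow>
     eval_fps A q = 0 \<longrightarrow> (\<exists>B \<in> mform (w - v). A = P * B))"

text \<open>Subtracting a multiple of \<open>P * e\<close> removes the constant term; the quotient
  by the discriminant vanishes at \<open>q\<close> again and has smaller weight. A suitable
  \<open>e\<close> of weight w - v exists unless w < v or w - v = 2, and exactly these weights are
  left to \<open>base\<close>.\<close>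

lemma divides_at_zerosI:
  assumes P: "P \<in> mform v" "fps_nth P 0 \<noteq> 0" and v: "v > 0" "even v"
    and base: "\<And>w A q. A \<in> mform w \<Longrightarrow> even w \<Longrightarrow> w \<ge> 0 \<Longrightarrow> w < v \<or> w = v + 2 \<Longrightarrow> norm q < 1 \<Longrightarrow> eval_fps P q = 0 \<Longrightarrow>
       eval_fps A q = 0 \<Longrightarrow> A = 0"
  shows "divides_at_zeros v P"
proof -
  have "\<exists>B \<in> mform (w - v). A = P * B"
    if "A \<in> mform w" "norm q < 1" "eval_fps P q = 0" "eval_fps A q = 0" for w A q
    using that
  proof (induction "nat w" arbitrary: w A rule: less_induct)
    case (less w A)
    consider "odd w \<or> w < 0" | "even w" "w \<ge> 0" "w < v \<or> w = v + 2" | "even w" "w \<ge> v" "w \<noteq> v + 2"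
      by linarith
    then show ?case
    proof cases
      case 1
      then have "A = 0" using mform_odd mform_negative less.prems(1) by blast
      then show ?thesis using mform_0 by auto
    next
      case 2
      then have "A = 0" using base[of A w q] less.prems by auto
      then show ?thesis using mform_0 by auto
    next
      case 3
      then obtain a b where "4 * int a + 6 * int b = w - v"
        using weight_decomposition[of "w - v"] v(2) by auto
      from mform_monomial[OF this] obtain e where e: "e \<in> mform (w - v)" "fps_nth e 0 = 1"
        by blast
      have Pe: "P * e \<in> mform w"
        using mform_mult[OF P(1) e(1)] by simp
      have "fps_nth (P * e) 0 \<noteq> 0"
        using P(2) e(2) by simp
      then obtain c B where B: "B \<in> mform (w - 12)" "A = fps_const c * (P * e) + delta_fps * B"
        using mform_reduce[OF less.prems(1) Pe] by metis
      have q0: "q \<noteq> 0"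
        using less.prems(3) P(2) by (auto simp: eval_fps_at_0)
      have "eval_fps A q = c * (eval_fps P q * eval_fps e q) + eval_fps delta_fps q * eval_fps B q"
        unfolding B(2) using less.prems(2) mform_disc[OF P(1)] mform_disc[OF e(1)] mform_disc[OF B(1)]
            mform_disc[OF mform_delta] by (simp add: disc_eval disc_intros)
      then have Bq: "eval_fps B q = 0"
        using less.prems eval_delta_nonzero[OF q0 less.prems(2)] by simp
      have "w > 0" using 3 v by simp
      then obtain C where C: "C \<in> mform (w - 12 - v)" "B = P * C"
        using less.hyps[OF _ B(1) less.prems(2,3) Bq] by auto
      have "A = P * (fps_const c * e + delta_fps * C)"
        unfolding B(2) C(2) by (simp add: algebra_simps)
      moreover have "delta_fps * C \<in> mform (w - v)"
        using mform_mult[OF mform_delta C(1)] by (simp add: algebra_simps)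
      then have "fps_const c * e + delta_fps * C \<in> mform (w - v)"
        by (intro mform_add mform_cmult e)
      ultimately show ?thesis by blast
    qed
  qed
  then show ?thesis unfolding divides_at_zeros_def by blast
qed

text \<open>In these weights the space is spanned by one monomial, and a nonzero value of the
  monomial at \<open>q\<close> forces the scalar factor to vanish.\<close>

lemma eval_small:
  assumes A: "A \<in> mform w" and w: "4 * int a + 6 * int b = w" "w < 12 \<or> w = 14"
    and q: "norm q < 1" "eval_fps A q = 0"
    and nz: "a \<noteq> 0 \<Longrightarrow> eval_fps E4_fps q \<noteq> 0" "b \<noteq> 0 \<Longrightarrow> eval_fps E6_fps q \<noteq> 0"
  shows "A = 0"
proof -
  have eq: "A = fps_const (fps_nth A 0) * (E4_fps ^ a * E6_fps ^ b)"
    by (rule mform_small[OF A mform_monomial[OF w(1)] w(2)])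
  have "eval_fps (fps_const k * (E4_fps ^ a * E6_fps ^ b)) q = k * (eval_fps E4_fps q ^ a * eval_fps E6_fps q ^ b)" for k
    using q mform_disc[OF mform_E4] mform_disc[OF mform_E6] by (simp add: disc_eval disc_intros)
  from this[of "fps_nth A 0"] have "eval_fps A q = fps_nth A 0 * (eval_fps E4_fps q ^ a * eval_fps E6_fps q ^ b)"
    unfolding eq[symmetric] .
  moreover have "eval_fps E4_fps q ^ a * eval_fps E6_fps q ^ b \<noteq> 0"
    using nz by auto
  ultimately have "fps_nth A 0 = 0" using q(2) by auto
  then show ?thesis using eq by simp
qed

lemma divides_at_zeros_E4: "divides_at_zeros 4 E4_fps"
proof (rule divides_at_zerosI[OF mform_E4])
  fix w A and q :: complex
  assume A: "A \<in> mform w" and w: "even w" "w \<ge> 0" "w < 4 \<or> w = 4 + 2"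
    and q: "norm q < 1" "eval_fps E4_fps q = 0" "eval_fps A q = 0"
  from w have "w = 0 \<or> w = 2 \<or> w = 6" by presburger
  then show "A = 0"
    using eval_small[OF A _ _ q(1,3), of 0 0] eval_small[OF A _ _ q(1,3), of 0 1] mform_2 A
      E4_E6_no_common_zero[OF q(1,2)] by fastforce
qed (auto simp: E4_nth_0)

lemma divides_at_zeros_E6: "divides_at_zeros 6 E6_fps"
proof (rule divides_at_zerosI[OF mform_E6])
  fix w A and q :: complex
  assume A: "A \<in> mform w" and w: "even w" "w \<ge> 0" "w < 6 \<or> w = 6 + 2"
    and q: "norm q < 1" "eval_fps E6_fps q = 0" "eval_fps A q = 0"
  have e4: "eval_fps E4_fps q \<noteq> 0"
    using E4_E6_no_common_zero[OF q(1)] q(2) by blast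
  from w have "w = 0 \<or> w = 2 \<or> w = 4 \<or> w = 8" by presburger
  then show "A = 0"
    using eval_small[OF A _ _ q(1,3), of 0 0] eval_small[OF A _ _ q(1,3), of 1 0]
      eval_small[OF A _ _ q(1,3), of 2 0] mform_2 A e4 by fastforce
qed (auto simp: E6_nth_0)

text \<open>Every orbit of zeros on which neither E4 nor E6 vanishes belongs to one member of this
  pencil. The excluded c = 0 and c = 1 are the cube of E4 and a multiple of the discriminant. The
  derivative formula shows that the zeros are simple.\<close>

lemma generic_form:
  fixes c :: complex
  defines "P \<equiv> E4_fps ^ 3 - fps_const c * E6_fps\<^sup>2"
  assumes c: "c \<noteq> 0" "c \<noteq> 1"
  shows "P \<in> mform 12" "fps_nth P 0 \<noteq> 0"
    "norm q < 1 \<Longrightarrow> eval_fps P q = eval_fps E4_fps q ^ 3 - c * (eval_fps E6_fps q)\<^sup>2"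
    "norm q < 1 \<Longrightarrow> eval_fps P q = 0 \<Longrightarrow> eval_fps E4_fps q \<noteq> 0 \<and> eval_fps E6_fps q \<noteq> 0"
    "divides_at_zeros 12 P"
    "serre 12 0 P = fps_const (c - 1) * (E4_fps\<^sup>2 * E6_fps)"
proof -
  show P: "P \<in> mform 12"
    unfolding P_def using mform_power[OF mform_E4, of 3] mform_power[OF mform_E6, of 2]
    by (intro mform_diff mform_cmult) simp_all
  show nth0: "fps_nth P 0 \<noteq> 0"
    using c by (simp add: P_def fps_power_zeroth E4_nth_0 E6_nth_0)
  show ev: "eval_fps P q = eval_fps E4_fps q ^ 3 - c * (eval_fps E6_fps q)\<^sup>2" if "norm q < 1" for q
    using that mform_disc[OF mform_E4] mform_disc[OF mform_E6] by (simp add: P_def disc_eval disc_intros)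
  show nz: "eval_fps E4_fps q \<noteq> 0 \<and> eval_fps E6_fps q \<noteq> 0" if "norm q < 1" "eval_fps P q = 0" for q
    using ev[OF that(1)] that(2) c(1) E4_E6_no_common_zero[OF that(1)] by auto
  show "divides_at_zeros 12 P"
  proof (rule divides_at_zerosI[OF P nth0])
    fix w A and q :: complex
    assume A: "A \<in> mform w" and w: "even w" "w \<ge> 0" "w < 12 \<or> w = 12 + 2"
      and q: "norm q < 1" "eval_fps P q = 0" "eval_fps A q = 0"
    show "A = 0"
    proof (cases "w = 2")
      case False
      then obtain a b where "4 * int a + 6 * int b = w"
        using weight_decomposition w by metis
      then show ?thesis
        using eval_small[OF A _ _ q(1,3), of a b] nz[OF q(1,2)] w(3) by simp
    qed (use A mform_2 in simp)
  qed auto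
  have "serre 12 0 (E4_fps ^ 3) = of_nat 3 * E4_fps ^ (3 - 1) * serre 4 0 E4_fps"
    using serre_power[of 3 4 E4_fps] by simp
  moreover have "serre 12 0 (E6_fps ^ 2) = of_nat 2 * E6_fps ^ (2 - 1) * serre 6 0 E6_fps"
    using serre_power[of 2 6 E6_fps] by simp
  moreover have "of_nat 3 * Y\<^sup>2 * (fps_const (- 1 / 3) * Z) = fps_const (3 * (- 1 / 3)) * (Y\<^sup>2 * Z)"
      "of_nat 2 * Z * (fps_const (- 1 / 2) * Y\<^sup>2) = fps_const (2 * (- 1 / 2)) * (Y\<^sup>2 * Z)" for Y Z :: "complex fps"
    unfolding fps_const_mult[symmetric] fps_of_nat[symmetric] by (simp_all add: mult_ac)
  ultimately have "serre 12 0 (E4_fps ^ 3) = - (E4_fps\<^sup>2 * E6_fps)" "serre 12 0 (E6_fps ^ 2) = - (E4_fps\<^sup>2 * E6_fps)"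
    by (simp_all add: serre_E4 serre_E6 flip: fps_const_neg)
  then show "serre 12 0 P = fps_const (c - 1) * (E4_fps\<^sup>2 * E6_fps)"
    unfolding P_def serre_diff serre_cmult by (simp add: algebra_simps flip: fps_const_sub)
qed

text \<open>If 4a + 6b \<equiv> 2 modulo 4, then b is odd, so E6 divides the monomial used for
  reduction; subtracting 12 from the weight preserves the class.\<close>

lemma vanish_at_E6_zero:
  assumes "A \<in> mform w" "w mod 4 = 2" "norm q < 1" "eval_fps E6_fps q = 0"
  shows "eval_fps A q = 0"
  using assms
proof (induction "nat w" arbitrary: w A rule: less_induct)
  case (less w A)
  note d = mform_disc[OF mform_E4] mform_disc[OF mform_E6] mform_disc[OF mform_delta]
  have small: "A = 0" if "w < 0 \<or> odd w \<or> w = 2"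
    using that less.prems(1) mform_2[of A] mform_negative[of A w] mform_odd[of A w] by auto
  have "w < 0 \<or> w = 2 \<or> w \<ge> 6" using less.prems(2) by presburger
  then consider "w < 0" | "w = 2" | "w \<ge> 6" by blast
  then show ?case
  proof cases
    case 3
    define a where "a = nat ((w - 6) div 4)"
    have "4 * ((w - 6) div 4) + 6 = w" "(w - 6) div 4 \<ge> 0"
      using 3 less.prems(2) by presburger+
    then have a: "4 * int a + 6 * int 1 = w"
      by (simp add: a_def)
    obtain c B where B: "B \<in> mform (w - 12)" "A = fps_const c * (E4_fps ^ a * E6_fps ^ 1) + delta_fps * B"
      using mform_reduce[OF less.prems(1) mform_monomial(1)[OF a]] mform_monomial(2)[OF a] by (metis zero_neq_one)
    have "eval_fps B q = 0"
      by (rule less.hyps[OF _ B(1)]) (use 3 less.prems in \<open>auto, presburger\<close>)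
    then show ?thesis
      unfolding B(2) using less.prems(3,4) d mform_disc[OF B(1)] by (simp add: disc_eval disc_intros)
  qed (use small in auto)
qed

text \<open>If 4a + 6b is not divisible by 6, then a is not 0, so E4 divides the monomial used for
  reduction.\<close>

lemma vanish_at_E4_zero:
  assumes "A \<in> mform w" "w mod 6 \<noteq> 0" "norm q < 1" "eval_fps E4_fps q = 0"
  shows "eval_fps A q = 0"
  using assms
proof (induction "nat w" arbitrary: w A rule: less_induct)
  case (less w A)
  note d = mform_disc[OF mform_E4] mform_disc[OF mform_E6] mform_disc[OF mform_delta]
  have small: "A = 0" if "w < 0 \<or> odd w \<or> w = 2"
    using that less.prems(1) mform_2[of A] mform_negative[of A w] mform_odd[of A w] by auto
  have "(w < 0 \<or> odd w) \<or> w = 2 \<or> (w \<ge> 4 \<and> even w)" using less.prems(2) by presburger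
  then consider "w < 0 \<or> odd w" | "w = 2" | "w \<ge> 4" "even w" by blast
  then show ?case
  proof cases
    case 3
    have "w mod 6 = 2 \<or> w mod 6 = 4" using 3 less.prems(2) by presburger
    then obtain a b :: nat where a: "4 * int a + 6 * int b = w" "a \<noteq> 0"
    proof
      assume "w mod 6 = 2"
      then have "4 * 2 + 6 * ((w - 8) div 6) = w" "(w - 8) div 6 \<ge> 0" using 3 by presburger+
      then have "4 * int 2 + 6 * int (nat ((w - 8) div 6)) = w" by simp
      then show ?thesis by (rule that) simp
    next
      assume "w mod 6 = 4"
      then have "4 * 1 + 6 * ((w - 4) div 6) = w" "(w - 4) div 6 \<ge> 0" using 3 by presburger+
      then have "4 * int 1 + 6 * int (nat ((w - 4) div 6)) = w" by simp
      then show ?thesis by (rule that) simp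
    qed
    obtain c B where B: "B \<in> mform (w - 12)" "A = fps_const c * (E4_fps ^ a * E6_fps ^ b) + delta_fps * B"
      using mform_reduce[OF less.prems(1) mform_monomial(1)[OF a(1)]] mform_monomial(2)[OF a(1)] by (metis zero_neq_one)
    have "(w - 12) mod 6 \<noteq> 0" using less.prems(2) by presburger
    then have "eval_fps B q = 0"
      by (intro less.hyps[OF _ B(1)]) (use 3 less.prems in auto)
    then show ?thesis
      unfolding B(2) using less.prems(3,4) d mform_disc[OF B(1)] a(2) by (simp add: disc_eval disc_intros)
  qed (use small in auto)
qed

text \<open>
  The last clause says that a relation \<open>a \<partial>F = b F\<close> at the zeros of \<open>P\<close> can be
  replaced by one between forms of such small weight that dividing by \<open>P\<close> lowers the weight.
\<close>

lemma zero_form_exists: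
  assumes q: "norm q < 1" "q \<noteq> 0"
  obtains v P where "P \<in> mform v" "v > 0" "fps_nth P 0 \<noteq> 0" "eval_fps P q = 0" "divides_at_zeros v P"
    "\<And>z. norm z < 1 \<Longrightarrow> eval_fps P z = 0 \<Longrightarrow> eval_fps (serre v 0 P) z \<noteq> 0"
    "\<And>u a b. a \<in> mform u \<Longrightarrow> b \<in> mform (u + 2) \<Longrightarrow> eval_fps a q \<noteq> 0 \<Longrightarrow>
       \<exists>y \<alpha> \<beta>. \<alpha> \<in> mform y \<and> \<beta> \<in> mform (y + 2) \<and> y + 2 < v \<and> \<alpha> \<noteq> 0 \<and> eval_fps (\<alpha> * b + \<beta> * a) q = 0"
proof -
  note d = mform_disc[OF mform_E4] mform_disc[OF mform_E6]
  consider "eval_fps E4_fps q = 0" | "eval_fps E6_fps q = 0" | "eval_fps E4_fps q \<noteq> 0" "eval_fps E6_fps q \<noteq> 0"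
    by blast
  then show ?thesis
  proof cases
    case 1
    show ?thesis
    proof (rule that[OF mform_E4 _ _ 1 divides_at_zeros_E4])
      show "eval_fps (serre 4 0 E4_fps) z \<noteq> 0" if "norm z < 1" "eval_fps E4_fps z = 0" for z
        using that d E4_E6_no_common_zero by (simp add: serre_E4 disc_eval disc_intros)
      fix u a b assume a: "a \<in> mform u" "b \<in> mform (u + 2)" "eval_fps a q \<noteq> 0"
      \<comment> \<open>Since \<open>a\<close> does not vanish at \<open>q\<close>, its weight is
        divisible by 6; the weight of \<open>b\<close> is not, so \<open>b\<close> vanishes and
        \<alpha> = 1, \<beta> = 0 will do. The zeros of E6 are treated in the same way modulo
        4.\<close>
      have "u mod 6 = 0" using vanish_at_E4_zero[OF a(1) _ q(1) 1] a(3) by blast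
      then have "(u + 2) mod 6 \<noteq> 0" by presburger
      then have "eval_fps b q = 0" using vanish_at_E4_zero[OF a(2) _ q(1) 1] by blast
      then show "\<exists>y \<alpha> \<beta>. \<alpha> \<in> mform y \<and> \<beta> \<in> mform (y + 2) \<and> y + 2 < 4 \<and> \<alpha> \<noteq> 0 \<and> eval_fps (\<alpha> * b + \<beta> * a) q = 0"
        by (intro exI[of _ 0] exI[of _ 1]) (auto simp: mform_0 mform_1)
    qed (auto simp: E4_nth_0)
  next
    case 2
    show ?thesis
    proof (rule that[OF mform_E6 _ _ 2 divides_at_zeros_E6])
      show "eval_fps (serre 6 0 E6_fps) z \<noteq> 0" if "norm z < 1" "eval_fps E6_fps z = 0" for z
        using that d E4_E6_no_common_zero by (auto simp: serre_E6 disc_eval disc_intros)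
      fix u a b assume a: "a \<in> mform u" "b \<in> mform (u + 2)" "eval_fps a q \<noteq> 0"
      have "a \<noteq> 0" using a(3) by auto
      then have "even u" using mform_odd[OF a(1)] by blast
      moreover have "u mod 4 \<noteq> 2" using vanish_at_E6_zero[OF a(1) _ q(1) 2] a(3) by blast
      ultimately have "(u + 2) mod 4 = 2" by presburger
      then have "eval_fps b q = 0" using vanish_at_E6_zero[OF a(2) _ q(1) 2] by blast
      then show "\<exists>y \<alpha> \<beta>. \<alpha> \<in> mform y \<and> \<beta> \<in> mform (y + 2) \<and> y + 2 < 6 \<and> \<alpha> \<noteq> 0 \<and> eval_fps (\<alpha> * b + \<beta> * a) q = 0"
        by (intro exI[of _ 0] exI[of _ 1]) (auto simp: mform_0 mform_1)
    qed (auto simp: E6_nth_0)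
  next
    case 3
    \<comment> \<open>The member of the pencil that vanishes at \<open>q\<close>; \<open>c\<close>
      is 1 only where the discriminant vanishes.\<close>
    define c where "c = eval_fps E4_fps q ^ 3 / (eval_fps E6_fps q)\<^sup>2"
    have c0: "c \<noteq> 0" using 3 by (simp add: c_def)
    have c1: "c \<noteq> 1"
    proof
      assume "c = 1"
      then have "eval_fps E4_fps q ^ 3 = (eval_fps E6_fps q)\<^sup>2" using 3 by (simp add: c_def)
      then have "eval_fps (E4_fps ^ 3 - E6_fps\<^sup>2) q = 0"
        using q d by (simp add: disc_eval disc_intros)
      then show False
        using eval_delta_nonzero[OF q(2,1)] q mform_disc[OF mform_delta]
        by (simp add: delta_eq disc_eval disc_intros)
    qed
    note G = generic_form[OF c0 c1]
    show ?thesis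
    proof (rule that[OF G(1) _ G(2) _ G(5)])
      show "eval_fps (E4_fps ^ 3 - fps_const c * E6_fps\<^sup>2) q = 0"
        using G(3)[OF q(1)] 3 by (simp add: c_def)
      show "eval_fps (serre 12 0 (E4_fps ^ 3 - fps_const c * E6_fps\<^sup>2)) z \<noteq> 0"
        if "norm z < 1" "eval_fps (E4_fps ^ 3 - fps_const c * E6_fps\<^sup>2) z = 0" for z
        using G(4)[OF that] that(1) d c1 by (simp add: G(6) disc_eval disc_intros)
      fix u a b assume a: "a \<in> mform u" "b \<in> mform (u + 2)" "eval_fps a q \<noteq> 0"
      \<comment> \<open>With \<alpha> = E4 and \<beta> = l E6 the required vanishing at
        \<open>q\<close> is one linear equation for \<open>l\<close>, solvable since E6 and
        \<open>a\<close> are nonzero at \<open>q\<close>.\<close>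
      define l where "l = - (eval_fps E4_fps q * eval_fps b q / (eval_fps E6_fps q * eval_fps a q))"
      have "E4_fps \<noteq> 0" using E4_nth_0 by auto
      moreover have "eval_fps (E4_fps * b + (fps_const l * E6_fps) * a) q = 0"
        using q(1) d mform_disc[OF a(1)] mform_disc[OF a(2)] a(3) 3 by (simp add: disc_eval disc_intros l_def)
      moreover have "fps_const l * E6_fps \<in> mform (4 + 2)"
        using mform_cmult[OF mform_E6] by simp
      ultimately show "\<exists>y \<alpha> \<beta>. \<alpha> \<in> mform y \<and> \<beta> \<in> mform (y + 2) \<and> y + 2 < 12 \<and> \<alpha> \<noteq> 0 \<and> eval_fps (\<alpha> * b + \<beta> * a) q = 0"
        using mform_E4 by (intro exI[of _ 4] exI[of _ E4_fps] exI[of _ "fps_const l * E6_fps"]) auto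
    qed auto
  qed
qed

subsection \<open>Vector-valued forms\<close>

lemma fps_mult_nth_lowest:
  fixes f g :: "'a::comm_ring_1 fps"
  assumes "\<And>i. i < a \<Longrightarrow> fps_nth f i = 0" "\<And>i. i < b \<Longrightarrow> fps_nth g i = 0"
  shows "fps_nth (f * g) (a + b) = fps_nth f a * fps_nth g b"
proof -
  have "fps_nth (f * g) (a + b) = (\<Sum>i\<in>{0..a+b}. fps_nth f i * fps_nth g (a + b - i))"
    by (simp add: fps_mult_nth)
  also have "\<dots> = (\<Sum>i\<in>{a}. fps_nth f i * fps_nth g (a + b - i))"
  proof (rule sum.mono_neutral_right)
    show "\<forall>i\<in>{0..a + b} - {a}. fps_nth f i * fps_nth g (a + b - i) = 0"
    proof
      fix i assume i: "i \<in> {0..a + b} - {a}"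
      then consider "i < a" | "a + b - i < b" by force
      then show "fps_nth f i * fps_nth g (a + b - i) = 0"
        using assms by cases auto
    qed
  qed auto
  finally show ?thesis by simp
qed

text \<open>Each factor \<open>P\<close> lowers the weight by v > 0, and nonzero forms have
  nonnegative weight, so the extraction stops.\<close>

lemma mform_factor_out:
  assumes P: "P \<in> mform v" "v > 0" "divides_at_zeros v P"
    and A: "A \<in> mform w" "A \<noteq> 0"
  obtains e h where "h \<in> mform (w - int e * v)" "A = P ^ e * h"
    "\<And>q. norm q < 1 \<Longrightarrow> eval_fps P q = 0 \<Longrightarrow> eval_fps h q \<noteq> 0"
proof -
  have "\<exists>e h. h \<in> mform (w - int e * v) \<and> A = P ^ e * h \<and>
     (\<forall>q. norm q < 1 \<longrightarrow> eval_fps P q = 0 \<longrightarrow> eval_fps h q \<noteq> 0)"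
    using A
  proof (induction "nat w" arbitrary: w A rule: less_induct)
    case (less w A)
    show ?case
    proof (cases "\<exists>q. norm q < 1 \<and> eval_fps P q = 0 \<and> eval_fps A q = 0")
      case True
      then obtain B where B: "B \<in> mform (w - v)" "A = P * B"
        using P(3) less.prems(1) unfolding divides_at_zeros_def by blast
      have "B \<noteq> 0" using B less.prems(2) by auto
      then have "w - v \<ge> 0" using mform_negative[OF B(1)] by force
      then obtain e h where "h \<in> mform (w - v - int e * v)" "B = P ^ e * h"
        "\<forall>q. norm q < 1 \<longrightarrow> eval_fps P q = 0 \<longrightarrow> eval_fps h q \<noteq> 0"
        using less.hyps[OF _ B(1) \<open>B \<noteq> 0\<close>] P(2) by auto
      then show ?thesis
        unfolding B(2) by (intro exI[of _ "Suc e"] exI[of _ h]) (auto simp: algebra_simps)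
    next
      case False
      then show ?thesis
        using less.prems by (intro exI[of _ 0] exI[of _ A]) auto
    qed
  qed
  then show ?thesis using that by blast
qed

text \<open>All that is kept of the representation: the exponents of the diagonal matrix for T and
  the matrix \<open>R\<close> for S. The integer \<open>l\<close> is the weight of the discriminant
  to the power \<open>m 1 + m 2\<close>. The last three conditions make the components of a nonzero
  form nonzero and linearly independent.\<close>

locale vector_forms =
  fixes m :: "2 \<Rightarrow> complex" and R :: "2 \<Rightarrow> 2 \<Rightarrow> complex" and l :: int
  assumes exponent_sum: "12 * (m 1 + m 2) = of_int l"
    and exponent_diff: "m 1 - m 2 \<notin> \<int>"
    and R12: "R 1 2 \<noteq> 0" and R21: "R 2 1 \<noteq> 0"
begin

definition twist :: "2 \<Rightarrow> complex fps \<Rightarrow> complex \<Rightarrow> complex" where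
  "twist i A \<tau> = exp (2 * of_real pi * \<i> * m i * \<tau>) * at_nome A \<tau>"

definition vform :: "int \<Rightarrow> (2 \<Rightarrow> complex fps) set" where
  "vform k = {\<phi>. (\<forall>i. \<phi> i \<in> disc) \<and> (\<forall>\<tau> i. Im \<tau> > 0 \<longrightarrow>
     twist i (\<phi> i) (- 1 / \<tau>) = \<tau> powi k * (R i 1 * twist 1 (\<phi> 1) \<tau> + R i 2 * twist 2 (\<phi> 2) \<tau>))}"

definition D :: "int \<Rightarrow> (2 \<Rightarrow> complex fps) \<Rightarrow> 2 \<Rightarrow> complex fps" where
  "D k \<phi> i = serre k (m i) (\<phi> i)"

text \<open>A determinant of two vector forms has leading exponent \<open>m 1 + m 2\<close> and
  transforms by the determinant of the representation. Dividing by the corresponding power of the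
  discriminant removes both and leaves a scalar form.\<close>

definition cross :: "(2 \<Rightarrow> complex fps) \<Rightarrow> (2 \<Rightarrow> complex fps) \<Rightarrow> complex fps" where
  "cross \<phi> \<psi> = (\<phi> 1 * \<psi> 2 - \<phi> 2 * \<psi> 1) * delta_power (- (m 1 + m 2))"

lemma vform_disc: "\<phi> \<in> vform k \<Longrightarrow> \<phi> i \<in> disc"
  and vform_transform: "\<phi> \<in> vform k \<Longrightarrow> Im \<tau> > 0 \<Longrightarrow>
     twist i (\<phi> i) (- 1 / \<tau>) = \<tau> powi k * (R i 1 * twist 1 (\<phi> 1) \<tau> + R i 2 * twist 2 (\<phi> 2) \<tau>)"
  by (auto simp: vform_def)

lemma vform_add: "\<phi> \<in> vform k \<Longrightarrow> \<psi> \<in> vform k \<Longrightarrow> (\<lambda>i. \<phi> i + \<psi> i) \<in> vform k"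
  by (auto simp: vform_def disc_intros twist_def at_nome_simps Im_inverse_pos algebra_simps simp del: divide_minus_left)

lemma vform_mult:
  assumes A: "A \<in> mform w" and \<phi>: "\<phi> \<in> vform k"
  shows "(\<lambda>i. A * \<phi> i) \<in> vform (w + k)"
proof -
  have tw: "twist i (A * \<phi> i) \<tau> = at_nome A \<tau> * twist i (\<phi> i) \<tau>" if "Im \<tau> > 0" for i \<tau>
    using that mform_disc[OF A] vform_disc[OF \<phi>] by (simp add: twist_def at_nome_simps)
  have "twist i (A * \<phi> i) (- 1 / \<tau>) =
      \<tau> powi (w + k) * (R i 1 * twist 1 (A * \<phi> 1) \<tau> + R i 2 * twist 2 (A * \<phi> 2) \<tau>)" if \<tau>: "Im \<tau> > 0" for i \<tau>
  proof -
    have "\<tau> \<noteq> 0" using \<tau> by auto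
    then show ?thesis
      unfolding tw[OF \<tau>] tw[OF Im_inverse_pos[OF \<tau>]] mform_transform[OF A \<tau>] vform_transform[OF \<phi> \<tau>]
      by (simp add: power_int_add algebra_simps)
  qed
  then show ?thesis
    using mform_disc[OF A] vform_disc[OF \<phi>] by (simp add: vform_def disc_intros)
qed

lemma vform_divide:
  assumes A: "(\<lambda>i. P * \<phi> i) \<in> vform k" and P: "P \<in> mform v" "P \<noteq> 0" and \<phi>: "\<And>i. \<phi> i \<in> disc"
  shows "\<phi> \<in> vform (k - v)"
proof -
  have tw: "twist i (P * \<phi> i) \<tau> = at_nome P \<tau> * twist i (\<phi> i) \<tau>" if "Im \<tau> > 0" for i \<tau>
    using that mform_disc[OF P(1)] \<phi> by (simp add: twist_def at_nome_simps)
  have "twist i (\<phi> i) (- 1 / \<tau>) - \<tau> powi (k - v) * (R i 1 * twist 1 (\<phi> 1) \<tau> + R i 2 * twist 2 (\<phi> 2) \<tau>) = 0"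
    if \<tau>: "Im \<tau> > 0" for i \<tau>
  proof (rule at_nome_cancel[OF mform_disc[OF P(1)] P(2) _ _ \<tau>])
    show "continuous_on {\<tau>. Im \<tau> > 0} (\<lambda>\<tau>. twist i (\<phi> i) (- 1 / \<tau>) -
        \<tau> powi (k - v) * (R i 1 * twist 1 (\<phi> 1) \<tau> + R i 2 * twist 2 (\<phi> 2) \<tau>))"
      unfolding twist_def by (intro continuous_intros continuous_at_nome \<phi>) auto
    fix \<tau> assume \<tau>: "Im \<tau> > 0"
    have t0: "\<tau> \<noteq> 0" using \<tau> by auto
    have gen: "x * (w - p * (a * s + b * t)) = 0" if "V * x * w = V * p * (a * (x * s) + b * (x * t))" "V \<noteq> 0"
      for x w p a b s t V :: complex
    proof -
      have "V * (x * (w - p * (a * s + b * t))) = V * x * w - V * p * (a * (x * s) + b * (x * t))"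
        by (simp add: algebra_simps)
      then show ?thesis using that by auto
    qed
    have "\<tau> powi k = \<tau> powi v * \<tau> powi (k - v)"
      using t0 by (simp flip: power_int_add)
    then show "at_nome P \<tau> * (twist i (\<phi> i) (- 1 / \<tau>) -
        \<tau> powi (k - v) * (R i 1 * twist 1 (\<phi> 1) \<tau> + R i 2 * twist 2 (\<phi> 2) \<tau>)) = 0"
      using vform_transform[OF A \<tau>, of i] t0
      unfolding tw[OF \<tau>] tw[OF Im_inverse_pos[OF \<tau>]] mform_transform[OF P(1) \<tau>]
      by (intro gen[of "\<tau> powi v"]) simp_all
  qed
  then show ?thesis
    using \<phi> by (simp add: vform_def)
qed

lemma vform_D:
  assumes \<phi>: "\<phi> \<in> vform k"
  shows "D k \<phi> \<in> vform (k + 2)"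
proof -
  note d = vform_disc[OF \<phi>]
  let ?t1 = "\<lambda>i. twist i (qderiv (\<phi> i) + fps_const (m i) * \<phi> i)"
  have der: "(twist i (\<phi> i) has_field_derivative 2 * of_real pi * \<i> * ?t1 i \<tau>) (at \<tau>)" if "Im \<tau> > 0" for i \<tau>
    using twisted_has_field_derivative[OF d that, of "m i" i] by (simp add: twist_def[abs_def])
  have tD: "twist i (D k \<phi> i) \<tau> = ?t1 i \<tau> - of_int k / 12 * at_nome E2_fps \<tau> * twist i (\<phi> i) \<tau>"
    if "Im \<tau> > 0" for i \<tau>
    using that d by (simp add: twist_def D_def serre_def at_nome_simps disc_intros disc_qderiv disc_E2 algebra_simps)
  have "twist i (D k \<phi> i) (- 1 / \<tau>) =
      \<tau> powi (k + 2) * (R i 1 * twist 1 (D k \<phi> 1) \<tau> + R i 2 * twist 2 (D k \<phi> 2) \<tau>)" if \<tau>: "Im \<tau> > 0" for i \<tau>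
  proof -
    have "?t1 i (- 1 / \<tau>) - of_int k / 12 * at_nome E2_fps (- 1 / \<tau>) * twist i (\<phi> i) (- 1 / \<tau>) =
        \<tau> powi (k + 2) * ((R i 1 * ?t1 1 \<tau> + R i 2 * ?t1 2 \<tau>) - of_int k / 12 * at_nome E2_fps \<tau> *
          (R i 1 * twist 1 (\<phi> 1) \<tau> + R i 2 * twist 2 (\<phi> 2) \<tau>))"
    proof (rule serre_transform[OF der _ _ \<tau>])
      show "((\<lambda>\<tau>. R i 1 * twist 1 (\<phi> 1) \<tau> + R i 2 * twist 2 (\<phi> 2) \<tau>) has_field_derivative
          2 * of_real pi * \<i> * (R i 1 * ?t1 1 \<tau> + R i 2 * ?t1 2 \<tau>)) (at \<tau>)" if "Im \<tau> > 0" for \<tau>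
        using that by (auto intro!: derivative_eq_intros der simp: algebra_simps)
    qed (use vform_transform[OF \<phi>] in auto)
    then show ?thesis
      unfolding tD[OF \<tau>] tD[OF Im_inverse_pos[OF \<tau>]] by (simp only:) (simp add: algebra_simps)
  qed
  then show ?thesis
    using d by (simp add: vform_def D_def disc_serre)
qed

lemma cross_disc: "(\<And>i. \<phi> i \<in> disc) \<Longrightarrow> (\<And>i. \<psi> i \<in> disc) \<Longrightarrow> cross \<phi> \<psi> \<in> disc"
  unfolding cross_def by (intro disc_intros disc_delta_power)

text \<open>The quotient of the determinant by the power of the discriminant transforms with some
  constant \<open>C\<close>, and \<open>multiplier_trivial\<close> evaluates it without any
  comparison of det R with the multiplier of that power.\<close>

lemma cross_mform:
  assumes \<phi>: "\<phi> \<in> vform k" and \<psi>: "\<psi> \<in> vform k'"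
  shows "cross \<phi> \<psi> \<in> mform (k + k' - l)"
proof (cases "cross \<phi> \<psi> = 0")
  case False
  define s where "s = m 1 + m 2"
  note d = vform_disc[OF \<phi>] vform_disc[OF \<psi>]
  obtain c where c: "c \<noteq> 0" "\<And>\<tau>. Im \<tau> > 0 \<Longrightarrow> delta_fun s (- 1 / \<tau>) = c * \<tau> powi l * delta_fun s \<tau>"
    using delta_fun_transform[OF exponent_sum] unfolding s_def by metis
  define C where "C = (R 1 1 * R 2 2 - R 1 2 * R 2 1) / c"
  have W: "at_nome (cross \<phi> \<psi>) \<tau> * delta_fun s \<tau> =
      twist 1 (\<phi> 1) \<tau> * twist 2 (\<psi> 2) \<tau> - twist 2 (\<phi> 2) \<tau> * twist 1 (\<psi> 1) \<tau>" if \<tau>: "Im \<tau> > 0" for \<tau>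
  proof -
    have "at_nome (delta_power (- s)) \<tau> * at_nome (delta_power s) \<tau> = at_nome (delta_power (- s) * delta_power s) \<tau>"
      using \<tau> by (simp add: at_nome_mult disc_delta_power)
    then have "at_nome (delta_power (- s)) \<tau> * at_nome (delta_power s) \<tau> = 1"
      by (simp add: delta_power_add delta_power_0)
    moreover have "exp (2 * of_real pi * \<i> * s * \<tau>) = exp (2 * of_real pi * \<i> * m 1 * \<tau>) * exp (2 * of_real pi * \<i> * m 2 * \<tau>)"
      by (simp add: s_def algebra_simps flip: exp_add)
    moreover have "at_nome (cross \<phi> \<psi>) \<tau> =
        (at_nome (\<phi> 1) \<tau> * at_nome (\<psi> 2) \<tau> - at_nome (\<phi> 2) \<tau> * at_nome (\<psi> 1) \<tau>) * at_nome (delta_power (- s)) \<tau>"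
      using \<tau> d by (simp add: cross_def s_def at_nome_simps disc_intros disc_delta_power)
    ultimately have "at_nome (cross \<phi> \<psi>) \<tau> * delta_fun s \<tau> =
        (at_nome (\<phi> 1) \<tau> * at_nome (\<psi> 2) \<tau> - at_nome (\<phi> 2) \<tau> * at_nome (\<psi> 1) \<tau>) *
        (exp (2 * of_real pi * \<i> * m 1 * \<tau>) * exp (2 * of_real pi * \<i> * m 2 * \<tau>))"
    proof -
      have gen: "W * (E * e) = w * (a * b)" if "d * e = 1" "E = a * b" "W = w * d" for W E e w a b d :: complex
      proof -
        have "W * (E * e) = w * (a * b) * (d * e)" unfolding that(2,3) by (simp add: mult_ac)
        then show ?thesis using that(1) by simp
      qed
      assume "at_nome (delta_power (- s)) \<tau> * at_nome (delta_power s) \<tau> = 1"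
        "exp (2 * of_real pi * \<i> * s * \<tau>) = exp (2 * of_real pi * \<i> * m 1 * \<tau>) * exp (2 * of_real pi * \<i> * m 2 * \<tau>)"
        "at_nome (cross \<phi> \<psi>) \<tau> =
          (at_nome (\<phi> 1) \<tau> * at_nome (\<psi> 2) \<tau> - at_nome (\<phi> 2) \<tau> * at_nome (\<psi> 1) \<tau>) * at_nome (delta_power (- s)) \<tau>"
      then show ?thesis
        unfolding delta_fun_def by (rule gen)
    qed
    then show ?thesis
      by (simp only: twist_def) (simp add: algebra_simps)
  qed
  have tr: "at_nome (cross \<phi> \<psi>) (- 1 / \<tau>) = C * \<tau> powi (k + k' - l) * at_nome (cross \<phi> \<psi>) \<tau>" if \<tau>: "Im \<tau> > 0" for \<tau>
  proof -
    have t0: "\<tau> \<noteq> 0" using \<tau> by auto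
    define x1 x2 y1 y2 where "x1 = twist 1 (\<phi> 1) \<tau>" "x2 = twist 2 (\<phi> 2) \<tau>" "y1 = twist 1 (\<psi> 1) \<tau>" "y2 = twist 2 (\<psi> 2) \<tau>"
    note xy = this
    have "at_nome (cross \<phi> \<psi>) (- 1 / \<tau>) * (c * \<tau> powi l * delta_fun s \<tau>) =
       (\<tau> powi k * (R 1 1 * x1 + R 1 2 * x2)) * (\<tau> powi k' * (R 2 1 * y1 + R 2 2 * y2)) -
       (\<tau> powi k * (R 2 1 * x1 + R 2 2 * x2)) * (\<tau> powi k' * (R 1 1 * y1 + R 1 2 * y2))"
      using W[OF Im_inverse_pos[OF \<tau>]] unfolding c(2)[OF \<tau>] vform_transform[OF \<phi> \<tau>] vform_transform[OF \<psi> \<tau>] xy .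
    also have "\<dots> = \<tau> powi k * \<tau> powi k' * (R 1 1 * R 2 2 - R 1 2 * R 2 1) * (x1 * y2 - x2 * y1)"
      by (simp add: algebra_simps)
    also have "x1 * y2 - x2 * y1 = at_nome (cross \<phi> \<psi>) \<tau> * delta_fun s \<tau>"
      using W[OF \<tau>] by (simp add: xy)
    also have "\<tau> powi k * \<tau> powi k' * (R 1 1 * R 2 2 - R 1 2 * R 2 1) * (at_nome (cross \<phi> \<psi>) \<tau> * delta_fun s \<tau>) =
        (C * \<tau> powi (k + k' - l) * at_nome (cross \<phi> \<psi>) \<tau>) * (c * \<tau> powi l * delta_fun s \<tau>)"
      using t0 c(1) by (simp add: C_def power_int_add power_int_diff)
    finally show ?thesis
      using c(1) t0 delta_fun_nonzero[OF \<tau>, of s] by simp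
  qed
  have "C = 1"
    by (rule multiplier_trivial(1)[OF cross_disc[OF d] False tr])
  then show ?thesis
    using tr cross_disc[OF d] by (simp add: mform_def)
qed (simp add: mform_0)

lemma cross_self [simp]: "cross \<phi> \<phi> = 0"
  by (simp add: cross_def mult.commute)

lemma cross_swap: "cross \<psi> \<phi> = - cross \<phi> \<psi>"
  by (simp add: cross_def algebra_simps)

lemma cross_add: "cross \<phi> (\<lambda>i. \<psi> i + \<omega> i) = cross \<phi> \<psi> + cross \<phi> \<omega>"
  and cross_smult: "cross \<phi> (\<lambda>i. A * \<psi> i) = A * cross \<phi> \<psi>"
  by (simp_all add: cross_def algebra_simps)

text \<open>Three vectors in a plane satisfy a linear relation whose coefficients are their
  two-by-two determinants.\<close>

lemma plucker: "cross \<phi> \<psi> * \<omega> i + cross \<psi> \<omega> * \<phi> i + cross \<omega> \<phi> * \<psi> i = 0"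
proof -
  have "i = 1 \<or> i = 2" using exhaust_2 by blast
  then show ?thesis by (auto simp: cross_def algebra_simps)
qed

text \<open>Powers of the discriminant are annihilated by the Serre derivative of their weight, so
  the Leibniz rule acts on the determinant alone.\<close>

lemma serre_cross:
  "serre (k + k' - l) 0 (cross \<phi> \<psi>) = cross (D k \<phi>) \<psi> + cross \<phi> (D k' \<psi>)"
proof -
  define s where "s = m 1 + m 2"
  have ls: "of_int l = 12 * s" using exponent_sum by (simp add: s_def)
  have E: "serre (- l) (- s) (delta_power (- s)) = 0"
    by (simp add: serre_def qderiv_delta_power ls algebra_simps flip: fps_const_neg)
  have "serre (k + k' - l) 0 (cross \<phi> \<psi>) =
      serre ((k + k') + - l) (s + - s) ((\<phi> 1 * \<psi> 2 - \<phi> 2 * \<psi> 1) * delta_power (- s))"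
    by (simp add: cross_def s_def)
  also have "\<dots> = serre (k + k') s (\<phi> 1 * \<psi> 2 - \<phi> 2 * \<psi> 1) * delta_power (- s)"
    by (simp only: serre_mult E mult_zero_right add_0_right)
  also have "serre (k + k') s (\<phi> 1 * \<psi> 2 - \<phi> 2 * \<psi> 1) =
      serre (k + k') (m 1 + m 2) (\<phi> 1 * \<psi> 2) - serre (k + k') (m 2 + m 1) (\<phi> 2 * \<psi> 1)"
    by (simp add: serre_diff s_def add.commute)
  also have "\<dots> = (D k \<phi> 1 * \<psi> 2 + \<phi> 1 * D k' \<psi> 2) - (D k \<phi> 2 * \<psi> 1 + \<phi> 2 * D k' \<psi> 1)"
    unfolding D_def by (simp only: serre_mult)
  finally show ?thesis
    by (simp add: cross_def s_def algebra_simps)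
qed

text \<open>If one component vanishes identically, its transformation law says that an off-diagonal
  entry of \<open>R\<close> times the other component is zero.\<close>

lemma vform_component_zero:
  assumes \<phi>: "\<phi> \<in> vform k" and z: "\<phi> i = 0"
  shows "\<phi> j = 0"
proof -
  have "\<phi> j = 0" if ij: "i = 1 \<and> j = 2 \<or> i = 2 \<and> j = 1"
  proof (rule at_nome_eqI[OF vform_disc[OF \<phi>] disc_0])
    fix \<tau> :: complex assume \<tau>: "Im \<tau> > 0"
    have t0: "\<tau> \<noteq> 0" using \<tau> by auto
    have tz: "twist i (\<phi> i) \<sigma> = 0" for \<sigma> by (simp add: twist_def z)
    have "\<tau> powi k * (R i 1 * twist 1 (\<phi> 1) \<tau> + R i 2 * twist 2 (\<phi> 2) \<tau>) = 0"
      using vform_transform[OF \<phi> \<tau>, of i] tz by simp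
    then have "twist j (\<phi> j) \<tau> = 0"
      using ij tz[of \<tau>] t0 R12 R21 by auto
    then show "at_nome (\<phi> j) \<tau> = at_nome 0 \<tau>" by (simp add: twist_def)
  qed
  moreover have "(i = 1 \<or> i = 2) \<and> (j = 1 \<or> j = 2)" using exhaust_2 by blast
  ultimately show ?thesis using z by auto
qed

text \<open>In a vanishing Wronskian the terms with E2 cancel, and comparing lowest coefficients
  equates the total orders \<open>a + m 1\<close> and \<open>b + m 2\<close>, against the
  nonintegral difference of exponents.\<close>

lemma cross_D_nonzero:
  assumes \<phi>: "\<phi> \<in> vform k" and nz: "\<phi> i \<noteq> 0"
  shows "cross \<phi> (D k \<phi>) \<noteq> 0"
proof
  assume z: "cross \<phi> (D k \<phi>) = 0"
  have nz': "\<phi> j \<noteq> 0" for j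
    using vform_component_zero[OF \<phi>, of j i] nz by auto
  define f where "f j = qderiv (\<phi> j) + fps_const (m j) * \<phi> j" for j
  have fn: "fps_nth (f j) n = (of_nat n + m j) * fps_nth (\<phi> j) n" for j n
    by (simp add: f_def qderiv_nth algebra_simps)
  have "\<phi> 1 * D k \<phi> 2 = \<phi> 2 * D k \<phi> 1"
    using z delta_power_nonzero by (simp add: cross_def)
  then have eq: "\<phi> 1 * f 2 = \<phi> 2 * f 1"
    by (simp add: D_def serre_def f_def algebra_simps)
  define a where "a = subdegree (\<phi> 1)"
  define b where "b = subdegree (\<phi> 2)"
  have low: "fps_nth (\<phi> 1) n = 0" if "n < a" for n using that unfolding a_def by (rule nth_less_subdegree_zero)
  have low2: "fps_nth (\<phi> 2) n = 0" if "n < b" for n using that unfolding b_def by (rule nth_less_subdegree_zero)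
  have "fps_nth (\<phi> 1 * f 2) (a + b) = fps_nth (\<phi> 1) a * fps_nth (f 2) b"
    by (rule fps_mult_nth_lowest) (simp_all add: low low2 fn)
  moreover have "fps_nth (\<phi> 2 * f 1) (b + a) = fps_nth (\<phi> 2) b * fps_nth (f 1) a"
    by (rule fps_mult_nth_lowest) (simp_all add: low low2 fn)
  ultimately have "fps_nth (\<phi> 1) a * ((of_nat b + m 2) * fps_nth (\<phi> 2) b) = fps_nth (\<phi> 2) b * ((of_nat a + m 1) * fps_nth (\<phi> 1) a)"
    by (simp add: eq fn add.commute)
  moreover have "fps_nth (\<phi> 1) a \<noteq> 0" "fps_nth (\<phi> 2) b \<noteq> 0"
    using nz' by (simp_all add: a_def b_def)
  ultimately have "of_nat b + m 2 = of_nat a + m 1" by simp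
  then have "m 1 - m 2 = of_nat b - of_nat a" by (simp add: algebra_simps)
  then show False using exponent_diff by simp
qed

lemma vform_weight_bound:
  assumes \<phi>: "\<phi> \<in> vform k" and nz: "\<phi> i \<noteq> 0"
  shows "0 \<le> 2 * k + 2 - l"
proof (rule ccontr)
  assume "\<not> ?thesis"
  moreover have "cross \<phi> (D k \<phi>) \<in> mform (2 * k + 2 - l)"
    using cross_mform[OF \<phi> vform_D[OF \<phi>]] by (simp add: algebra_simps)
  ultimately show False
    using cross_D_nonzero[OF \<phi> nz] mform_negative by simp
qed

text \<open>The nonzero Wronskian makes \<open>2 * k + 2 - l\<close> nonnegative, so
  \<open>nat\<close> keeps the order of the weights that occur and a least one exists.\<close>

lemma minimal_vform_exists:
  assumes "\<phi> \<in> vform k" "\<phi> i \<noteq> 0"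
  obtains F k0 where "F \<in> vform k0" "F 1 \<noteq> 0"
    "\<And>\<psi> k' j. \<psi> \<in> vform k' \<Longrightarrow> \<psi> j \<noteq> 0 \<Longrightarrow> k0 \<le> k'"
proof -
  define Q where "Q n \<longleftrightarrow> (\<exists>k \<phi> i. \<phi> \<in> vform k \<and> \<phi> i \<noteq> 0 \<and> nat (2 * k + 2 - l) = n)" for n
  have "Q (LEAST n. Q n)"
    by (rule LeastI[of Q "nat (2 * k + 2 - l)"]) (use assms in \<open>auto simp: Q_def\<close>)
  then obtain k0 F i0 where F: "F \<in> vform k0" "F i0 \<noteq> 0" "nat (2 * k0 + 2 - l) = (LEAST n. Q n)"
    unfolding Q_def by blast
  have "k0 \<le> k'" if "\<psi> \<in> vform k'" "\<psi> j \<noteq> 0" for \<psi> k' j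
  proof -
    have "nat (2 * k0 + 2 - l) \<le> nat (2 * k' + 2 - l)"
      unfolding F(3) by (rule Least_le) (use that in \<open>auto simp: Q_def\<close>)
    then show ?thesis using vform_weight_bound[OF that] by simp
  qed
  moreover have "F 1 \<noteq> 0" using vform_component_zero[OF F(1), of 1 i0] F(2) by auto
  ultimately show ?thesis using that F(1) by blast
qed

end

subsection \<open>Forms of minimal weight\<close>

context vector_forms
begin

lemma cross_combination_nonzero:
  assumes F: "F \<in> vform k" "F 1 \<noteq> 0" and a: "\<alpha> \<noteq> 0"
  shows "\<exists>i. \<alpha> * D k F i + \<beta> * F i \<noteq> 0"
proof (rule ccontr)
  assume "\<not> ?thesis"
  then have "(\<lambda>i. \<alpha> * D k F i + \<beta> * F i) = (\<lambda>_. 0)" by auto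
  then have "cross F (\<lambda>i. \<alpha> * D k F i + \<beta> * F i) = 0" by (simp add: cross_def)
  then have "\<alpha> * cross F (D k F) = 0"
    by (simp only: cross_add cross_smult cross_self mult_zero_right add_0_right)
  then show False
    using cross_D_nonzero[OF F] a by simp
qed

text \<open>If one component had no constant term, a combination of \<open>D k F\<close> and
  \<open>F\<close> of weight k + 6 could be chosen that has none in either component; dividing by
  the discriminant would give weight k - 6.\<close>

lemma minimal_cross_cusp:
  assumes F: "F \<in> vform k" "F 1 \<noteq> 0"
    and min: "\<And>\<psi> k' j. \<psi> \<in> vform k' \<Longrightarrow> \<psi> j \<noteq> 0 \<Longrightarrow> k \<le> k'"
  shows "fps_nth (F i) 0 \<noteq> 0"
proof
  assume z: "fps_nth (F i) 0 = 0"
  define j :: 2 where "j = (if i = 1 then 2 else 1)"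
  have ij: "p = i \<or> p = j" for p
    using exhaust_2[of p] exhaust_2[of i] by (auto simp: j_def)
  \<comment> \<open>The constant term of \<open>D k F j\<close> is \<open>c\<close> times that of
    \<open>F j\<close>, so \<open>G\<close> loses its constant term in component j; component i has
    none by assumption.\<close>
  define c where "c = m j - of_int k / 12"
  have Dn: "fps_nth (D k F p) 0 = (m p - of_int k / 12) * fps_nth (F p) 0" for p
    by (simp add: D_def serre_def qderiv_nth E2_nth_0 algebra_simps)
  define G where "G p = E4_fps * D k F p + (fps_const (- c) * E6_fps) * F p" for p
  have Gf: "G \<in> vform (k + 6)"
  proof -
    have "(\<lambda>p. E4_fps * D k F p) \<in> vform (4 + (k + 2))"
      by (intro vform_mult mform_E4 vform_D F)
    moreover have "(\<lambda>p. (fps_const (- c) * E6_fps) * F p) \<in> vform (6 + k)"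
      by (intro vform_mult mform_cmult mform_E6 F)
    ultimately show ?thesis
      unfolding G_def using vform_add[of _ "k + 6"] by (simp add: algebra_simps)
  qed
  have G0: "fps_nth (G p) 0 = 0" for p
    using ij[of p] z by (auto simp: G_def Dn E4_nth_0 E6_nth_0 c_def algebra_simps)
  define Q where "Q p = fps_shift 1 (G p) * delta_power (- 1)" for p
  have GX: "fps_X * fps_shift 1 (G p) = G p" for p
    using G0[of p] by (simp add: fps_eq_iff)
  have "delta_fps * Q p = fps_X * fps_shift 1 (G p) * (delta_power 1 * delta_power (- 1))" for p
    by (simp add: delta_fps_def Q_def mult_ac)
  then have GQ: "delta_fps * Q p = G p" for p
    by (simp only: delta_power_inverse GX mult_1_right)
  have "fps_shift 1 (G p) \<in> disc" for p
    using vform_disc[OF Gf, of p] by (simp add: disc_def)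
  then have Qd: "Q p \<in> disc" for p
    unfolding Q_def by (intro disc_intros disc_delta_power)
  have "Q \<in> vform (k + 6 - 12)"
    by (rule vform_divide[OF _ mform_delta delta_nonzero Qd]) (use Gf GQ in simp)
  moreover have "E4_fps \<noteq> 0" using E4_nth_0 by auto
  then obtain p where "G p \<noteq> 0"
    using cross_combination_nonzero[OF F, of E4_fps "fps_const (- c) * E6_fps"] unfolding G_def by blast
  then have "Q p \<noteq> 0" using GQ[of p] by auto
  ultimately have "k \<le> k + 6 - 12" by (rule min)
  then show False by simp
qed

text \<open>Let \<open>P\<close> vanish on the orbit where the Wronskian \<open>g\<close> is
  supposed to vanish. \<open>plucker\<close> expresses \<open>g\<close> times the second derivative
  by the first derivative and \<open>F\<close>; cancelling the power of \<open>P\<close> common to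
  the coefficients leaves either a combination of \<open>D k F\<close> and \<open>F\<close>
  divisible by \<open>P\<close>, or \<open>F\<close> itself divisible by \<open>P\<close>. Both
  quotients have weight below the minimum.\<close>

lemma minimal_cross_interior:
  assumes F: "F \<in> vform k" "F 1 \<noteq> 0"
    and min: "\<And>\<psi> k' j. \<psi> \<in> vform k' \<Longrightarrow> \<psi> j \<noteq> 0 \<Longrightarrow> k \<le> k'"
    and q: "norm q < 1" "q \<noteq> 0"
  shows "eval_fps (cross F (D k F)) q \<noteq> 0"
proof
  define g where "g = cross F (D k F)"
  define DF where "DF = D k F"
  define DDF where "DDF = D (k + 2) DF"
  define w where "w = 2 * k + 2 - l"
  assume "eval_fps (cross F (D k F)) q = 0"
  then have gq: "eval_fps g q = 0" by (simp add: g_def)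
  have DF: "DF \<in> vform (k + 2)" unfolding DF_def by (rule vform_D[OF F(1)])
  have DDF: "DDF \<in> vform (k + 2 + 2)" unfolding DDF_def by (rule vform_D[OF DF])
  have g: "g \<in> mform w" "g \<noteq> 0"
    using cross_mform[OF F(1) DF] cross_D_nonzero[OF F] by (simp_all add: g_def DF_def w_def algebra_simps)
  have gDDF: "g * DDF i = serre w 0 g * DF i - cross DF DDF * F i" for i
  proof -
    have "serre w 0 g = cross F DDF"
      using serre_cross[of k "k + 2" F DF] by (simp add: g_def w_def DF_def DDF_def algebra_simps)
    then have "cross DDF F = - serre w 0 g"
      using cross_swap[of DDF F] by simp
    then have "g * DDF i + cross DF DDF * F i - serre w 0 g * DF i = 0"
      using plucker[of F DF DDF i] by (simp add: g_def DF_def[symmetric])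
    then show ?thesis
      by (simp add: algebra_simps)
  qed
  have B: "cross DF DDF \<in> mform (w + 4)"
    using cross_mform[OF DF DDF] by (simp add: w_def algebra_simps)
  obtain v P where P: "P \<in> mform v" "v > 0" "fps_nth P 0 \<noteq> 0" "eval_fps P q = 0" "divides_at_zeros v P"
    and P': "\<And>z. norm z < 1 \<Longrightarrow> eval_fps P z = 0 \<Longrightarrow> eval_fps (serre v 0 P) z \<noteq> 0"
    and ab: "\<And>u a b. a \<in> mform u \<Longrightarrow> b \<in> mform (u + 2) \<Longrightarrow> eval_fps a q \<noteq> 0 \<Longrightarrow>
       \<exists>y \<alpha> \<beta>. \<alpha> \<in> mform y \<and> \<beta> \<in> mform (y + 2) \<and> y + 2 < v \<and> \<alpha> \<noteq> 0 \<and> eval_fps (\<alpha> * b + \<beta> * a) q = 0"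
    using zero_form_exists[OF q] by metis
  have P0: "P \<noteq> 0" using P(3) by auto
  note Pd = mform_disc[OF P(1)]
  obtain e h where h: "h \<in> mform (w - int e * v)" "g = P ^ e * h"
    "\<And>z. norm z < 1 \<Longrightarrow> eval_fps P z = 0 \<Longrightarrow> eval_fps h z \<noteq> 0"
    using mform_factor_out[OF P(1,2,5) g] by metis
  note hd = mform_disc[OF h(1)]
  have "e \<noteq> 0"
    using h(2,3) gq q(1) P(4) by (cases e) auto
  then obtain n where e: "e = Suc n" by (cases e) auto
  \<comment> \<open>With \<open>g = P ^ Suc n * h\<close>, differentiation costs exactly one factor:
    the derivative is \<open>P ^ n * a\<close>, and \<open>a\<close> does not vanish at the zeros of
    \<open>P\<close> because they are simple.\<close>
  define a where "a = of_nat e * serre v 0 P * h + P * serre (w - int e * v) 0 h"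
  define u where "u = w - int n * v + 2"
  have gP: "g = P ^ n * (P * h)" by (simp add: h(2) e mult_ac)
  have "serre (int e * v + (w - int e * v)) (0 + 0) (P ^ e * h) =
      of_nat e * P ^ n * serre v 0 P * h + P ^ e * serre (w - int e * v) 0 h"
    unfolding serre_mult using serre_power[of e v P] by (simp add: e)
  then have Dg: "serre w 0 g = P ^ n * a"
    by (simp add: h(2) a_def e algebra_simps)
  have a: "a \<in> mform u"
  proof -
    have "fps_const (of_nat e) * (serre v 0 P * h) \<in> mform ((v + 2) + (w - int e * v))"
      by (intro mform_cmult mform_mult mform_serre P h)
    moreover have "P * serre (w - int e * v) 0 h \<in> mform (v + (w - int e * v + 2))"
      by (intro mform_mult mform_serre P h)
    moreover have "(v + 2) + (w - int e * v) = u" "v + (w - int e * v + 2) = u"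
      by (simp_all add: u_def e algebra_simps)
    moreover have "a = fps_const (of_nat e) * (serre v 0 P * h) + P * serre (w - int e * v) 0 h"
      by (simp only: a_def fps_of_nat mult.assoc)
    ultimately show ?thesis
      by (simp only: mform_add)
  qed
  have az: "eval_fps a z \<noteq> 0" if "norm z < 1" "eval_fps P z = 0" for z
  proof -
    have "a = fps_const (of_nat e) * serre v 0 P * h + P * serre (w - int e * v) 0 h"
      by (simp add: a_def fps_of_nat)
    then have "eval_fps a z = of_nat e * eval_fps (serre v 0 P) z * eval_fps h z"
      using that Pd hd by (simp add: disc_eval disc_intros disc_serre)
    then show ?thesis using P'[OF that] h(3)[OF that] e by (simp del: of_nat_Suc)
  qed
  have aDF: "P ^ n * (P * h * DDF i) = P ^ n * (a * DF i) - cross DF DDF * F i" for i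
    using gDDF[of i] unfolding Dg by (simp add: gP mult.assoc)
  \<comment> \<open>Either the third coefficient of the relation contains the full power
    \<open>P ^ n\<close> as well, or it contains a smaller exact power.\<close>
  consider b where "b \<in> mform (u + 2)" "cross DF DDF = P ^ n * b"
    | f b where "f < n" "b \<in> mform (w + 4 - int f * v)" "cross DF DDF = P ^ f * b"
       "\<And>z. norm z < 1 \<Longrightarrow> eval_fps P z = 0 \<Longrightarrow> eval_fps b z \<noteq> 0"
  proof (cases "cross DF DDF = 0")
    case True
    then show ?thesis using that(1)[of 0] mform_0 by simp
  next
    case False
    obtain f b where b: "b \<in> mform (w + 4 - int f * v)" "cross DF DDF = P ^ f * b"
       "\<And>z. norm z < 1 \<Longrightarrow> eval_fps P z = 0 \<Longrightarrow> eval_fps b z \<noteq> 0"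
      using mform_factor_out[OF P(1,2,5) B False] by metis
    show ?thesis
    proof (cases "f < n")
      case False
      have "P ^ (f - n) * b \<in> mform (int (f - n) * v + (w + 4 - int f * v))"
        by (intro mform_mult mform_power P b)
      then have "P ^ (f - n) * b \<in> mform (u + 2)"
        using False by (simp add: u_def of_nat_diff algebra_simps)
      moreover have "cross DF DDF = P ^ n * (P ^ (f - n) * b)"
        using False by (simp add: b(2) flip: mult.assoc power_add)
      ultimately show ?thesis by (rule that(1))
    qed (use that(2) b in blast)
  qed
  then show False
  proof cases
    case (1 b)
    have rel: "P * h * DDF i = a * DF i - b * F i" for i
    proof -
      have "P ^ n * (P * h * DDF i) = P ^ n * (a * DF i - b * F i)"
        using aDF[of i] by (simp add: 1(2) algebra_simps)
      then show ?thesis using P0 by simp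
    qed
    obtain y \<alpha> \<beta> where y: "\<alpha> \<in> mform y" "\<beta> \<in> mform (y + 2)" "y + 2 < v" "\<alpha> \<noteq> 0"
      "eval_fps (\<alpha> * b + \<beta> * a) q = 0"
      using ab[OF a 1(1) az[OF q(1) P(4)]] by blast
    have "\<alpha> * b + \<beta> * a \<in> mform (y + (u + 2))"
      using mform_mult[OF y(1) 1(1)] mform_mult[OF y(2) a] by (intro mform_add) (simp_all add: algebra_simps)
    then obtain c where c: "c \<in> mform (y + (u + 2) - v)" "\<alpha> * b + \<beta> * a = P * c"
      using P(5) y(5) q(1) P(4) unfolding divides_at_zeros_def by blast
    define G where "G i = \<alpha> * DF i + \<beta> * F i" for i
    \<comment> \<open>The relation turns the \<alpha>-part into a multiple of \<open>P\<close>, and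
      \<alpha>, \<beta> were chosen to do the same for the coefficient of \<open>F i\<close>. As
      \<open>a\<close> is nonzero at the zeros of \<open>P\<close>, the factor \<open>P\<close>
      belongs to \<open>G i\<close>.\<close>
    have "G i * a = P * (\<alpha> * h * DDF i + c * F i)" for i
    proof -
      have "G i * a = \<alpha> * (a * DF i - b * F i) + (\<alpha> * b + \<beta> * a) * F i"
        by (simp add: G_def algebra_simps)
      then show ?thesis
        unfolding rel[symmetric] c(2) by (simp add: algebra_simps)
    qed
    moreover have "G i \<in> disc" "\<alpha> * h * DDF i + c * F i \<in> disc" for i
      unfolding G_def by (intro disc_intros vform_disc[OF DF] vform_disc[OF DDF] vform_disc[OF F(1)]
        mform_disc[OF y(1)] mform_disc[OF y(2)] mform_disc[OF c(1)] hd)+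
    ultimately have "\<exists>Q. Q \<in> disc \<and> G i = P * Q" for i
      using disc_divide[OF _ Pd mform_disc[OF a] _ _ az] by metis
    then obtain Q where Q: "\<And>i. Q i \<in> disc" "\<And>i. G i = P * Q i" by metis
    have "G \<in> vform (y + 2 + k)"
      unfolding G_def using vform_mult[OF y(1) DF] vform_mult[OF y(2) F(1)]
      by (intro vform_add) (simp_all add: algebra_simps)
    then have "Q \<in> vform (y + 2 + k - v)"
      using Q by (intro vform_divide[OF _ P(1) P0]) (simp_all flip: Q(2))
    moreover obtain i where "G i \<noteq> 0"
      using cross_combination_nonzero[OF F y(4)] unfolding G_def DF_def by blast
    then have "Q i \<noteq> 0" using Q(2)[of i] by auto
    ultimately have "k \<le> y + 2 + k - v" by (rule min)
    then show False using y(3) by simp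
  next
    case (2 f b)
    define d where "d = n - f - 1"
    have n: "n = f + Suc d" using 2(1) by (simp add: d_def)
    \<comment> \<open>Here \<open>P\<close> still divides the two other terms after cancelling
      \<open>P ^ f\<close>, while \<open>b\<close> is nonzero at the zeros of
      \<open>P\<close>.\<close>
    have "F i * b = P * (P ^ d * (a * DF i - P * h * DDF i))" for i
    proof -
      have "P ^ f * (F i * b) = P ^ f * (P * (P ^ d * (a * DF i - P * h * DDF i)))"
        using aDF[of i] by (simp add: 2(3) n power_add algebra_simps)
      then show ?thesis using P0 by simp
    qed
    moreover have "P ^ d * (a * DF i - P * h * DDF i) \<in> disc" for i
      by (intro disc_intros vform_disc[OF DF] vform_disc[OF DDF] mform_disc[OF a] hd Pd)
    ultimately have "\<exists>Q. Q \<in> disc \<and> F i = P * Q" for i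
      using disc_divide[OF vform_disc[OF F(1)] Pd mform_disc[OF 2(2)] _ _ 2(4)] by metis
    then obtain Q where Q: "\<And>i. Q i \<in> disc" "\<And>i. F i = P * Q i" by metis
    have "(\<lambda>i. P * Q i) = F" using Q(2) by auto
    then have "Q \<in> vform (k - v)"
      using Q(1) F(1) by (intro vform_divide[OF _ P(1) P0]) simp_all
    moreover have "Q 1 \<noteq> 0" using F(2) Q(2)[of 1] by auto
    ultimately have "k \<le> k - v" by (rule min)
    then show False using P(2) by simp
  qed
qed

text \<open>A Wronskian without zeros in the disc has an inverse that is again a form. Neither
  weight can be negative, so both are 0 and the Wronskian is constant; this fixes
  \<open>2 * k0 + 2 = l\<close>. Its derivative vanishes, and the remaining coefficient of the
  relation has weight 4, a multiple of E4.\<close>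

theorem minimal_form_equation:
  assumes "\<phi> \<in> vform k" "\<phi> i \<noteq> 0"
  obtains F k0 c \<kappa> where "F \<in> vform k0" "2 * k0 + 2 = l" "cross F (D k0 F) = fps_const c" "c \<noteq> 0"
    "\<And>i. fps_nth (F i) 0 \<noteq> 0" "\<And>i. D (k0 + 2) (D k0 F) i = - (fps_const \<kappa> * E4_fps * F i)"
proof -
  obtain F k0 where F: "F \<in> vform k0" "F 1 \<noteq> 0"
    "\<And>\<psi> k' j. \<psi> \<in> vform k' \<Longrightarrow> \<psi> j \<noteq> 0 \<Longrightarrow> k0 \<le> k'"
    using minimal_vform_exists[OF assms] by metis
  have F0: "fps_nth (F i) 0 \<noteq> 0" for i
    by (rule minimal_cross_cusp[OF F(1,2)]) (rule F(3))
  define DF where "DF = D k0 F"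
  define DDF where "DDF = D (k0 + 2) DF"
  define g where "g = cross F DF"
  define w where "w = 2 * k0 + 2 - l"
  have DF: "DF \<in> vform (k0 + 2)" unfolding DF_def by (rule vform_D[OF F(1)])
  have DDF: "DDF \<in> vform (k0 + 2 + 2)" unfolding DDF_def by (rule vform_D[OF DF])
  have g: "g \<in> mform w"
    using cross_mform[OF F(1) DF] by (simp add: g_def w_def algebra_simps)
  have nz: "eval_fps g q \<noteq> 0" if "norm q < 1" for q
  proof (cases "q = 0")
    case True
    have "fps_nth g 0 = (m 2 - m 1) * (fps_nth (F 1) 0 * fps_nth (F 2) 0)"
      by (simp add: g_def cross_def DF_def D_def serre_def qderiv_nth E2_nth_0 delta_power_nth_0 algebra_simps)
    moreover have "m 2 - m 1 \<noteq> 0"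
      using exponent_diff by auto
    ultimately show ?thesis using True F0 by (simp add: eval_fps_at_0)
  next
    case False
    then show ?thesis
      unfolding g_def DF_def by (intro minimal_cross_interior[OF F(1,2) _ that False]) (rule F(3))
  qed
  obtain h where h: "h \<in> disc" "1 = g * h"
    by (rule disc_divide[OF disc_1 mform_disc[OF g] mform_disc[OF g] disc_1]) (use nz in auto)
  have g0: "g \<noteq> 0" and h0: "h \<noteq> 0" using h(2) by auto
  have "h \<in> mform (0 - w)"
    by (rule mform_divide[OF _ g g0 h(1)]) (simp flip: h(2) add: mform_1)
  then have "w = 0"
    using mform_negative[of h "- w"] mform_negative[OF g] g0 h0 by force
  define c where "c = fps_nth g 0"
  have gc: "g = fps_const c"
    using mform_weight_0 g \<open>w = 0\<close> unfolding c_def by simp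
  have c: "c \<noteq> 0" using g0 gc by auto
  have "cross DF DDF \<in> mform 4"
  proof -
    have wt: "k0 + 2 + (k0 + 2 + 2) - l = 4" using \<open>w = 0\<close> by (simp add: w_def)
    show ?thesis using cross_mform[OF DF DDF] unfolding wt .
  qed
  then have B: "cross DF DDF = fps_const (fps_nth (cross DF DDF) 0) * E4_fps"
    by (rule mform_small) (auto simp: mform_E4 E4_nth_0)
  define \<kappa> where "\<kappa> = fps_nth (cross DF DDF) 0 / c"
  have "DDF i = - (fps_const \<kappa> * E4_fps * F i)" for i
  proof -
    have "cross F DDF = serre (k0 + (k0 + 2) - l) 0 g"
      using serre_cross[of k0 "k0 + 2" F DF] by (simp add: g_def DF_def DDF_def)
    also have "\<dots> = 0"
      using \<open>w = 0\<close> by (simp add: w_def gc serre_def)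
    finally have "cross F DDF = 0" .
    then have "g * DDF i = - (cross DF DDF * F i)"
      using plucker[of F DF DDF i] cross_swap[of F DDF] by (simp add: g_def algebra_simps eq_neg_iff_add_eq_0)
    also have "\<dots> = fps_const c * - (fps_const \<kappa> * E4_fps * F i)"
      using c by (subst B) (simp add: \<kappa>_def mult.assoc flip: fps_const_mult mult.assoc)
    finally have "fps_const c * DDF i = fps_const c * - (fps_const \<kappa> * E4_fps * F i)"
      by (simp only: gc)
    moreover have "fps_const c \<noteq> 0" using c by simp
    ultimately show ?thesis using mult_left_cancel by blast
  qed
  then have "D (k0 + 2) (D k0 F) i = - (fps_const \<kappa> * E4_fps * F i)" for i
    by (simp only: DF_def DDF_def)
  moreover have "2 * k0 + 2 = l" using \<open>w = 0\<close> by (simp add: w_def)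
  ultimately show ?thesis
    using that[of F k0 c \<kappa>] F(1) c F0 gc unfolding g_def DF_def by blast
qed

text \<open>Cramer's rule for the system with rows \<open>F\<close> and \<open>D k0 F\<close>, whose
  determinant is a nonzero constant.\<close>

lemma vform_combination:
  assumes F: "F \<in> vform k0" "2 * k0 + 2 = l" "cross F (D k0 F) = fps_const c" "c \<noteq> 0"
    and \<phi>: "\<phi> \<in> vform k"
  obtains \<alpha> \<beta> where "\<alpha> \<in> mform (k - k0)" "\<beta> \<in> mform (k - k0 - 2)" "\<And>i. \<phi> i = \<alpha> * F i + \<beta> * D k0 F i"
proof
  note DF = vform_D[OF F(1)]
  have w: "k + (k0 + 2) - l = k - k0" "k0 + k - l = k - k0 - 2"
    using F(2) by simp_all
  show "fps_const (1 / c) * cross \<phi> (D k0 F) \<in> mform (k - k0)"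
    using mform_cmult[OF cross_mform[OF \<phi> DF]] unfolding w by simp
  show "fps_const (1 / c) * cross F \<phi> \<in> mform (k - k0 - 2)"
    using mform_cmult[OF cross_mform[OF F(1) \<phi>]] unfolding w by simp
  fix i
  have "cross F (D k0 F) * \<phi> i = cross \<phi> (D k0 F) * F i + cross F \<phi> * D k0 F i"
  proof -
    have "cross F (D k0 F) * \<phi> i - cross \<phi> (D k0 F) * F i - cross F \<phi> * D k0 F i = 0"
      using plucker[of F "D k0 F" \<phi> i] cross_swap[of "D k0 F" \<phi>] cross_swap[of \<phi> F] by simp
    then show ?thesis by (simp add: algebra_simps)
  qed
  then have "fps_const (1 / c) * (fps_const c * \<phi> i) = fps_const (1 / c) * (cross \<phi> (D k0 F) * F i + cross F \<phi> * D k0 F i)"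
    by (simp only: F(3))
  moreover have "fps_const (1 / c) * (fps_const c * \<phi> i) = \<phi> i"
    using F(4) by (simp flip: mult.assoc)
  ultimately show "\<phi> i = fps_const (1 / c) * cross \<phi> (D k0 F) * F i + fps_const (1 / c) * cross F \<phi> * D k0 F i"
    by (simp add: algebra_simps)
qed

end

subsection \<open>Integral and bounded power series\<close>

definition of_int_fps :: "int fps \<Rightarrow> complex fps" where
  "of_int_fps A = Abs_fps (\<lambda>n. of_int (fps_nth A n))"

lemma of_int_fps_nth [simp]: "fps_nth (of_int_fps A) n = of_int (fps_nth A n)"
  by (simp add: of_int_fps_def)

lemma of_int_fps_add: "of_int_fps (A + B) = of_int_fps A + of_int_fps B"
  and of_int_fps_diff: "of_int_fps (A - B) = of_int_fps A - of_int_fps B"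
  and of_int_fps_uminus: "of_int_fps (- A) = - of_int_fps A"
  and of_int_fps_mult: "of_int_fps (A * B) = of_int_fps A * of_int_fps B"
  and of_int_fps_const: "of_int_fps (fps_const c) = fps_const (of_int c)"
  and of_int_fps_qderiv: "of_int_fps (qderiv A) = qderiv (of_int_fps A)"
  and of_int_fps_1: "of_int_fps 1 = 1"
  by (simp_all add: fps_eq_iff fps_mult_nth qderiv_nth)

lemma of_int_fps_inject: "of_int_fps A = of_int_fps B \<longleftrightarrow> A = B"
  by (simp add: fps_eq_iff)

text \<open>Gauss's lemma: at the sum of the least indices with coefficients prime to
  \<open>p\<close>, exactly one product in the convolution is prime to \<open>p\<close>.\<close>

lemma prime_gauss_fps:
  fixes V H :: "int fps"
  assumes p: "Factorial_Ring.prime p" and V: "\<not> p dvd fps_nth V i0" and VH: "\<And>n. p dvd fps_nth (V * H) n"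
  shows "p dvd fps_nth H n"
proof (rule ccontr)
  assume H: "\<not> p dvd fps_nth H n"
  define i where "i = (LEAST i. \<not> p dvd fps_nth V i)"
  define j where "j = (LEAST j. \<not> p dvd fps_nth H j)"
  have i: "\<not> p dvd fps_nth V i" "\<And>k. k < i \<Longrightarrow> p dvd fps_nth V k"
    unfolding i_def using LeastI[of "\<lambda>i. \<not> p dvd fps_nth V i", OF V] not_less_Least by blast+
  have j: "\<not> p dvd fps_nth H j" "\<And>k. k < j \<Longrightarrow> p dvd fps_nth H k"
    unfolding j_def using LeastI[of "\<lambda>i. \<not> p dvd fps_nth H i", OF H] not_less_Least by blast+
  have "fps_nth (V * H) (i + j) = (\<Sum>k\<in>{0..i+j}. fps_nth V k * fps_nth H (i + j - k))"
    by (simp add: fps_mult_nth)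
  also have "\<dots> = fps_nth V i * fps_nth H j + (\<Sum>k\<in>{0..i+j}-{i}. fps_nth V k * fps_nth H (i + j - k))"
    by (subst sum.remove[of _ i]) auto
  finally have eq: "fps_nth V i * fps_nth H j =
     fps_nth (V * H) (i + j) - (\<Sum>k\<in>{0..i+j}-{i}. fps_nth V k * fps_nth H (i + j - k))" by simp
  have "p dvd (\<Sum>k\<in>{0..i+j}-{i}. fps_nth V k * fps_nth H (i + j - k))"
  proof (rule dvd_sum)
    fix k assume "k \<in> {0..i+j} - {i}"
    then consider "k < i" | "i + j - k < j" by force
    then show "p dvd fps_nth V k * fps_nth H (i + j - k)"
      using i(2) j(2) by cases (auto intro: dvd_mult dvd_mult2)
  qed
  then have "p dvd fps_nth V i * fps_nth H j"
    unfolding eq using VH by (intro dvd_diff) auto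
  then show False
    using i(1) j(1) p by (simp add: prime_dvd_mult_iff)
qed

lemma prime_power_gauss_fps:
  fixes V H :: "int fps"
  assumes p: "Factorial_Ring.prime p" and V: "\<not> p dvd fps_nth V i0" and VH: "\<And>n. p ^ v dvd fps_nth (V * H) n"
  shows "p ^ v dvd fps_nth H n"
  using VH
proof (induction v arbitrary: n)
  case (Suc v)
  have p0: "p \<noteq> 0" using p by auto
  have "p ^ v dvd fps_nth (V * H) n" for n
    using Suc.prems[of n] dvd_trans[OF le_imp_power_dvd[of v "Suc v" p]] by auto
  then have "p ^ v dvd fps_nth H n" for n using Suc.IH by blast
  define G where "G = Abs_fps (\<lambda>n. fps_nth H n div p ^ v)"
  have HG: "H = fps_const (p ^ v) * G"
    using \<open>\<And>n. p ^ v dvd fps_nth H n\<close> by (simp add: fps_eq_iff G_def)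
  have VG: "V * H = fps_const (p ^ v) * (V * G)" by (simp add: HG mult_ac)
  then have "p ^ v * p dvd p ^ v * fps_nth (V * G) n" for n
    using Suc.prems[of n] unfolding VG by (simp add: mult.commute)
  then have "p dvd fps_nth (V * G) n" for n
    using p0 by simp
  then have "p dvd fps_nth G n" by (rule prime_gauss_fps[OF p V])
  then show ?case by (simp add: HG mult.commute mult_dvd_mono)
qed simp

section \<open>Series with bounded denominators\<close>

definition bounded_fps :: "complex fps \<Rightarrow> bool" where
  "bounded_fps A \<longleftrightarrow> (\<exists>B::int. B \<noteq> 0 \<and> (\<forall>n. of_int B * fps_nth A n \<in> \<int>))"

definition rational_fps :: "complex fps \<Rightarrow> bool" where
  "rational_fps A \<longleftrightarrow> (\<forall>n. fps_nth A n \<in> \<rat>)"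

lemma bounded_fps_iff: "bounded_fps A \<longleftrightarrow> (\<exists>B C. B \<noteq> 0 \<and> fps_const (of_int B) * A = of_int_fps C)"
proof
  assume "bounded_fps A"
  then obtain B :: int where B: "B \<noteq> 0" "\<And>n. of_int B * fps_nth A n \<in> \<int>"
    unfolding bounded_fps_def by blast
  then have "\<exists>c. of_int B * fps_nth A n = of_int c" for n
    by (meson Ints_cases)
  then obtain c where "\<And>n. of_int B * fps_nth A n = of_int (c n)" by metis
  then have "fps_const (of_int B) * A = of_int_fps (Abs_fps c)"
    by (simp add: fps_eq_iff)
  then show "\<exists>B C. B \<noteq> 0 \<and> fps_const (of_int B) * A = of_int_fps C" using B(1) by blast
next
  assume "\<exists>B C. B \<noteq> 0 \<and> fps_const (of_int B) * A = of_int_fps C"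
  then obtain B C where B: "B \<noteq> 0" "fps_const (of_int B) * A = of_int_fps C" by blast
  have "of_int B * fps_nth A n = of_int (fps_nth C n)" for n
    using arg_cong[OF B(2), of "\<lambda>Z. fps_nth Z n"] by simp
  then show "bounded_fps A" unfolding bounded_fps_def using B(1) by (metis Ints_of_int)
qed

lemma bounded_of_int_fps: "bounded_fps (of_int_fps A)"
  unfolding bounded_fps_def by (rule exI[of _ 1]) simp

lemma bounded_fps_add:
  assumes "bounded_fps A" "bounded_fps B" shows "bounded_fps (A + B)"
proof -
  obtain a C b E where ab: "a \<noteq> 0" "fps_const (of_int a) * A = of_int_fps C"
    "b \<noteq> 0" "fps_const (of_int b) * B = of_int_fps E"
    using assms unfolding bounded_fps_iff by blast
  have "fps_const (of_int (a * b)) * (A + B) =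
      fps_const (of_int b) * (fps_const (of_int a) * A) + fps_const (of_int a) * (fps_const (of_int b) * B)"
    by (simp add: algebra_simps flip: fps_const_mult)
  also have "\<dots> = of_int_fps (fps_const b * C + fps_const a * E)"
    unfolding ab by (simp add: of_int_fps_add of_int_fps_mult of_int_fps_const)
  finally show ?thesis
    unfolding bounded_fps_iff using ab by (intro exI[of _ "a * b"]) auto
qed

lemma bounded_fps_mult:
  assumes "bounded_fps A" "bounded_fps B" shows "bounded_fps (A * B)"
proof -
  obtain a C b E where ab: "a \<noteq> 0" "fps_const (of_int a) * A = of_int_fps C"
    "b \<noteq> 0" "fps_const (of_int b) * B = of_int_fps E"
    using assms unfolding bounded_fps_iff by blast
  have "fps_const (of_int (a * b)) * (A * B) = (fps_const (of_int a) * A) * (fps_const (of_int b) * B)"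
    by (simp add: algebra_simps flip: fps_const_mult)
  also have "\<dots> = of_int_fps (C * E)"
    unfolding ab by (simp add: of_int_fps_mult)
  finally show ?thesis
    unfolding bounded_fps_iff using ab by (intro exI[of _ "a * b"]) auto
qed

lemma bounded_fps_const:
  assumes "c \<in> \<rat>" shows "bounded_fps (fps_const c)"
proof -
  obtain a b :: int where ab: "b \<noteq> 0" "c = of_int a / of_int b"
    using assms by (metis Rats_cases' less_irrefl)
  then have "fps_const (of_int b) * fps_const c = of_int_fps (fps_const a)"
    by (simp add: of_int_fps_const)
  then show ?thesis unfolding bounded_fps_iff using ab(1) by blast
qed

lemma bounded_fps_diff: "bounded_fps A \<Longrightarrow> bounded_fps B \<Longrightarrow> bounded_fps (A - B)"
  using bounded_fps_add[of A "fps_const (- 1) * B"] bounded_fps_mult[of "fps_const (- 1)" B] bounded_fps_const[of "- 1"]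
  by (simp flip: fps_const_neg)

lemma bounded_fps_qderiv:
  assumes "bounded_fps A" shows "bounded_fps (qderiv A)"
proof -
  obtain a C where a: "a \<noteq> 0" "fps_const (of_int a) * A = of_int_fps C"
    using assms unfolding bounded_fps_iff by blast
  have "fps_const (of_int a) * qderiv A = qderiv (fps_const (of_int a) * A)"
    by (simp add: qderiv_mult)
  then show ?thesis
    unfolding bounded_fps_iff using a by (metis of_int_fps_qderiv)
qed

lemma bounded_fps_power: "bounded_fps A \<Longrightarrow> bounded_fps (A ^ n)"
  by (induction n) (auto intro: bounded_fps_mult bounded_of_int_fps[of 1, unfolded of_int_fps_1])

lemma bounded_imp_rational: 
  assumes "bounded_fps A" shows "rational_fps A"
  unfolding rational_fps_def
proof
  fix n
  obtain B :: int where B: "B \<noteq> 0" "of_int B * fps_nth A n \<in> \<int>"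
    using assms unfolding bounded_fps_def by blast
  then obtain c where "of_int B * fps_nth A n = of_int c" by (auto elim: Ints_cases)
  then have "fps_nth A n = of_int c / of_int B" using B(1) by (simp add: field_simps)
  then show "fps_nth A n \<in> \<rat>" by simp
qed

definition sigma_int :: "int fps" where
  "sigma_int = Abs_fps (\<lambda>n. int (divisor_sum n))"

lemma sigma_int: "sigma_fps = of_int_fps sigma_int"
  by (simp add: fps_eq_iff sigma_fps_def sigma_int_def)

text \<open>This is (E4 - 1)/48, computed from E2 = 1 - 24 s. Since 240 = 48 * 5, its first
  coefficient is the 5 that enters the bound 60.\<close>

definition E4_tail :: "int fps" where
  "E4_tail = - sigma_int + 12 * sigma_int\<^sup>2 + 6 * qderiv sigma_int"

lemma E4_tail_nth_1: "fps_nth E4_tail (Suc 0) = 5"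
  by (simp add: E4_tail_def sigma_int_def divisor_sum_1 qderiv_nth power2_eq_square
      fps_mult_nth_1[simplified] numeral_fps_const)

lemma of_int_fps_numeral: "of_int_fps (numeral k) = numeral k"
  by (simp add: numeral_fps_const of_int_fps_const)

lemmas of_int_fps_simps = of_int_fps_add of_int_fps_diff of_int_fps_uminus of_int_fps_mult of_int_fps_const
  of_int_fps_qderiv of_int_fps_1 of_int_fps_numeral

lemma E4_eq: "E4_fps = 1 + 48 * of_int_fps E4_tail"
  by (simp add: E4_fps_def E2_fps_def E4_tail_def of_int_fps_simps sigma_int power2_eq_square
      qderiv_diff qderiv_mult algebra_simps)

lemma bounded_E2: "bounded_fps E2_fps"
proof -
  have eq: "E2_fps = of_int_fps (1 - 24 * sigma_int)"
    by (simp add: E2_fps_def sigma_int of_int_fps_simps)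
  show ?thesis unfolding eq by (rule bounded_of_int_fps)
qed

lemma bounded_E4: "bounded_fps E4_fps"
proof -
  have eq: "E4_fps = of_int_fps (1 + 48 * E4_tail)"
    by (simp add: E4_eq of_int_fps_simps)
  show ?thesis unfolding eq by (rule bounded_of_int_fps)
qed

lemma bounded_fps_serre:
  assumes "bounded_fps A" "m \<in> \<rat>" shows "bounded_fps (serre w m A)"
  unfolding serre_def using assms
  by (intro bounded_fps_add bounded_fps_diff bounded_fps_mult bounded_fps_qderiv bounded_fps_const bounded_E2) auto

lemma bounded_E6: "bounded_fps E6_fps"
  unfolding E6_fps_def numeral_fps_const
  using bounded_fps_mult[OF bounded_fps_const[of "- 3"] bounded_fps_serre[OF bounded_E4, of 0 4]]
  by (simp flip: fps_const_neg)

text \<open>Only boundedness matters, so the factor 1728 may be divided out and no product expansion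
  is required.\<close>

lemma bounded_delta: "bounded_fps delta_fps"
proof -
  have "bounded_fps (fps_const (1 / 1728) * (E4_fps ^ 3 - E6_fps\<^sup>2))"
    by (intro bounded_fps_mult bounded_fps_diff bounded_fps_power bounded_E4 bounded_E6 bounded_fps_const) auto
  moreover have "fps_const (1 / 1728) * (fps_const 1728 * delta_fps) = delta_fps"
    by (simp flip: mult.assoc)
  ultimately show ?thesis by (simp only: delta_eq)
qed

text \<open>1 is extended to a basis of the complex numbers over the rationals. The functional makes
  complex coefficients rational while fixing those that already are.\<close>

lemma rational_functional_exists:
  obtains f :: "complex \<Rightarrow> rat" where "f 1 = 1" "\<And>x y. f (x + y) = f x + f y" "\<And>r x. f (of_rat r * x) = r * f x"
proof -
  interpret vs: vector_space_pair "\<lambda>(r::rat) (z::complex). of_rat r * z" "(*) :: rat \<Rightarrow> rat \<Rightarrow> rat"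
    by unfold_locales (auto simp: algebra_simps of_rat_add of_rat_mult)
  have "vs.vs1.independent {1}"
    by (subst vs.vs1.dependent_single) simp
  from vs.linear_independent_extend[OF this, of "\<lambda>_. 1"]
  obtain f where f: "Vector_Spaces.linear (\<lambda>(r::rat) (z::complex). of_rat r * z) (*) f" "f 1 = 1"
    by auto
  interpret f: Vector_Spaces.linear "\<lambda>(r::rat) (z::complex). of_rat r * z" "(*) :: rat \<Rightarrow> rat \<Rightarrow> rat" f
    by (rule f(1))
  show ?thesis
    using that[of f] f(2) f.add f.scale by blast
qed

context
  fixes f :: "complex \<Rightarrow> rat"
  assumes f1: "f 1 = 1" and fadd: "\<And>x y. f (x + y) = f x + f y" and fscale: "\<And>r x. f (of_rat r * x) = r * f x"
begin

definition rational_part :: "complex fps \<Rightarrow> complex fps" where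
  "rational_part A = Abs_fps (\<lambda>n. of_rat (f (fps_nth A n)))"

lemma rational_part_add: "rational_part (A + B) = rational_part A + rational_part B"
  by (simp add: fps_eq_iff rational_part_def fadd of_rat_add)

lemma f_sum: "f (sum g S) = (\<Sum>x\<in>S. f (g x))" if "finite S"
  using that
proof (induction S rule: finite_induct)
  case empty
  show ?case using fscale[of 0 0] by simp
qed (simp add: fadd)

lemma f_mult_rational: "x \<in> \<rat> \<Longrightarrow> of_rat (f (y * x)) = of_rat (f y) * x"
proof -
  assume "x \<in> \<rat>"
  then obtain r where "x = of_rat r" by (auto elim: Rats_cases)
  then show ?thesis using fscale[of r y] by (simp add: mult.commute of_rat_mult)
qed

lemma rational_part_mult: "rational_fps E \<Longrightarrow> rational_part (A * E) = rational_part A * E"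
  by (simp add: fps_eq_iff rational_part_def fps_mult_nth f_sum of_rat_sum f_mult_rational rational_fps_def)

lemma rational_part_rational: "rational_fps E \<Longrightarrow> rational_part E = E"
  using f_mult_rational[of _ 1] f1 by (simp add: rational_part_def fps_eq_iff rational_fps_def)

lemma rational_part_const: "rational_part (fps_const c) = fps_const (of_rat (f c))"
  using fscale[of 0 0] by (simp add: rational_part_def fps_eq_iff)

text \<open>Reduction by the discriminant writes a form through monomials in E4, E6 and the
  discriminant, which have bounded denominators; the functional acts on the scalar factors
  only.\<close>

lemma rational_part_mform:
  assumes "A \<in> mform w"
  shows "rational_part A \<in> mform w \<and> bounded_fps (rational_part A)"
  using assms
proof (induction "nat w" arbitrary: w A rule: less_induct)
  case (less w A)
  have zero: "rational_part 0 = 0"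
    using rational_part_const[of 0] fscale[of 0 0] by simp
  show ?case
  proof (cases "even w \<and> w \<ge> 0 \<and> w \<noteq> 2")
    case False
    then have "A = 0"
      using less.prems mform_odd mform_negative mform_2 by (metis not_le)
    then show ?thesis
      using zero mform_0 bounded_fps_const[of 0] by simp
  next
    case True
    then obtain a b where "4 * int a + 6 * int b = w"
      using weight_decomposition by metis
    note e = mform_monomial[OF this]
    let ?e = "E4_fps ^ a * E6_fps ^ b"
    have be: "bounded_fps ?e"
      by (intro bounded_fps_mult bounded_fps_power bounded_E4 bounded_E6)
    obtain c B where B: "B \<in> mform (w - 12)" "A = fps_const c * ?e + delta_fps * B"
      using mform_reduce[OF less.prems e(1)] e(2) by (metis zero_neq_one)
    have rB: "rational_part B \<in> mform (w - 12) \<and> bounded_fps (rational_part B)"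
    proof (cases "w = 0")
      case True
      then have "B = 0" using mform_negative[OF B(1)] by simp
      then show ?thesis using zero mform_0 bounded_fps_const[of 0] by simp
    next
      case False
      then show ?thesis using less.hyps[OF _ B(1)] \<open>even w \<and> w \<ge> 0 \<and> w \<noteq> 2\<close> by auto
    qed
    have "rational_part A = fps_const (of_rat (f c)) * ?e + delta_fps * rational_part B"
      unfolding B(2) rational_part_add rational_part_mult[OF bounded_imp_rational[OF be]] rational_part_const
      using rational_part_mult[OF bounded_imp_rational[OF bounded_delta], of B] by (simp add: mult.commute)
    moreover have "fps_const (of_rat (f c)) * ?e + delta_fps * rational_part B \<in> mform w"
      using mform_mult[OF mform_delta, of "rational_part B" "w - 12"] rB by (intro mform_add mform_cmult e) simp
    moreover have "bounded_fps (fps_const (of_rat (f c)) * ?e + delta_fps * rational_part B)"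
      using rB by (intro bounded_fps_add bounded_fps_mult[OF _ be] bounded_fps_mult[OF bounded_delta] bounded_fps_const) auto
    ultimately show ?thesis by simp
  qed
qed

end

subsection \<open>The arithmetic of the second order equation\<close>

lemma serre_nth:
  "fps_nth (serre w m A) n = (of_nat n + m) * fps_nth A n - of_int w / 12 * fps_nth (E2_fps * A) n"
  by (simp add: serre_def qderiv_nth mult.assoc distrib_right)

lemma serre_nth_lowest:
  assumes "\<And>j. j < n \<Longrightarrow> fps_nth A j = 0"
  shows "j < n \<Longrightarrow> fps_nth (serre w m A) j = 0"
    and "fps_nth (serre w m A) n = (of_nat n + m - of_int w / 12) * fps_nth A n"
proof -
  have "fps_nth (E2_fps * A) j = 0" if "j < n" for j
    using that assms by (auto simp: fps_mult_nth intro!: sum.neutral)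
  then show "j < n \<Longrightarrow> fps_nth (serre w m A) j = 0"
    using assms by (simp add: serre_nth)
  have "fps_nth (E2_fps * A) (0 + n) = fps_nth E2_fps 0 * fps_nth A n"
    by (rule fps_mult_nth_lowest) (use assms in auto)
  then show "fps_nth (serre w m A) n = (of_nat n + m - of_int w / 12) * fps_nth A n"
    by (simp add: serre_nth E2_nth_0 left_diff_distrib)
qed

lemma rational_fps_mult:
  assumes "rational_fps A" "rational_fps B" shows "rational_fps (A * B)"
proof -
  have "sum g S \<in> \<rat>" if "\<And>x. x \<in> S \<Longrightarrow> g x \<in> \<rat>" for g :: "nat \<Rightarrow> complex" and S
    using that by (induction S rule: infinite_finite_induct) auto
  then show ?thesis
    using assms unfolding rational_fps_def fps_mult_nth by simp
qed

lemma rational_fps_serre: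
  assumes "rational_fps A" "m \<in> \<rat>" shows "rational_fps (serre w m A)"
  using assms rational_fps_mult[OF bounded_imp_rational[OF bounded_E2] assms(1)]
  by (simp add: rational_fps_def serre_nth)

text \<open>Frobenius' recursion: in degree n the equation contains the n-th coefficient with the
  factor \<open>I n\<close>, and otherwise only earlier coefficients. The assumption
  \<open>nres\<close> excludes resonance.\<close>

lemma solution_rational:
  assumes eq: "serre (k + 2) m (serre k m A) = - (fps_const \<kappa> * E4_fps * A)"
    and A0: "fps_nth A 0 = 1" and m: "m \<in> \<rat>"
    and nres: "\<And>n. n > 0 \<Longrightarrow> of_nat n + 2 * m - of_int (2 * k + 2) / 12 \<noteq> 0"
  shows "rational_fps A"
proof -
  define I where "I n = (of_nat n + m - of_int (k + 2) / 12) * (of_nat n + m - of_int k / 12) + \<kappa>" for n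
  define L where "L B = serre (k + 2) m (serre k m B) + fps_const \<kappa> * E4_fps * B" for B
  have low: "fps_nth (L B) n = I n * fps_nth B n" if B: "\<And>j. j < n \<Longrightarrow> fps_nth B j = 0" for B n
  proof -
    have "fps_nth (E4_fps * B) (0 + n) = fps_nth E4_fps 0 * fps_nth B n"
      by (rule fps_mult_nth_lowest) (use B in auto)
    moreover have "fps_nth (serre (k + 2) m (serre k m B)) n =
        (of_nat n + m - of_int (k + 2) / 12) * ((of_nat n + m - of_int k / 12) * fps_nth B n)"
      using serre_nth_lowest(2)[where A = "serre k m B", OF serre_nth_lowest(1)[OF B]]
        serre_nth_lowest(2)[where A = B, OF B] by simp
    ultimately have "fps_nth (L B) n = (of_nat n + m - of_int (k + 2) / 12) * ((of_nat n + m - of_int k / 12) * fps_nth B n) +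
        \<kappa> * fps_nth B n"
      by (simp add: L_def mult.assoc E4_nth_0)
    then show ?thesis
      by (simp only: I_def distrib_right mult.assoc)
  qed
  have L0: "L A = 0" by (simp add: L_def eq)
  have "I 0 = 0" using low[of 0 A] L0 A0 by simp
  \<comment> \<open>The indicial equation at degree 0 determines \<kappa> and shows that it is
    rational; it also lets \<open>I n\<close> factor with the root n = 0.\<close>
  then have kap: "\<kappa> = - ((m - of_int (k + 2) / 12) * (m - of_int k / 12))"
    unfolding I_def by (simp add: eq_neg_iff_add_eq_0 add.commute)
  have \<kappa>: "\<kappa> \<in> \<rat>" unfolding kap using m by auto
  have I: "I n = of_nat n * (of_nat n + 2 * m - of_int (2 * k + 2) / 12)" for n
    unfolding I_def kap by (simp add: algebra_simps add_divide_distrib)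
  have IQ: "I n \<in> \<rat>" for n unfolding I using m by auto
  have "fps_nth A n \<in> \<rat>" for n
  proof (induction n rule: less_induct)
    case (less n)
    show ?case
    proof (cases "n = 0")
      case False
      \<comment> \<open>The truncation isolates the contribution of the earlier coefficients; the
        rest \<open>A - T\<close> starts in degree n, where only \<open>I n\<close> acts.\<close>
      define T where "T = Abs_fps (\<lambda>j. if j < n then fps_nth A j else 0)"
      have T: "rational_fps T" using less by (auto simp: rational_fps_def T_def)
      have "rational_fps (fps_const \<kappa> * E4_fps * T)"
        by (intro rational_fps_mult T bounded_imp_rational bounded_E4 bounded_fps_const \<kappa>)
      then have "rational_fps (L T)"
        using rational_fps_serre[OF rational_fps_serre[OF T m, of k] m, of "k + 2"]
        by (auto simp: L_def rational_fps_def)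
      moreover have "L A = L T + L (A - T)"
        by (simp add: L_def serre_diff algebra_simps)
      then have "fps_nth (L T) n + fps_nth (L (A - T)) n = 0"
        using L0 by (metis fps_add_nth fps_zero_nth)
      moreover have "fps_nth (L (A - T)) n = I n * fps_nth (A - T) n"
        by (rule low) (simp add: T_def)
      moreover have "fps_nth (A - T) n = fps_nth A n" by (simp add: T_def)
      moreover have "I n \<noteq> 0" using nres[of n] False by (simp add: I)
      ultimately have "fps_nth A n = - fps_nth (L T) n / I n" "fps_nth (L T) n \<in> \<rat>"
        by (auto simp: field_simps add_eq_0_iff rational_fps_def)
      then show ?thesis using IQ[of n] by simp
    qed (simp add: A0)
  qed
  then show ?thesis by (simp add: rational_fps_def)
qed

text \<open>After clearing denominators, the greatest power of \<open>p\<close> dividing all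
  coefficients is taken out; it exists because some coefficient is nonzero.\<close>

lemma primitive_part_exists:
  fixes p :: int
  assumes A: "bounded_fps A" "A \<noteq> 0" and p: "Factorial_Ring.prime p"
  obtains c A0 i where "c \<noteq> 0" "fps_const c * A = of_int_fps A0" "\<not> p dvd fps_nth A0 i"
proof -
  obtain B C where B: "B \<noteq> 0" "fps_const (of_int B) * A = of_int_fps C"
    using A(1) unfolding bounded_fps_iff by blast
  have "C \<noteq> 0"
  proof
    assume "C = 0"
    then have "of_int_fps C = 0" by (simp add: fps_eq_iff)
    then show False using B A(2) by simp
  qed
  then obtain n0 where n0: "fps_nth C n0 \<noteq> 0" by (auto simp: fps_eq_iff)
  have "\<not> (\<forall>v n. p ^ v dvd fps_nth C n)"
  proof
    assume "\<forall>v n. p ^ v dvd fps_nth C n"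
    then have "p ^ Suc (multiplicity p (fps_nth C n0)) dvd fps_nth C n0" by blast
    then show False
      using n0 p by (metis multiplicity_geI not_prime_unit Suc_n_not_le_n)
  qed
  then obtain v where v: "\<not> (\<forall>n. p ^ v dvd fps_nth C n)" by blast
  define w where "w = (LEAST v. \<not> (\<forall>n. p ^ v dvd fps_nth C n))"
  have w: "\<not> (\<forall>n. p ^ w dvd fps_nth C n)" "\<And>u. u < w \<Longrightarrow> \<forall>n. p ^ u dvd fps_nth C n"
    unfolding w_def using LeastI[of "\<lambda>v. \<not> (\<forall>n. p ^ v dvd fps_nth C n)", OF v] not_less_Least by blast+
  then obtain u where u: "w = Suc u" by (cases w) auto
  have pu: "p ^ u dvd fps_nth C n" for n using w(2)[of u] u by blast
  define A0 where "A0 = Abs_fps (\<lambda>n. fps_nth C n div p ^ u)"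
  have p0: "p \<noteq> 0" using p by auto
  have C: "C = fps_const (p ^ u) * A0"
    using pu by (simp add: fps_eq_iff A0_def)
  obtain i where "\<not> p ^ Suc u dvd fps_nth C i" using w(1) u by blast
  then have "\<not> p dvd fps_nth A0 i"
    unfolding C using p0 by (simp add: mult.commute)
  moreover have "fps_const (1 / of_int (p ^ u)) * (fps_const (of_int B) * A) = of_int_fps A0"
    unfolding B(2) C using p0 by (simp add: of_int_fps_simps flip: mult.assoc)
  then have "fps_const (of_int B / of_int (p ^ u)) * A = of_int_fps A0"
    by (simp flip: mult.assoc)
  ultimately show ?thesis
    using B(1) p0 by (intro that[of "of_int B / of_int (p ^ u)"]) auto
qed

text \<open>
  With \<open>u = \<theta>\<xi>/\<xi>\<close> a quotient \<open>U/V\<close> of integral series, \<open>V\<close> primitive at \<open>p\<close>, the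
  Riccati equation of \<open>u\<close> contains the term \<open>12 r\<^sup>2 Y\<close>, \<open>E\<^sub>4 = 1 + 48 Y\<close>; all its other terms have at most
  one factor \<open>r\<close> in front of an integral series, which bounds the power of \<open>p\<close> in the denominator of \<open>r\<close>.
\<close>

lemma riccati:
  fixes \<xi> U V Y S :: "complex fps" and k r :: complex
  assumes VU: "V * qderiv \<xi> = U * \<xi>" and \<xi>: "\<xi> \<noteq> 0"
    and ode: "qderiv (qderiv \<xi>) + (fps_const r + fps_const (4 * (k + 1)) * S) * qderiv \<xi> +
       (fps_const (2 * (k + 1)) * qderiv S + fps_const (2 * (k + 1) * r) * S + fps_const (4 * (k + 1)\<^sup>2) * S\<^sup>2
         - fps_const (12 * r\<^sup>2) * Y) * \<xi> = 0"
  shows "fps_const (12 * r\<^sup>2) * Y * V\<^sup>2 = (V * qderiv U + U\<^sup>2 - U * qderiv V + fps_const (4 * (k + 1)) * S * U * V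
     + fps_const (2 * (k + 1)) * qderiv S * V\<^sup>2 + fps_const (4 * (k + 1)\<^sup>2) * S\<^sup>2 * V\<^sup>2)
     + fps_const r * (U * V + fps_const (2 * (k + 1)) * S * V\<^sup>2)"
proof -
  have "qderiv (V * qderiv \<xi>) = qderiv (U * \<xi>)" by (simp only: VU)
  then have "qderiv V * qderiv \<xi> + V * qderiv (qderiv \<xi>) = qderiv U * \<xi> + U * qderiv \<xi>"
    by (simp only: qderiv_mult)
  then have "V * qderiv (qderiv \<xi>) = qderiv U * \<xi> + U * qderiv \<xi> - qderiv V * qderiv \<xi>"
    by (simp only: eq_diff_eq add.commute)
  then have "V * (V * qderiv (qderiv \<xi>)) = V * (qderiv U * \<xi> + U * qderiv \<xi> - qderiv V * qderiv \<xi>)"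
    by (simp only:)
  also have "\<dots> = V * qderiv U * \<xi> + U * (V * qderiv \<xi>) - qderiv V * (V * qderiv \<xi>)"
    by (simp add: algebra_simps)
  finally have V2: "V\<^sup>2 * qderiv (qderiv \<xi>) = (V * qderiv U + U\<^sup>2 - U * qderiv V) * \<xi>"
    by (simp add: VU power2_eq_square algebra_simps)
  have V1: "V\<^sup>2 * qderiv \<xi> = V * U * \<xi>"
    using VU by (simp add: power2_eq_square mult.assoc)
  let ?lin = "fps_const r + fps_const (4 * (k + 1)) * S"
  let ?cst = "fps_const (2 * (k + 1)) * qderiv S + fps_const (2 * (k + 1) * r) * S + fps_const (4 * (k + 1)\<^sup>2) * S\<^sup>2
         - fps_const (12 * r\<^sup>2) * Y"
  have "V\<^sup>2 * (qderiv (qderiv \<xi>) + ?lin * qderiv \<xi> + ?cst * \<xi>) = 0"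
    by (simp only: ode mult_zero_right)
  then have "V\<^sup>2 * qderiv (qderiv \<xi>) + ?lin * (V\<^sup>2 * qderiv \<xi>) + ?cst * V\<^sup>2 * \<xi> = 0"
    by (simp only: distrib_left mult_ac)
  then have "(V * qderiv U + U\<^sup>2 - U * qderiv V + ?lin * (V * U) + ?cst * V\<^sup>2) * \<xi> = 0"
    unfolding V1 V2 by (simp only: distrib_right mult.assoc)
  then have "V * qderiv U + U\<^sup>2 - U * qderiv V + ?lin * (V * U) + ?cst * V\<^sup>2 = 0"
    using \<xi> by simp
  moreover have "fps_const (2 * (k + 1) * r) = fps_const r * fps_const (2 * (k + 1))"
    by (simp add: mult_ac)
  ultimately show ?thesis
    by (simp only:) (simp add: algebra_simps del: fps_const_mult fps_const_add)
qed

text \<open>The point of this normal form is integrality: E2 contributes \<open>s / 3\<close> and E4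
  contributes \<open>y / 3\<close>, but by the definition of \<open>E4_tail\<close> the combination
  is integral. So \<open>r\<close> is the only source of denominators, and it is squared only in
  front of \<open>y\<close>.\<close>

lemma serre_serre_expand:
  fixes k :: int and r :: complex
  defines "m \<equiv> of_int (k + 1) / 12 + r / 2" and "\<kappa> \<equiv> 1 / 144 - r\<^sup>2 / 4"
    and "s \<equiv> of_int_fps sigma_int" and "y \<equiv> of_int_fps E4_tail"
  shows "serre (k + 2) m (serre k m \<xi>) + fps_const \<kappa> * E4_fps * \<xi> =
       qderiv (qderiv \<xi>) + (fps_const r + fps_const (4 * (of_int k + 1)) * s) * qderiv \<xi> +
       (fps_const (2 * (of_int k + 1)) * qderiv s + fps_const (2 * (of_int k + 1) * r) * s + fps_const (4 * (of_int k + 1)\<^sup>2) * s\<^sup>2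
         - fps_const (12 * r\<^sup>2) * y) * \<xi>"
proof -
  have E2: "E2_fps = 1 - fps_const 24 * s"
    by (simp add: E2_fps_def s_def sigma_int numeral_fps_const)
  have E4: "E4_fps = 1 + fps_const 48 * y"
    by (simp add: E4_eq y_def numeral_fps_const)
  have y: "y = - s + fps_const 12 * s\<^sup>2 + fps_const 6 * qderiv s"
    by (simp add: y_def s_def E4_tail_def of_int_fps_simps power2_eq_square numeral_fps_const)
  \<comment> \<open>\<open>a\<close> and \<open>b\<close> are the constant terms that the two Serre
    derivatives add to q d/dq; \<kappa> is chosen so that their product cancels.\<close>
  define a where "a = 1 / 12 + r / 2"
  define b where "b = r / 2 - 1 / 12"
  define K :: complex where "K = of_int k"
  have 1: "serre k m \<eta> = qderiv \<eta> + fps_const a * \<eta> + fps_const (2 * K) * s * \<eta>" for \<eta>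
  proof -
    have "serre k m \<eta> = qderiv \<eta> + fps_const (m - K / 12) * \<eta> + fps_const (K / 12 * 24) * s * \<eta>"
      by (simp add: serre_def E2 K_def algebra_simps flip: fps_const_sub fps_const_mult)
    moreover have "m - K / 12 = a" by (simp add: m_def K_def a_def add_divide_distrib)
    ultimately show ?thesis by (simp add: mult.commute)
  qed
  have 2: "serre (k + 2) m \<eta> = qderiv \<eta> + fps_const b * \<eta> + fps_const (2 * (K + 2)) * s * \<eta>" for \<eta>
  proof -
    have "serre (k + 2) m \<eta> = qderiv \<eta> + fps_const (m - (K + 2) / 12) * \<eta> + fps_const ((K + 2) / 12 * 24) * s * \<eta>"
      by (simp add: serre_def E2 K_def algebra_simps flip: fps_const_sub fps_const_mult)
    moreover have "m - (K + 2) / 12 = b" by (simp add: m_def K_def b_def add_divide_distrib)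
    ultimately show ?thesis by (simp add: mult.commute)
  qed
  have "serre (k + 2) m (serre k m \<xi>) + fps_const \<kappa> * E4_fps * \<xi> =
      qderiv (qderiv \<xi>) + (fps_const (a + b) + fps_const (2 * K + 2 * (K + 2)) * s) * qderiv \<xi> +
      (fps_const (2 * K) * qderiv s + fps_const (2 * K * b + 2 * (K + 2) * a) * s + fps_const (2 * K * (2 * (K + 2))) * s\<^sup>2
        + fps_const (a * b + \<kappa>) + fps_const (48 * \<kappa>) * y) * \<xi>"
    unfolding 1 2 E4
    by (simp add: qderiv_add qderiv_mult power2_eq_square algebra_simps flip: fps_const_mult fps_const_add numeral_fps_const)
  also have "a + b = r" by (simp add: a_def b_def)
  also have "2 * K + 2 * (K + 2) = 4 * (K + 1)" by simp
  also have "a * b + \<kappa> = 0" by (simp add: a_def b_def \<kappa>_def power2_eq_square algebra_simps)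
  also have "2 * K * b + 2 * (K + 2) * a = 2 * (K + 1) * r + 1 / 3"
    by (simp add: a_def b_def algebra_simps)
  also have "48 * \<kappa> = 1 / 3 - 12 * r\<^sup>2" by (simp add: \<kappa>_def)
  also have "fps_const (2 * K) * qderiv s + fps_const (2 * (K + 1) * r + 1 / 3) * s + fps_const (2 * K * (2 * (K + 2))) * s\<^sup>2
        + fps_const 0 + fps_const (1 / 3 - 12 * r\<^sup>2) * y =
      fps_const (2 * (K + 1)) * qderiv s + fps_const (2 * (K + 1) * r) * s + fps_const (4 * (K + 1)\<^sup>2) * s\<^sup>2
         - fps_const (12 * r\<^sup>2) * y"
  proof -
    have "fps_const (1 / 3) * y = fps_const (- 1 / 3) * s + fps_const 4 * s\<^sup>2 + fps_const 2 * qderiv s"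
      by (simp add: y fps_eq_iff)
    then have "fps_const (1 / 3 - 12 * r\<^sup>2) * y =
        fps_const (- 1 / 3) * s + fps_const 4 * s\<^sup>2 + fps_const 2 * qderiv s - fps_const (12 * r\<^sup>2) * y"
      by (simp add: left_diff_distrib flip: fps_const_sub)
    moreover have "fps_const (2 * K) * qderiv s + fps_const (2 * (K + 1) * r + 1 / 3) * s + fps_const (2 * K * (2 * (K + 2))) * T
        + fps_const 0 + Z =
      fps_const (2 * (K + 1)) * qderiv s + fps_const (2 * (K + 1) * r) * s + fps_const (4 * (K + 1)\<^sup>2) * T
         - fps_const (12 * r\<^sup>2) * y"
      if "Z = fps_const (- 1 / 3) * s + fps_const 4 * T + fps_const 2 * qderiv s - fps_const (12 * r\<^sup>2) * y" for Z T
      unfolding that by (simp add: fps_eq_iff algebra_simps power2_eq_square)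
    ultimately show ?thesis by blast
  qed
  finally show ?thesis by (simp add: K_def)
qed

text \<open>Multiplied by \<open>M\<^sup>2\<close>, the Riccati equation equates 12 a^2 Y V^2 with a
  multiple of \<open>M\<close>. Gauss's lemma cancels \<open>V\<close> twice at each prime, and the
  coefficient of q is 60 a^2, with \<open>a\<close> prime to \<open>M\<close>.\<close>

theorem denominator_divides_60:
  fixes k a :: int and M :: nat
  defines "r \<equiv> of_int a / of_nat M :: complex"
  defines "m \<equiv> of_int (k + 1) / 12 + r / 2"
  assumes M: "M > 0" "coprime a (int M)"
    and ode: "serre (k + 2) m (serre k m \<xi>) = - (fps_const (1 / 144 - r\<^sup>2 / 4) * E4_fps * \<xi>)"
    and N: "N = d * \<xi>" "bounded_fps N" "bounded_fps d" "N \<noteq> 0"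
  shows "M dvd 60"
proof -
  have \<xi>: "\<xi> \<noteq> 0" and d: "d \<noteq> 0" using N by auto
  have "int M dvd 60"
  proof (rule multiplicity_le_imp_dvd)
    fix p :: int assume p: "Factorial_Ring.prime p"
    define v where "v = multiplicity p (int M)"
    show "multiplicity p (int M) \<le> multiplicity p 60"
    proof (cases "v = 0")
      case False
      have pvM: "p ^ v dvd int M" by (simp add: v_def multiplicity_dvd)
      have pM: "p dvd int M" using pvM False by (meson dvd_power dvd_trans not_gr_zero)
      have pa: "coprime (p ^ v) (a\<^sup>2)"
      proof -
        have "\<not> p dvd a" using M(2) pM p by (meson coprime_common_divisor not_prime_unit)
        then show ?thesis using p by (simp add: prime_imp_coprime coprime_power_left_iff coprime_power_right_iff)
      qed
      obtain c1 N0 i1 where N0: "c1 \<noteq> 0" "fps_const c1 * N = of_int_fps N0" "\<not> p dvd fps_nth N0 i1"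
        using primitive_part_exists[OF N(2,4) p] by metis
      obtain c2 d0 i2 where d0: "c2 \<noteq> 0" "fps_const c2 * d = of_int_fps d0" "\<not> p dvd fps_nth d0 i2"
        using primitive_part_exists[OF N(3) d p] by metis
      \<comment> \<open>\<open>U/V\<close> is the logarithmic derivative of \<open>N0/d0\<close> and
        hence of \<xi>: the constants \<open>c1\<close> and \<open>c2\<close> drop out.\<close>
      define U where "U = d0 * qderiv N0 - N0 * qderiv d0"
      define V where "V = N0 * d0"
      define s where "s = of_int_fps sigma_int"
      define y where "y = of_int_fps E4_tail"
      have VU: "of_int_fps V * qderiv \<xi> = of_int_fps U * \<xi>"
        by (simp add: U_def V_def of_int_fps_simps qderiv_mult N(1) algebra_simps flip: N0(2) d0(2))
      have eqn: "fps_const (12 * r\<^sup>2) * y * (of_int_fps V)\<^sup>2 =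
         (of_int_fps V * qderiv (of_int_fps U) + (of_int_fps U)\<^sup>2 - of_int_fps U * qderiv (of_int_fps V) +
            fps_const (4 * (of_int k + 1)) * s * of_int_fps U * of_int_fps V
          + fps_const (2 * (of_int k + 1)) * qderiv s * (of_int_fps V)\<^sup>2 + fps_const (4 * (of_int k + 1)\<^sup>2) * s\<^sup>2 * (of_int_fps V)\<^sup>2)
         + fps_const r * (of_int_fps U * of_int_fps V + fps_const (2 * (of_int k + 1)) * s * (of_int_fps V)\<^sup>2)"
      proof (rule riccati[OF VU \<xi>])
        have "serre (k + 2) m (serre k m \<xi>) + fps_const (1 / 144 - r\<^sup>2 / 4) * E4_fps * \<xi> = 0"
          by (simp add: ode)
        then show "qderiv (qderiv \<xi>) + (fps_const r + fps_const (4 * (of_int k + 1)) * s) * qderiv \<xi> +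
           (fps_const (2 * (of_int k + 1)) * qderiv s + fps_const (2 * (of_int k + 1) * r) * s + fps_const (4 * (of_int k + 1)\<^sup>2) * s\<^sup>2
             - fps_const (12 * r\<^sup>2) * y) * \<xi> = 0"
          unfolding s_def y_def m_def by (simp only: serre_serre_expand)
      qed
      define J1 where "J1 = V * qderiv U + U\<^sup>2 - U * qderiv V + fps_const (4 * (k + 1)) * sigma_int * U * V
          + fps_const (2 * (k + 1)) * qderiv sigma_int * V\<^sup>2 + fps_const (4 * (k + 1)\<^sup>2) * sigma_int\<^sup>2 * V\<^sup>2"
      define J2 where "J2 = U * V + fps_const (2 * (k + 1)) * sigma_int * V\<^sup>2"
      have eqJ: "fps_const (12 * r\<^sup>2) * y * (of_int_fps V)\<^sup>2 = of_int_fps J1 + fps_const r * of_int_fps J2"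
        unfolding eqn J1_def J2_def s_def by (simp add: of_int_fps_simps power2_eq_square)
      have rM: "of_nat M * r = of_int a" using M(1) by (simp add: r_def)
      have "of_int_fps (fps_const (12 * a\<^sup>2) * E4_tail * V\<^sup>2) = fps_const ((of_nat M)\<^sup>2) * (fps_const (12 * r\<^sup>2) * y * (of_int_fps V)\<^sup>2)"
      proof -
        have "(of_nat M)\<^sup>2 * (12 * r\<^sup>2) = 12 * (of_int a)\<^sup>2"
          by (simp flip: rM add: power_mult_distrib)
        then show ?thesis
          by (simp add: of_int_fps_simps y_def power2_eq_square flip: mult.assoc)
      qed
      also have "\<dots> = fps_const (of_nat M) * (fps_const (of_nat M) * of_int_fps J1 + fps_const (of_nat M * r) * of_int_fps J2)"
        unfolding eqJ by (simp add: distrib_left power2_eq_square flip: mult.assoc fps_const_mult)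
      also have "\<dots> = of_int_fps (fps_const (int M) * (fps_const (int M) * J1 + fps_const a * J2))"
        by (simp add: rM of_int_fps_simps)
      finally have int_eq: "V * (V * (fps_const (12 * a\<^sup>2) * E4_tail)) = fps_const (int M) * (fps_const (int M) * J1 + fps_const a * J2)"
        unfolding of_int_fps_inject by (simp add: power2_eq_square mult_ac)
      have "p ^ v dvd fps_nth (V * (V * (fps_const (12 * a\<^sup>2) * E4_tail))) n" for n
        unfolding int_eq using pvM by (simp add: dvd_mult2)
      moreover obtain i where V: "\<not> p dvd fps_nth V i"
        using prime_gauss_fps[OF p N0(3), of d0] d0(3) unfolding V_def by blast
      ultimately have "p ^ v dvd fps_nth (fps_const (12 * a\<^sup>2) * E4_tail) n" for n
        using prime_power_gauss_fps[OF p V] by blast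
      from this[of "Suc 0"] have "p ^ v dvd a\<^sup>2 * 60"
        by (simp add: E4_tail_nth_1 mult.commute)
      then have "p ^ v dvd 60"
        using pa by (simp add: coprime_dvd_mult_right_iff)
      then show ?thesis
        unfolding v_def[symmetric] using p by (intro multiplicity_geI) auto
    qed (simp add: v_def)
  qed (use M in simp)
  then have "int M dvd int 60" by simp
  then show ?thesis by (simp only: int_dvd_int_iff)
qed

subsection \<open>Bounded denominators\<close>

text \<open>The first component and its Serre derivative are two bounded combinations of \<xi> and
  \<eta>; eliminating \<eta> produces the bounded \<open>N\<close> and \<open>d\<close> with
  \<open>N = d * \<xi>\<close> that \<open>denominator_divides_60\<close> takes.\<close>

theorem (in vector_forms) bounded_implies_level:
  fixes a :: int and M :: nat
  assumes \<phi>: "\<phi> \<in> vform k" "\<phi> 1 \<noteq> 0" "bounded_fps (\<phi> 1)"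
    and M: "M > 0" "coprime a (int M)" "m 1 - m 2 = of_int a / of_nat M"
  shows "M dvd 60"
proof -
  obtain F k0 c \<kappa> where F: "F \<in> vform k0" "2 * k0 + 2 = l" "cross F (D k0 F) = fps_const c" "c \<noteq> 0"
    "\<And>i. fps_nth (F i) 0 \<noteq> 0" "\<And>i. D (k0 + 2) (D k0 F) i = - (fps_const \<kappa> * E4_fps * F i)"
    using minimal_form_equation[OF \<phi>(1,2)] by metis
  define r where "r = m 1 - m 2"
  have r: "r = of_int a / of_nat M" using M(3) by (simp add: r_def)
  have m1: "m 1 = of_int (k0 + 1) / 12 + r / 2"
  proof -
    have "12 * (m 1 + m 2) = 2 * of_int k0 + 2"
      using exponent_sum F(2) by (metis of_int_add of_int_mult of_int_numeral)
    then show ?thesis by (simp add: r_def field_simps)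
  qed
  have m1Q: "m 1 \<in> \<rat>" unfolding m1 r by auto
  have odeF: "serre (k0 + 2) (m 1) (serre k0 (m 1) (F 1)) = - (fps_const \<kappa> * E4_fps * F 1)"
    using F(6)[of 1] by (simp add: D_def)
  \<comment> \<open>Comparison of constant terms gives the indicial equation. The sum of the
    exponents is known from \<open>l\<close>, so the product depends on \<open>r\<close>
    alone.\<close>
  have kap: "\<kappa> = 1 / 144 - r\<^sup>2 / 4"
  proof -
    have "fps_nth (serre (k0 + 2) (m 1) (serre k0 (m 1) (F 1))) 0 =
        (of_nat 0 + m 1 - of_int (k0 + 2) / 12) * ((of_nat 0 + m 1 - of_int k0 / 12) * fps_nth (F 1) 0)"
      by (subst serre_nth_lowest(2); simp add: serre_nth_lowest(2))
    moreover have "fps_nth (- (fps_const \<kappa> * E4_fps * F 1)) 0 = - (\<kappa> * fps_nth (F 1) 0)"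
      by (simp add: E4_nth_0 mult.assoc)
    ultimately have "- (\<kappa> * fps_nth (F 1) 0) = (m 1 - of_int (k0 + 2) / 12) * ((m 1 - of_int k0 / 12) * fps_nth (F 1) 0)"
      unfolding odeF by (simp only: of_nat_0 add_0_left)
    then have "((m 1 - of_int (k0 + 2) / 12) * (m 1 - of_int k0 / 12) + \<kappa>) * fps_nth (F 1) 0 = 0"
      by (simp only: distrib_right mult.assoc) (metis add.commute add.right_inverse)
    then have "(m 1 - of_int (k0 + 2) / 12) * (m 1 - of_int k0 / 12) + \<kappa> = 0"
      using F(5) by simp
    moreover have "m 1 - of_int (k0 + 2) / 12 = r / 2 - 1 / 12" "m 1 - of_int k0 / 12 = r / 2 + 1 / 12"
      by (simp_all add: m1 add_divide_distrib)
    moreover have "(r / 2 - 1 / 12) * (r / 2 + 1 / 12) = r\<^sup>2 / 4 - 1 / 144"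
      by (simp add: power2_eq_square algebra_simps)
    ultimately have "(r\<^sup>2 / 4 - 1 / 144) + \<kappa> = 0" by simp
    then show ?thesis by (simp add: algebra_simps add_eq_0_iff)
  qed
  have \<kappa>Q: "\<kappa> \<in> \<rat>" unfolding kap r by auto
  define c0 where "c0 = fps_nth (F 1) 0"
  have c0: "c0 \<noteq> 0" using F(5) by (simp add: c0_def)
  define \<xi> where "\<xi> = fps_const (1 / c0) * F 1"
  have F1: "F 1 = fps_const c0 * \<xi>"
    using c0 by (simp add: \<xi>_def flip: mult.assoc)
  have \<xi>0: "fps_nth \<xi> 0 = 1" using c0 by (simp add: \<xi>_def c0_def)
  have ode: "serre (k0 + 2) (m 1) (serre k0 (m 1) \<xi>) = - (fps_const \<kappa> * E4_fps * \<xi>)"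
    unfolding \<xi>_def serre_cmult odeF by (simp add: mult_ac)
  have \<xi>Q: "rational_fps \<xi>"
  proof (rule solution_rational[OF ode \<xi>0 m1Q])
    fix n :: nat
    have "of_nat n + 2 * m 1 - of_int (2 * k0 + 2) / 12 = of_nat n + r"
      by (simp add: m1 field_simps)
    moreover have "of_nat n + r \<noteq> 0"
    proof
      assume "of_nat n + r = 0"
      then have "r = of_int (- int n)" by (simp add: add_eq_0_iff)
      then show False using exponent_diff unfolding r_def by (metis Ints_of_int)
    qed
    ultimately show "of_nat n + 2 * m 1 - of_int (2 * k0 + 2) / 12 \<noteq> 0" by (simp only: not_False_eq_True)
  qed
  define \<eta> where "\<eta> = serre k0 (m 1) \<xi>"
  have \<eta>Q: "rational_fps \<eta>" unfolding \<eta>_def by (rule rational_fps_serre[OF \<xi>Q m1Q])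
  have DF1: "D k0 F 1 = fps_const c0 * \<eta>" by (simp add: D_def F1 serre_cmult \<eta>_def)
  obtain \<alpha> \<beta> where ab: "\<alpha> \<in> mform (k - k0)" "\<beta> \<in> mform (k - k0 - 2)" "\<phi> 1 = \<alpha> * F 1 + \<beta> * D k0 F 1"
    using vform_combination[OF F(1,2,3,4) \<phi>(1)] by metis
  \<comment> \<open>The forms \<alpha> and \<beta> have arbitrary complex coefficients. Applying
    \<open>f\<close> to the relation leaves \<open>\<phi> 1\<close>, \<xi> and \<eta> unchanged,
    since these are rational, and replaces the multipliers by bounded ones.\<close>
  obtain f :: "complex \<Rightarrow> rat" where f: "f 1 = 1" "\<And>x y. f (x + y) = f x + f y" "\<And>r x. f (of_rat r * x) = r * f x"
    using rational_functional_exists by metis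
  define \<alpha>' where "\<alpha>' = rational_part f (fps_const c0 * \<alpha>)"
  define \<beta>' where "\<beta>' = rational_part f (fps_const c0 * \<beta>)"
  have \<alpha>': "\<alpha>' \<in> mform (k - k0)" "bounded_fps \<alpha>'"
    using rational_part_mform[OF f mform_cmult[OF ab(1)]] by (simp_all add: \<alpha>'_def)
  have \<beta>': "\<beta>' \<in> mform (k - k0 - 2)" "bounded_fps \<beta>'"
    using rational_part_mform[OF f mform_cmult[OF ab(2)]] by (simp_all add: \<beta>'_def)
  have \<phi>1: "\<phi> 1 = \<alpha>' * \<xi> + \<beta>' * \<eta>"
  proof -
    have "\<phi> 1 = (fps_const c0 * \<alpha>) * \<xi> + (fps_const c0 * \<beta>) * \<eta>"
      unfolding ab(3) F1 DF1 by (simp add: mult_ac)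
    then have "rational_part f (\<phi> 1) = rational_part f ((fps_const c0 * \<alpha>) * \<xi> + (fps_const c0 * \<beta>) * \<eta>)"
      by (simp only:)
    then show ?thesis
      unfolding rational_part_add[OF f] rational_part_mult[OF f \<xi>Q] rational_part_mult[OF f \<eta>Q]
        rational_part_rational[OF f bounded_imp_rational[OF \<phi>(3)]] \<alpha>'_def \<beta>'_def .
  qed
  define A where "A = serre (k - k0) 0 \<alpha>'"
  define B where "B = serre (k - k0 - 2) 0 \<beta>'"
  define p where "p = A - fps_const \<kappa> * E4_fps * \<beta>'"
  \<comment> \<open>The determinant of the system \<alpha>', \<beta>' and p, \<alpha>' + B, which
    expresses \<open>\<phi> 1\<close> and its Serre derivative by \<xi> and \<eta>.\<close>
  define d where "d = \<alpha>' * (\<alpha>' + B) - \<beta>' * p"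
  define N where "N = (\<alpha>' + B) * \<phi> 1 - \<beta>' * serre k (m 1) (\<phi> 1)"
  have comb: "serre k (m i) (\<alpha>' * u + \<beta>' * serre k0 (m i) u) = p * u + (\<alpha>' + B) * serre k0 (m i) u"
    if u: "serre (k0 + 2) (m i) (serre k0 (m i) u) = - (fps_const \<kappa> * E4_fps * u)" for u i
  proof -
    have "serre k (m i) (\<alpha>' * u) = A * u + \<alpha>' * serre k0 (m i) u"
      using serre_mult[of "k - k0" k0 0 "m i" \<alpha>' u] by (simp add: A_def)
    moreover have "serre k (m i) (\<beta>' * serre k0 (m i) u) = B * serre k0 (m i) u + \<beta>' * - (fps_const \<kappa> * E4_fps * u)"
      using serre_mult[of "k - k0 - 2" "k0 + 2" 0 "m i" \<beta>' "serre k0 (m i) u"] u by (simp add: B_def)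
    ultimately show ?thesis
      by (simp add: serre_add p_def algebra_simps)
  qed
  have N: "N = d * \<xi>"
    unfolding N_def \<phi>1 \<eta>_def comb[OF ode] d_def by (simp add: algebra_simps)
  have bA: "bounded_fps A" "bounded_fps B"
    unfolding A_def B_def by (intro bounded_fps_serre \<alpha>' \<beta>'; simp)+
  have bp: "bounded_fps p"
    unfolding p_def by (intro bounded_fps_diff bounded_fps_mult bounded_fps_const bounded_E4 bA \<beta>' \<kappa>Q)
  have bd: "bounded_fps d"
    unfolding d_def by (intro bounded_fps_diff bounded_fps_mult bounded_fps_add bA bp \<alpha>' \<beta>')
  have bN: "bounded_fps N"
    unfolding N_def by (intro bounded_fps_diff bounded_fps_mult bounded_fps_add bounded_fps_serre bA \<phi>(3) \<alpha>' \<beta>' m1Q)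
  \<comment> \<open>\<alpha>' and \<beta>' were matched with the first component only;
    \<open>G\<close> is the vector form they define. Its Wronskian is \<open>d\<close> times that of
    \<open>F\<close>, and it is nonzero because \<open>G 1\<close> is.\<close>
  define G where "G i = \<alpha>' * F i + \<beta>' * D k0 F i" for i
  have "G \<in> vform k"
    unfolding G_def using vform_mult[OF \<alpha>'(1) F(1)] vform_mult[OF \<beta>'(1) vform_D[OF F(1)]]
    by (intro vform_add) simp_all
  moreover have "G 1 = fps_const c0 * \<phi> 1"
    unfolding G_def DF1 \<phi>1 F1 by (simp add: algebra_simps)
  then have "G 1 \<noteq> 0" using c0 \<phi>(2) by simp
  ultimately have "cross G (D k G) \<noteq> 0" by (rule cross_D_nonzero)
  moreover have "D k G i = p * F i + (\<alpha>' + B) * D k0 F i" for i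
    using comb[of i "F i"] F(6)[of i] by (simp add: D_def G_def)
  then have "cross G (D k G) = d * cross F (D k0 F)"
    by (simp add: cross_def G_def d_def algebra_simps)
  ultimately have d0: "d \<noteq> 0" by auto
  have "\<xi> \<noteq> 0" using \<xi>0 by auto
  then have "N \<noteq> 0" using N d0 by simp
  show ?thesis
    by (rule denominator_divides_60[OF M(1,2) _ N bN bd \<open>N \<noteq> 0\<close>, of k0])
       (use ode in \<open>simp add: m1[unfolded r] kap[unfolded r]\<close>)
qed

subsection \<open>Representations of the modular group\<close>

definition S_SL2Z :: "int^2^2" where
  "S_SL2Z = vector [vector [0, - 1], vector [1, 0]]"

lemmas matrix2_simps = vec_eq_iff forall_2 matrix_matrix_mult_def sum_2 mat_def det_2

lemma S_SL2Z_nth [simp]: "S_SL2Z $ 1 $ 1 = 0" "S_SL2Z $ 1 $ 2 = - 1" "S_SL2Z $ 2 $ 1 = 1" "S_SL2Z $ 2 $ 2 = 0"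
  and T_SL2Z_nth [simp]: "T_SL2Z $ 1 $ 1 = 1" "T_SL2Z $ 1 $ 2 = 1" "T_SL2Z $ 2 $ 1 = 0" "T_SL2Z $ 2 $ 2 = 1"
  by (simp_all add: S_SL2Z_def T_SL2Z_def)

lemma carrier_SL2Z: "A \<in> carrier SL2Z \<longleftrightarrow> A $ 1 $ 1 * A $ 2 $ 2 - A $ 1 $ 2 * A $ 2 $ 1 = 1"
  by (simp add: SL2Z_def det_2)

lemma S_SL2Z_carrier: "S_SL2Z \<in> carrier SL2Z" and T_SL2Z_carrier: "T_SL2Z \<in> carrier SL2Z"
  by (simp_all add: carrier_SL2Z)

lemma SL2Z_mult_closed: "A \<in> carrier SL2Z \<Longrightarrow> B \<in> carrier SL2Z \<Longrightarrow> A ** B \<in> carrier SL2Z"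
  by (simp add: SL2Z_def det_mul)

text \<open>S and T generate even as a semigroup, since the inverses are words in them. The descent
  is Euclid's algorithm on the first column.\<close>

lemma SL2Z_induct:
  assumes S: "Q S_SL2Z" and T: "Q T_SL2Z"
    and mult: "\<And>A B. A \<in> carrier SL2Z \<Longrightarrow> B \<in> carrier SL2Z \<Longrightarrow> Q A \<Longrightarrow> Q B \<Longrightarrow> Q (A ** B)"
    and A: "A \<in> carrier SL2Z"
  shows "Q A"
proof -
  define Tp :: "int \<Rightarrow> int^2^2" where "Tp n = vector [vector [1, n], vector [0, 1]]" for n
  have Tp [simp]: "Tp n $ 1 $ 1 = 1" "Tp n $ 1 $ 2 = n" "Tp n $ 2 $ 1 = 0" "Tp n $ 2 $ 2 = 1" for n
    by (simp_all add: Tp_def)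
  have Tpc: "Tp n \<in> carrier SL2Z" for n by (simp add: carrier_SL2Z)
  note c = S_SL2Z_carrier T_SL2Z_carrier SL2Z_mult_closed Tpc
  let ?S = "S_SL2Z" and ?T = "T_SL2Z"
  have Sinv: "Q (?S ** (?S ** ?S))" by (intro mult c S)
  \<comment> \<open>\<open>(ST)\<^sup>3 = S\<^sup>2 = -1\<close> and
    \<open>S\<^sup>-\<^sup>1 = S\<^sup>3\<close> give the inverse of T as STST times the cube of
    S.\<close>
  have "Q ((?S ** ?T) ** ((?S ** ?T) ** (?S ** (?S ** ?S))))" by (intro mult c S T)
  also have "(?S ** ?T) ** ((?S ** ?T) ** (?S ** (?S ** ?S))) = Tp (- 1)"
    by (simp add: matrix2_simps)
  finally have Tm: "Q (Tp (- 1))" .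
  have QT: "Q (Tp n)" for n
  proof (induction n rule: int_induct[of _ 0])
    case base
    have "Q (Tp (- 1) ** ?T)" by (intro mult c Tm T)
    also have "Tp (- 1) ** ?T = Tp 0" by (simp add: matrix2_simps)
    finally show ?case .
  next
    case (step1 i)
    have "Q (?T ** Tp i)" by (intro mult c T step1)
    also have "?T ** Tp i = Tp (i + 1)" by (simp add: matrix2_simps)
    finally show ?case .
  next
    case (step2 i)
    have "Q (Tp (- 1) ** Tp i)" by (intro mult c Tm step2)
    also have "Tp (- 1) ** Tp i = Tp (i - 1)" by (simp add: matrix2_simps)
    finally show ?case .
  qed
  show ?thesis
    using A
  proof (induction "nat \<bar>A $ 2 $ 1\<bar>" arbitrary: A rule: less_induct)
    case (less A)
    show ?case
    proof (cases "A $ 2 $ 1 = 0")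
      case True
      then have "A $ 1 $ 1 * A $ 2 $ 2 = 1" using less.prems by (simp add: carrier_SL2Z)
      then consider "A $ 1 $ 1 = 1" "A $ 2 $ 2 = 1" | "A $ 1 $ 1 = - 1" "A $ 2 $ 2 = - 1"
        using zmult_eq_1_iff by blast
      then show ?thesis
      proof cases
        case 1
        then have "A = Tp (A $ 1 $ 2)" using True by (simp add: matrix2_simps)
        then show ?thesis using QT by metis
      next
        case 2
        then have "A = (?S ** ?S) ** Tp (- (A $ 1 $ 2))" using True by (simp add: matrix2_simps)
        moreover have "Q ((?S ** ?S) ** Tp (- (A $ 1 $ 2)))" by (intro mult c S QT)
        ultimately show ?thesis by simp
      qed
    next
      case False
      define n where "n = A $ 1 $ 1 div A $ 2 $ 1"
      define B where "B = ?S ** (Tp (- n) ** A)"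
      have B21: "B $ 2 $ 1 = A $ 1 $ 1 mod A $ 2 $ 1"
        by (simp add: B_def matrix2_simps n_def minus_div_mult_eq_mod[symmetric])
      have Bc: "B \<in> carrier SL2Z" unfolding B_def by (intro c less.prems)
      have "Q B"
        by (rule less.hyps[OF _ Bc]) (use False abs_mod_less in \<open>simp add: B21\<close>)
      then have "Q (Tp n ** ((?S ** (?S ** ?S)) ** B))" by (intro mult c QT Sinv Bc)
      also have "Tp n ** ((?S ** (?S ** ?S)) ** B) = A"
        by (simp add: B_def matrix2_simps)
      finally show ?thesis .
    qed
  qed
qed

context
  fixes \<rho> :: "int^2^2 \<Rightarrow> complex^2^2" and m :: "real^2"
  assumes hom: "\<rho> \<in> hom SL2Z GL2C"
    and \<rho>T: "\<rho> T_SL2Z = (\<chi> i j. if i = j then exp (2 * of_real pi * \<i> * of_real (m$i)) else 0)"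
begin

lemma rho_mult: "A \<in> carrier SL2Z \<Longrightarrow> B \<in> carrier SL2Z \<Longrightarrow> \<rho> (A ** B) = \<rho> A ** \<rho> B"
  using hom by (auto simp: hom_def SL2Z_def GL2C_def)

text \<open>T acts diagonally, so a zero off-diagonal entry for S persists in every product of S and
  T and makes a coordinate line invariant.\<close>

lemma irreducible_offdiagonal:
  assumes irr: "irreducible_rep \<rho>" and ij: "i \<noteq> j"
  shows "\<rho> S_SL2Z $ i $ j \<noteq> 0"
proof
  assume z: "\<rho> S_SL2Z $ i $ j = 0"
  have UN: "x = i \<or> x = j" for x
    using exhaust_2[of x] exhaust_2[of i] exhaust_2[of j] ij by auto
  have s2: "sum g UNIV = g i + g j" for g :: "2 \<Rightarrow> complex"
  proof -
    have "(UNIV :: 2 set) = {i, j}" using UN by auto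
    moreover have "sum g {i, j} = g i + g j" using ij by simp
    ultimately show ?thesis by metis
  qed
  have inv: "\<rho> \<gamma> $ i $ j = 0" if "\<gamma> \<in> carrier SL2Z" for \<gamma>
  proof (rule SL2Z_induct[of "\<lambda>\<gamma>. \<rho> \<gamma> $ i $ j = 0", OF z _ _ that])
    show "\<rho> T_SL2Z $ i $ j = 0" using ij by (simp add: \<rho>T)
    fix A B assume AB: "A \<in> carrier SL2Z" "B \<in> carrier SL2Z" "\<rho> A $ i $ j = 0" "\<rho> B $ i $ j = 0"
    then show "\<rho> (A ** B) $ i $ j = 0"
      unfolding rho_mult[OF AB(1,2)] by (simp add: matrix_matrix_mult_def s2)
  qed
  define W where "W = {w :: complex^2. w $ i = 0}"
  have "vec.subspace W"
    by (auto simp: W_def vec.subspace_def)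
  moreover have "\<rho> \<gamma> *v w \<in> W" if "\<gamma> \<in> carrier SL2Z" "w \<in> W" for \<gamma> w
    using inv[OF that(1)] that(2) by (simp add: W_def matrix_vector_mult_def s2)
  ultimately have "W = {0} \<or> W = UNIV"
    using irr unfolding irreducible_rep_def by blast
  moreover have "axis j 1 \<in> W" "axis j 1 \<noteq> (0 :: complex^2)"
    using ij by (auto simp: W_def axis_def vec_eq_iff)
  moreover have "axis i 1 \<notin> W" by (simp add: W_def axis_def)
  ultimately show False by blast
qed

text \<open>The determinant is a one-dimensional character. The relations
  \<open>(ST)\<^sup>3 = S\<^sup>2\<close> and \<open>S\<^sup>4 = 1\<close> force its value at T to
  be a twelfth root of unity.\<close>

lemma exponent_sum_integral:
  obtains l :: int where "12 * (complex_of_real (m$1) + of_real (m$2)) = of_int l"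
proof -
  define \<sigma> where "\<sigma> = det (\<rho> S_SL2Z)"
  define t where "t = det (\<rho> T_SL2Z)"
  note c = S_SL2Z_carrier T_SL2Z_carrier SL2Z_mult_closed
  let ?S = "S_SL2Z" and ?T = "T_SL2Z"
  have dm: "det (\<rho> (A ** B)) = det (\<rho> A) * det (\<rho> B)" if "A \<in> carrier SL2Z" "B \<in> carrier SL2Z" for A B
    using that by (simp add: rho_mult det_mul)
  have "\<rho> ?S \<in> carrier GL2C" using hom c by (auto simp: hom_def)
  then have s0: "\<sigma> \<noteq> 0" by (simp add: GL2C_def invertible_det_nz \<sigma>_def)
  have "(?S ** ?T) ** ((?S ** ?T) ** (?S ** ?T)) = ?S ** ?S"
    by (simp add: matrix2_simps)
  then have "det (\<rho> ((?S ** ?T) ** ((?S ** ?T) ** (?S ** ?T)))) = det (\<rho> (?S ** ?S))" by simp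
  then have "(\<sigma> * t) * ((\<sigma> * t) * (\<sigma> * t)) = \<sigma> * \<sigma>"
    by (simp only: dm c \<sigma>_def t_def)
  then have st: "\<sigma> * t ^ 3 = 1"
    using s0 by (simp add: power3_eq_cube mult_ac)
  have "((?S ** ?S) ** (?S ** ?S)) ** ?S = ?S"
    by (simp add: matrix2_simps)
  then have "det (\<rho> (((?S ** ?S) ** (?S ** ?S)) ** ?S)) = det (\<rho> ?S)" by simp
  then have "((\<sigma> * \<sigma>) * (\<sigma> * \<sigma>)) * \<sigma> = \<sigma>"
    by (simp only: dm c \<sigma>_def)
  then have s4: "\<sigma> ^ 4 = 1" using s0 by (simp add: power4_eq_xxxx mult_ac)
  have "(\<sigma> * t ^ 3) ^ 4 = \<sigma> ^ 4 * t ^ 12" by (simp add: power_mult_distrib flip: power_mult)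
  then have "t ^ 12 = 1" using st s4 by simp
  moreover have "t = exp (2 * of_real pi * \<i> * (of_real (m$1) + of_real (m$2)))"
    by (simp add: t_def \<rho>T det_2 ring_distribs exp_add)
  ultimately have "exp (12 * (2 * of_real pi * \<i> * (of_real (m$1) + of_real (m$2)))) = 1"
    by (metis exp_of_nat_mult of_nat_numeral)
  then obtain n :: int where "Im (12 * (2 * of_real pi * \<i> * (of_real (m$1) + of_real (m$2)))) = of_int (2 * n) * pi"
    unfolding exp_eq_1 by blast
  then have "12 * (m$1 + m$2) = of_int n" by simp
  then have "complex_of_real (12 * (m$1 + m$2)) = of_real (of_int n)" by (simp only:)
  then show ?thesis using that[of n] by simp
qed

lemma rho_T_pow: "\<rho> T_SL2Z [^]\<^bsub>GL2C\<^esub> (n::nat) = (\<chi> i j. if i = j then exp (2 * of_real pi * \<i> * (of_nat n * of_real (m$i))) else 0)"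
proof (induction n)
  case 0
  show ?case by (simp add: GL2C_def mat_def vec_eq_iff)
next
  case (Suc n)
  have eq: "\<rho> T_SL2Z [^]\<^bsub>GL2C\<^esub> Suc n = (\<rho> T_SL2Z [^]\<^bsub>GL2C\<^esub> n) ** \<rho> T_SL2Z"
    by (simp add: GL2C_def nat_pow_def)
  show ?case
    unfolding eq Suc.IH
    by (simp add: \<rho>T vec_eq_iff forall_2 matrix_matrix_mult_def sum_2 ring_distribs exp_add mult_ac)
qed

text \<open>A power of the diagonal matrix is scalar exactly if its two entries agree. This
  identifies the level with the denominator of the difference of exponents.\<close>

lemma projective_level_iff:
  "real n * (m$1 - m$2) \<in> \<int> \<longleftrightarrow> projective_level \<rho> dvd n"
proof -
  interpret GL: group GL2C by (rule group_GL2C)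
  interpret PGL: group PGL2C by (rule group_PGL2C)
  interpret N: normal scalars_GL2C GL2C by (rule normal_scalars_GL2C)
  define x where "x = scalars_GL2C #>\<^bsub>GL2C\<^esub> \<rho> T_SL2Z"
  have Tc: "\<rho> T_SL2Z \<in> carrier GL2C" using hom T_SL2Z_carrier by (auto simp: hom_def)
  have homc: "(\<lambda>a. scalars_GL2C #>\<^bsub>GL2C\<^esub> a) \<in> hom GL2C PGL2C"
    unfolding PGL2C_def by (rule N.r_coset_hom_Mod)
  have xc: "x \<in> carrier PGL2C" using homc Tc by (auto simp: hom_def x_def)
  have "projective_level \<rho> dvd n \<longleftrightarrow> x [^]\<^bsub>PGL2C\<^esub> n = \<one>\<^bsub>PGL2C\<^esub>"
    unfolding projective_level_def x_def[symmetric] using PGL.pow_eq_id[OF xc] by simp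
  also have "x [^]\<^bsub>PGL2C\<^esub> n = scalars_GL2C #>\<^bsub>GL2C\<^esub> (\<rho> T_SL2Z [^]\<^bsub>GL2C\<^esub> n)"
    unfolding x_def using Group.hom_nat_pow[OF homc Tc GL.is_group PGL.is_group] by simp
  also have "\<one>\<^bsub>PGL2C\<^esub> = scalars_GL2C" by (simp add: PGL2C_def FactGroup_def)
  also have "scalars_GL2C #>\<^bsub>GL2C\<^esub> (\<rho> T_SL2Z [^]\<^bsub>GL2C\<^esub> n) = scalars_GL2C \<longleftrightarrow> \<rho> T_SL2Z [^]\<^bsub>GL2C\<^esub> n \<in> scalars_GL2C"
    using GL.coset_join1[of scalars_GL2C "\<rho> T_SL2Z [^]\<^bsub>GL2C\<^esub> n"] GL.coset_join2[of "\<rho> T_SL2Z [^]\<^bsub>GL2C\<^esub> n" scalars_GL2C]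
      N.subgroup_axioms N.subset Tc GL.nat_pow_closed by blast
  also have "\<dots> \<longleftrightarrow> exp (2 * of_real pi * \<i> * (of_nat n * of_real (m$1))) = exp (2 * of_real pi * \<i> * (of_nat n * of_real (m$2)))"
    unfolding rho_T_pow scalars_GL2C_def by (auto simp: vec_eq_iff forall_2 mat_def)
  also have "\<dots> \<longleftrightarrow> exp (2 * of_real pi * \<i> * (of_nat n * of_real (m$1)) - 2 * of_real pi * \<i> * (of_nat n * of_real (m$2))) = 1"
    by (simp add: exp_diff)
  also have "2 * of_real pi * \<i> * (of_nat n * of_real (m$1)) - 2 * of_real pi * \<i> * (of_nat n * of_real (m$2)) =
      \<i> * of_real (2 * pi * (real n * (m$1 - m$2)))"
    by (simp add: algebra_simps)
  also have "exp \<dots> = 1 \<longleftrightarrow> (\<exists>k::int. real n * (m$1 - m$2) = of_int k)"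
  proof -
    have "exp (\<i> * of_real (2 * pi * z)) = 1 \<longleftrightarrow> (\<exists>k::int. z = of_int k)" for z
      unfolding exp_eq_1 by simp
    then show ?thesis .
  qed
  also have "\<dots> \<longleftrightarrow> real n * (m$1 - m$2) \<in> \<int>"
    by (auto elim: Ints_cases)
  finally show ?thesis by simp
qed

end

theorem theorem1:
  fixes \<rho> :: "int^2^2 \<Rightarrow> complex^2^2"
    and m :: "real^2"
    and M :: nat
    and k :: int
    and F :: "complex \<Rightarrow> complex^2"
  assumes "\<rho> \<in> hom SL2Z GL2C"
    and "irreducible_rep \<rho>"
    and "\<rho> T_SL2Z = (\<chi> i j. if i = j then exp (2 * of_real pi * \<i> * of_real (m$i)) else 0)"
    and "1 > m$1" and "m$1 > m$2" and "m$2 \<ge> 0"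
    and "projective_level \<rho> = M" and "M > 0"
    and "\<not> M dvd 60"
    and "F \<in> vvmf_rational k \<rho> m"
    and "\<exists>\<tau>\<in>upper_half_plane. F \<tau> \<noteq> 0"
  shows "\<not> bounded_denominators m F"
proof
  assume "bounded_denominators m F"
  then obtain a :: "nat \<Rightarrow> complex^2" and B :: int where a: "has_q_expansion m F a" "B \<noteq> 0" "\<And>n i. of_int B * a n $ i \<in> \<int>"
    unfolding bounded_denominators_def by blast
  obtain l :: int where l: "12 * (complex_of_real (m$1) + of_real (m$2)) = of_int l"
    using exponent_sum_integral[OF assms(1,3)] by metis
  define r where "r = m$1 - m$2"
  have r: "0 < r" "r < 1" using assms(4-6) by (auto simp: r_def)
  interpret vector_forms "\<lambda>i. complex_of_real (m$i)" "\<lambda>i j. \<rho> S_SL2Z $ i $ j" l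
  proof
    show "complex_of_real (m$1) - complex_of_real (m$2) \<notin> \<int>"
    proof
      assume "complex_of_real (m$1) - complex_of_real (m$2) \<in> \<int>"
      then obtain z :: int where "complex_of_real r = of_int z"
        unfolding r_def by (metis Ints_cases of_real_diff)
      then have "r = of_int z" by (metis of_real_eq_iff of_real_of_int_eq)
      then show False using r by auto
    qed
  qed (use l irreducible_offdiagonal[OF assms(1,3,2)] in auto)
  define \<phi> where "\<phi> i = Abs_fps (\<lambda>n. a n $ i)" for i
  have sums: "(\<lambda>n. a n $ i * exp (2 * of_real pi * \<i> * (of_real (m$i) + of_nat n) * \<tau>)) sums (F \<tau> $ i)"
    if "Im \<tau> > 0" for \<tau> i
    using a(1) that unfolding has_q_expansion_def upper_half_plane_def by blast
  have expn: "a n $ i * exp (2 * of_real pi * \<i> * (of_real (m$i) + of_nat n) * \<tau>) =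
      exp (2 * of_real pi * \<i> * of_real (m$i) * \<tau>) * (a n $ i * nome \<tau> ^ n)" for n i \<tau>
    by (simp add: nome_def ring_distribs exp_add mult_ac flip: exp_of_nat_mult)
  have ps: "(\<lambda>n. a n $ i * nome \<tau> ^ n) sums (F \<tau> $ i / exp (2 * of_real pi * \<i> * of_real (m$i) * \<tau>))"
    if "Im \<tau> > 0" for \<tau> i
    using sums_divide[OF sums[OF that, of i], of "exp (2 * of_real pi * \<i> * of_real (m$i) * \<tau>)"]
    unfolding expn by simp
  \<comment> \<open>Convergence at one point of each circle is enough, and every real x between 0
    and 1 is the nome of a point in the upper half-plane.\<close>
  have disc: "\<phi> i \<in> disc" for i
    unfolding disc_def mem_Collect_eq fps_conv_radius_def
  proof (rule conv_radius_geI_ex)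
    fix x :: real assume x: "0 < x" "ereal x < 1"
    then obtain \<tau> where "Im \<tau> > 0" "nome \<tau> = of_real x"
      using nome_surj[of "of_real x"] by auto
    then show "\<exists>z. norm z = x \<and> summable (\<lambda>n. fps_nth (\<phi> i) n * z ^ n)"
      using ps[of \<tau> i] x by (intro exI[of _ "of_real x"]) (auto simp: \<phi>_def sums_iff)
  qed
  have tw: "F \<tau> $ i = twist i (\<phi> i) \<tau>" if "Im \<tau> > 0" for \<tau> i
    using ps[OF that, of i] by (simp add: twist_def at_nome_def eval_fps_def \<phi>_def sums_iff)
  have "\<phi> \<in> vform k"
    unfolding vform_def mem_Collect_eq
  proof (intro conjI allI impI disc)
    fix \<tau> :: complex and i :: 2
    assume \<tau>: "Im \<tau> > 0"
    then have t0: "\<tau> \<noteq> 0" by auto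
    have "automorphy S_SL2Z \<tau> powi (- k) *s F (moebius_act S_SL2Z \<tau>) = \<rho> S_SL2Z *v F \<tau>"
      using assms(10) \<tau> S_SL2Z_carrier by (auto simp: vvmf_rational_def vvmf_def upper_half_plane_def)
    then have "\<tau> powi (- k) * F (- 1 / \<tau>) $ i = (\<rho> S_SL2Z *v F \<tau>) $ i"
      by (simp add: automorphy_def moebius_act_def vec_eq_iff)
    then have "F (- 1 / \<tau>) $ i = \<tau> powi k * (\<rho> S_SL2Z $ i $ 1 * F \<tau> $ 1 + \<rho> S_SL2Z $ i $ 2 * F \<tau> $ 2)"
      using t0 by (simp add: matrix_vector_mult_def sum_2 power_int_minus field_simps)
    then show "twist i (\<phi> i) (- 1 / \<tau>) = \<tau> powi k * (\<rho> S_SL2Z $ i $ 1 * twist 1 (\<phi> 1) \<tau> + \<rho> S_SL2Z $ i $ 2 * twist 2 (\<phi> 2) \<tau>)"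
      by (simp only: tw \<tau> Im_inverse_pos)
  qed
  moreover have "\<phi> 1 \<noteq> 0"
  proof
    assume z: "\<phi> 1 = 0"
    obtain \<tau> where \<tau>: "Im \<tau> > 0" "F \<tau> \<noteq> 0"
      using assms(11) by (auto simp: upper_half_plane_def)
    have "\<phi> i = 0" for i using vform_component_zero[OF \<open>\<phi> \<in> vform k\<close> z] .
    then have "F \<tau> $ i = 0" for i using tw[OF \<tau>(1), of i] by (simp add: twist_def)
    then show False using \<tau>(2) by (simp add: vec_eq_iff)
  qed
  moreover have "bounded_fps (\<phi> 1)"
    unfolding bounded_fps_def \<phi>_def using a(2,3) by auto
  moreover have level: "real n * r \<in> \<int> \<longleftrightarrow> M dvd n" for n
    using projective_level_iff[OF assms(1,3)] assms(7) by (simp add: r_def)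
  have "real M * r \<in> \<int>" using level by simp
  then obtain b :: int where b: "real M * r = of_int b" by (auto elim: Ints_cases)
  \<comment> \<open>A common factor h would make \<open>M/h\<close> times \<open>r\<close> an
    integer, so the level \<open>M\<close> would divide \<open>M/h\<close>.\<close>
  have "coprime b (int M)"
  proof (rule coprimeI)
    fix g assume g: "g dvd b" "g dvd int M"
    define h where "h = nat \<bar>g\<bar>"
    have "int h dvd b" "h dvd M" using g by (auto simp: h_def simp flip: int_dvd_int_iff)
    then obtain b' M' where bm: "b = int h * b'" "M = h * M'" by (auto elim!: dvdE)
    have h0: "h > 0" "M' > 0" using bm assms(8) by auto
    have "real M' * r = of_int b'"
      using b h0 unfolding bm by (simp add: mult.assoc)
    then have "M dvd M'" using level[of M'] by simp
    then have "h = 1" using h0 bm(2) by (metis dvd_imp_le le_antisym mult_eq_self_implies_10 dvd_triv_right nat_mult_dvd_cancel_disj nat_dvd_1_iff_1 mult_1 mult.commute neq0_conv)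
    then show "is_unit g" by (simp add: h_def)
  qed
  moreover have "complex_of_real (m$1) - complex_of_real (m$2) = of_int b / of_nat M"
  proof -
    have "r = of_int b / real M" using b assms(8) by (simp add: field_simps)
    then have "complex_of_real r = of_int b / of_nat M" by simp
    then show ?thesis by (simp add: r_def)
  qed
  ultimately have "M dvd 60"
    using assms(8) by (intro bounded_implies_level)
  then show False using assms(9) by simp
qed

end
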